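(* The following decision problem is $\mathcal{NP}$-complete when the input graph is restricted to bipartite graphs: given a graph $G$ and two positive integers $k$ and $k'$, decide whether $G$ has a $k$-rainbow independent dominating function of weight at most $k'$.
   Context: For a positive integer $k$, a $k$-rainbow independent dominating function ($k$RiDF) of a graph $G$ is a function $f: V(G)\to\{0,1,\ldots,k\}$ such that, writing $V_i=\{v: f(v)=i\}$, for every $i\in\{1,\ldots,k\}$ the set $V_i$ is an independent set of $G$ and every vertex $v$ with $f(v)=0$ is adjacent to some vertex $u$ with $f(u)=i$. The weight of $f$ is the number of vertices $v$ with $f(v)\neq 0$. Graphs are finite and simple. *)

theory Defs
  imports "HOL-Computational_Algebra.Polynomial"
begin

section \<open>Deterministic multi-tape Turing machines\<close>

text \<open>
  Tapes are infinite in both directions. Symbols are natural numbers: \<open>0\<close> is the blank, \<open>1\<close> and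
  \<open>2\<close> represent the input bits, larger symbols are auxiliary. A machine with \<open>tm_states M = s\<close> has
  the working states \<open>0, \<dots>, s - 1\<close>, starts in state \<open>0\<close> and halts on entering state \<open>s\<close>.
  Well-formedness confines the transition function to finitely many states and symbols; its values
  outside this finite domain are never used.
\<close>

datatype head_move = MoveLeft | MoveStay | MoveRight

record turing_machine =
  tm_tapes :: nat
  tm_symbols :: nat
  tm_states :: nat
  tm_delta :: "nat \<Rightarrow> nat list \<Rightarrow> nat \<times> (nat \<times> head_move) list"

definition wf_tm :: "turing_machine \<Rightarrow> bool" where
  "wf_tm M \<longleftrightarrow>
     tm_tapes M \<ge> 1 \<and> tm_symbols M \<ge> 3 \<and>
     (\<forall>q < tm_states M. \<forall>rs. length rs = tm_tapes M \<and> (\<forall>r \<in> set rs. r < tm_symbols M) \<longrightarrow>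
        fst (tm_delta M q rs) \<le> tm_states M \<and>
        length (snd (tm_delta M q rs)) = tm_tapes M \<and>
        (\<forall>a \<in> set (snd (tm_delta M q rs)). fst a < tm_symbols M))"

type_synonym tape = "(int \<Rightarrow> nat) \<times> int"
type_synonym tm_config = "nat \<times> tape list"

fun tape_read :: "tape \<Rightarrow> nat" where
  "tape_read (c, h) = c h"

fun head_shift :: "head_move \<Rightarrow> int" where
  "head_shift MoveLeft = -1"
| "head_shift MoveStay = 0"
| "head_shift MoveRight = 1"

fun tape_act :: "nat \<times> head_move \<Rightarrow> tape \<Rightarrow> tape" where
  "tape_act (s, m) (c, h) = (c(h := s), h + head_shift m)"

fun tm_step :: "turing_machine \<Rightarrow> tm_config \<Rightarrow> tm_config" where
  "tm_step M (q, ts) =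
     (if q < tm_states M
      then (case tm_delta M q (map tape_read ts) of (q', acts) \<Rightarrow> (q', map2 tape_act acts ts))
      else (q, ts))"

definition bit_symbol :: "bool \<Rightarrow> nat" where
  "bit_symbol b = (if b then 2 else 1)"

definition string_cells :: "bool list \<Rightarrow> int \<Rightarrow> nat" where
  "string_cells x i = (if 0 \<le> i \<and> i < int (length x) then bit_symbol (x ! nat i) else 0)"

definition tm_init :: "turing_machine \<Rightarrow> bool list \<Rightarrow> tm_config" where
  "tm_init M x = (0, (string_cells x, 0) # replicate (tm_tapes M - 1) (\<lambda>_. 0, 0))"

text \<open>
  The first tape carries the input at the start and exactly the output at the end; the final head
  positions and the final contents of the other tapes are irrelevant.
\<close>

definition tm_computes_in_time ::
    "turing_machine \<Rightarrow> (bool list \<Rightarrow> bool list) \<Rightarrow> (nat \<Rightarrow> nat) \<Rightarrow> bool" where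
  "tm_computes_in_time M f T \<longleftrightarrow>
     (\<forall>x. \<exists>t \<le> T (length x). \<exists>q ts.
        (tm_step M ^^ t) (tm_init M x) = (q, ts) \<and>
        q = tm_states M \<and> fst (ts ! 0) = string_cells (f x))"

definition polytime :: "(bool list \<Rightarrow> bool list) \<Rightarrow> bool" where
  "polytime f \<longleftrightarrow> (\<exists>M (p :: nat poly). wf_tm M \<and> tm_computes_in_time M f (poly p))"


section \<open>Languages, NP and NP-completeness\<close>

type_synonym language = "bool list set"

text \<open>A self-delimiting pairing: the bits of \<open>x\<close> are doubled, and \<open>01\<close> separates \<open>x\<close> from \<open>y\<close>.\<close>

definition string_pair :: "bool list \<Rightarrow> bool list \<Rightarrow> bool list" where
  "string_pair x y = concat (map (\<lambda>b. [b, b]) x) @ [False, True] @ y"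

definition class_P :: "language set" where
  "class_P = {L. polytime (\<lambda>x. [x \<in> L])}"

definition class_NP :: "language set" where
  "class_NP = {L. \<exists>R \<in> class_P. \<exists>p :: nat poly. \<forall>x.
     x \<in> L \<longleftrightarrow> (\<exists>y. length y \<le> poly p (length x) \<and> string_pair x y \<in> R)}"

definition polytime_reducible :: "language \<Rightarrow> language \<Rightarrow> bool" where
  "polytime_reducible L L' \<longleftrightarrow> (\<exists>f. polytime f \<and> (\<forall>x. x \<in> L \<longleftrightarrow> f x \<in> L'))"

definition NP_hard :: "language \<Rightarrow> bool" where
  "NP_hard L \<longleftrightarrow> (\<forall>L' \<in> class_NP. polytime_reducible L' L)"

definition NP_complete :: "language \<Rightarrow> bool" where
  "NP_complete L \<longleftrightarrow> L \<in> class_NP \<and> NP_hard L"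


section \<open>Graphs and rainbow independent dominating functions\<close>

definition simple_graph :: "'a set \<Rightarrow> 'a set set \<Rightarrow> bool" where
  "simple_graph V E \<longleftrightarrow> finite V \<and> (\<forall>e \<in> E. e \<subseteq> V \<and> card e = 2)"

definition independent_set :: "'a set set \<Rightarrow> 'a set \<Rightarrow> bool" where
  "independent_set E S \<longleftrightarrow> (\<forall>u \<in> S. \<forall>v \<in> S. {u, v} \<notin> E)"

definition bipartite :: "'a set \<Rightarrow> 'a set set \<Rightarrow> bool" where
  "bipartite V E \<longleftrightarrow>
     (\<exists>A B. A \<union> B = V \<and> A \<inter> B = {} \<and> independent_set E A \<and> independent_set E B)"

definition kRiDF :: "nat \<Rightarrow> 'a set \<Rightarrow> 'a set set \<Rightarrow> ('a \<Rightarrow> nat) \<Rightarrow> bool" where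
  "kRiDF k V E f \<longleftrightarrow>
     (\<forall>v \<in> V. f v \<in> {0..k}) \<and>
     (\<forall>i \<in> {1..k}.
        independent_set E {v \<in> V. f v = i} \<and>
        (\<forall>v \<in> V. f v = 0 \<longrightarrow> (\<exists>u \<in> V. {u, v} \<in> E \<and> f u = i)))"

definition weight :: "'a set \<Rightarrow> ('a \<Rightarrow> nat) \<Rightarrow> nat" where
  "weight V f = card {v \<in> V. f v \<noteq> 0}"


section \<open>The decision problem\<close>

text \<open>Binary representation, least significant bit first.\<close>

fun nat_bits :: "nat \<Rightarrow> bool list" where
  "nat_bits n = (if n = 0 then [] else odd n # nat_bits (n div 2))"

declare nat_bits.simps [simp del]

definition adjacency_bits :: "nat \<Rightarrow> nat set set \<Rightarrow> bool list" where
  "adjacency_bits n E = concat (map (\<lambda>i. map (\<lambda>j. {i, j} \<in> E) [0..<n]) [0..<n])"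

text \<open>
  The graph with vertices \<open>0, \<dots>, n - 1\<close> is given by \<open>n\<close> in unary and its adjacency matrix; the two
  integers are given in binary.
\<close>

definition encode_instance :: "nat \<Rightarrow> nat set set \<Rightarrow> nat \<Rightarrow> nat \<Rightarrow> bool list" where
  "encode_instance n E k k' =
     string_pair (replicate n True)
       (string_pair (adjacency_bits n E) (string_pair (nat_bits k) (nat_bits k')))"

text \<open>
  The language of encoded yes-instances of the problem whose input graphs are restricted to
  the graph class \<open>\<C>\<close>.
\<close>

definition kRiDF_problem :: "(nat set \<Rightarrow> nat set set \<Rightarrow> bool) \<Rightarrow> language" where
  "kRiDF_problem \<C> =
     {encode_instance n E k k' | n E k k'.
        simple_graph {..<n} E \<and> \<C> {..<n} E \<and> k \<ge> 1 \<and> k' \<ge> 1 \<and>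
        (\<exists>f. kRiDF k {..<n} E f \<and> weight {..<n} f \<le> k')}"


section \<open>Sanity checks\<close>

lemma polytime_id: "polytime (\<lambda>x. x)"
proof -
  let ?M = "\<lparr>tm_tapes = 1, tm_symbols = 3, tm_states = 0, tm_delta = \<lambda>_ _. (0, [])\<rparr>"
  have "wf_tm ?M"
    by (simp add: wf_tm_def)
  moreover have "tm_computes_in_time ?M (\<lambda>x. x) (poly 0)"
    by (simp add: tm_computes_in_time_def tm_init_def)
  ultimately show ?thesis
    unfolding polytime_def by blast
qed

lemma string_pair_inject [simp]: "string_pair x y = string_pair x' y' \<longleftrightarrow> x = x' \<and> y = y'"
proof (induction x arbitrary: x')
  case Nil
  show ?case by (cases x') (auto simp: string_pair_def)
next
  case (Cons a x)
  then show ?case by (cases x') (auto simp: string_pair_def)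
qed

lemma nat_bits_inject: "nat_bits m = nat_bits n \<Longrightarrow> m = n"
proof (induction m arbitrary: n rule: less_induct)
  case (less m)
  show ?case
  proof (cases "m = 0 \<or> n = 0")
    case True
    then show ?thesis using less.prems
      by (subst (asm) (1 2) nat_bits.simps) (auto split: if_splits)
  next
    case False
    then have eq: "odd m = odd n" "nat_bits (m div 2) = nat_bits (n div 2)"
      using less.prems by (subst (asm) (1 2) nat_bits.simps; simp)+
    have "m div 2 = n div 2"
      using less.IH[of "m div 2" "n div 2"] False eq by simp
    with eq show ?thesis by presburger
  qed
qed

lemma adjacency_bits_inject:
  assumes eq: "adjacency_bits n E = adjacency_bits n E'"
    and E: "simple_graph {..<n} E" and E': "simple_graph {..<n} E'"
  shows "E = E'"
proof -
  let ?row = "\<lambda>E i. map (\<lambda>j. {i, j} \<in> E) [0..<n]"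
  have "map (?row E) [0..<n] = map (?row E') [0..<n]"
    using eq unfolding adjacency_bits_def
    by (subst (asm) concat_eq_concat_iff) (auto simp: set_zip)
  then have adj: "{i, j} \<in> E \<longleftrightarrow> {i, j} \<in> E'" if "i < n" "j < n" for i j
    using that by auto
  show ?thesis
  proof (rule set_eqI)
    fix e
    show "e \<in> E \<longleftrightarrow> e \<in> E'"
    proof (cases "e \<subseteq> {..<n} \<and> card e = 2")
      case True
      then obtain i j where "e = {i, j}" by (auto simp: card_2_iff)
      with True adj show ?thesis by auto
    next
      case False
      with E E' show ?thesis by (auto simp: simple_graph_def)
    qed
  qed
qed

lemma encode_instance_inject:
  assumes "encode_instance n E k l = encode_instance n' E' k' l'"
    and "simple_graph {..<n} E" and "simple_graph {..<n'} E'"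
  shows "n = n' \<and> E = E' \<and> k = k' \<and> l = l'"
proof -
  have "n = n'"
    using assms(1) by (simp add: encode_instance_def)
  with assms adjacency_bits_inject[of n E E'] show ?thesis
    by (auto simp: encode_instance_def dest: nat_bits_inject)
qed

end

theory Submission
  imports Defs
begin

text \<open>
  Already \<open>k = 1\<close> is hard, where the problem asks for a small independent dominating set. A
  computation of a verifier is a solution of a constraint satisfaction problem all of whose
  constraints either say that a variable has some value or forbid a triple of values. Choosing or
  rejecting a value is modelled by the two ends of an edge; a constraint of the first kind then only
  refers to choosing ends and one of the second kind only to rejecting ends, so that the constraint
  vertices can be attached without creating odd cycles. Having more copies of every constraint
  vertex than the weight bound permits forces these vertices to be dominated by chosen ends.

  Polynomial-time computability is established once and for all for functions defined by bounded
  primitive recursion over the input bits and polynomially bounded numbers: such numbers are kept as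
  head positions on otherwise empty tapes. Both the bits of the constructed instance and the check
  of a certificate (a bipartition and a colouring written in unary) are of this form. As no vertex of
  value \<open>0\<close> can exist if \<open>k\<close> is at least the number \<open>n\<close> of vertices, the binary numbers \<open>k\<close> and
  \<open>k'\<close> may be cut off at \<open>n\<close>.
\<close>

section \<open>Structured programs for Turing machines\<close>

text \<open>Starting from arbitrary verifiers instead of from satisfiability avoids a chain of
  reductions, each with its own running time to be established. Running time is the main obstacle:
  the reduction must be carried out by a machine of the given kind. Therefore the graph is defined
  by arithmetic on vertex numbers whose digits are extracted by \<open>div\<close> and
  \<open>mod\<close>, and its adjacency matrix is written out entry by entry. One radix
  \<open>D x\<close> serves for times, positions, symbols and values alike; this is wasteful but
  keeps the digits uniform.

  Triples are enough because the state and all scanned symbols are guessed together as a single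
  value. Every condition on a step then involves at most three variables, and a head variable can
  serve as the address of a cell.

  The weight bound is the number of edges between choosing and rejecting ends: a solution takes one
  end of each. Nothing prevents a dominating set from choosing several values of a variable, but as
  the remaining constraints only forbid, any selection of one chosen value per variable is a
  solution.\<close>

datatype com =
    Write nat nat
  | Move nat head_move
  | Seq com com
  | If nat nat com com
  | While nat nat com

text \<open>
  Commands act on infinitely many tapes. \<open>If j a\<close> branches on whether the symbol scanned on tape
  \<open>j\<close> is \<open>a\<close>; \<open>While j a\<close> repeats its body \<^emph>\<open>until\<close> that symbol is \<open>a\<close>. The number in the middle of
  \<open>exec\<close> is the running time.
\<close>

inductive exec :: "com \<Rightarrow> (nat \<Rightarrow> tape) \<Rightarrow> nat \<Rightarrow> (nat \<Rightarrow> tape) \<Rightarrow> bool" where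
  Write: "exec (Write j a) ts 1 (ts(j := ((fst (ts j))(snd (ts j) := a), snd (ts j))))"
| Move: "exec (Move j m) ts 1 (ts(j := (fst (ts j), snd (ts j) + head_shift m)))"
| Seq: "exec c1 ts t1 ts1 \<Longrightarrow> exec c2 ts1 t2 ts2 \<Longrightarrow> exec (Seq c1 c2) ts (Suc (t1 + t2)) ts2"
| IfTrue: "tape_read (ts j) = a \<Longrightarrow> exec c1 ts t ts' \<Longrightarrow> exec (If j a c1 c2) ts (Suc t) ts'"
| IfFalse: "tape_read (ts j) \<noteq> a \<Longrightarrow> exec c2 ts t ts' \<Longrightarrow> exec (If j a c1 c2) ts (Suc t) ts'"
| WhileStop: "tape_read (ts j) = a \<Longrightarrow> exec (While j a c) ts 1 ts"
| WhileStep: "tape_read (ts j) \<noteq> a \<Longrightarrow> exec c ts t1 ts1 \<Longrightarrow> exec (While j a c) ts1 t2 ts2 \<Longrightarrow>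
    exec (While j a c) ts (Suc (t1 + t2)) ts2"

primrec com_within :: "nat \<Rightarrow> nat \<Rightarrow> com \<Rightarrow> bool" where
  "com_within K S (Write j a) \<longleftrightarrow> j < K \<and> a < S"
| "com_within K S (Move j m) \<longleftrightarrow> j < K"
| "com_within K S (Seq c1 c2) \<longleftrightarrow> com_within K S c1 \<and> com_within K S c2"
| "com_within K S (If j a c1 c2) \<longleftrightarrow> j < K \<and> com_within K S c1 \<and> com_within K S c2"
| "com_within K S (While j a c) \<longleftrightarrow> j < K \<and> com_within K S c"

lemma com_within_mono:
  "com_within K S c \<Longrightarrow> K \<le> K' \<Longrightarrow> S \<le> S' \<Longrightarrow> com_within K' S' c"
  by (induction c) auto

text \<open>A fixed command mentions finitely many tapes and symbols. This is what allows a finite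
  machine although \<open>exec\<close> works on infinitely many tapes.\<close>

lemma com_within_ex: "\<exists>K S. com_within K S c"
proof (induction c)
  case (Write j a)
  show ?case by (rule exI[of _ "Suc j"], rule exI[of _ "Suc a"]) simp
next
  case (Move j m)
  show ?case by (rule exI[of _ "Suc j"]) simp
next
  case (Seq c1 c2)
  then obtain K1 S1 K2 S2 where "com_within K1 S1 c1" "com_within K2 S2 c2" by blast
  then have "com_within (K1 + K2) (S1 + S2) c1" "com_within (K1 + K2) (S1 + S2) c2"
    by (auto intro: com_within_mono[of K1 S1] com_within_mono[of K2 S2])
  then show ?case by auto
next
  case (If j a c1 c2)
  then obtain K1 S1 K2 S2 where "com_within K1 S1 c1" "com_within K2 S2 c2" by blast
  then have "com_within (Suc j + K1 + K2) (S1 + S2) c1" "com_within (Suc j + K1 + K2) (S1 + S2) c2"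
    by (auto intro: com_within_mono[of K1 S1] com_within_mono[of K2 S2])
  then show ?case by (intro exI[of _ "Suc j + K1 + K2"] exI[of _ "S1 + S2"]) simp
next
  case (While j a c)
  then obtain K S where "com_within K S c" by blast
  then have "com_within (Suc j + K) S c" by (rule com_within_mono) auto
  then show ?case by (intro exI[of _ "Suc j + K"] exI[of _ S]) simp
qed

section \<open>Compilation of commands into machines\<close>

text \<open>
  The control states of the compiled machine are continuations, i.e. lists of commands still to be
  executed; only finitely many of them are reachable.
\<close>

definition keep :: "nat list \<Rightarrow> (nat \<times> head_move) list" where
  "keep rs = map (\<lambda>s. (s, MoveStay)) rs"

text \<open>Each rule unfolds only the first command of the list and costs one machine step. The
  constants in the running times of \<open>exec\<close> are chosen to match, so that the simulation
  preserves times exactly.\<close>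

fun control :: "com list \<Rightarrow> nat list \<Rightarrow> com list \<times> (nat \<times> head_move) list" where
  "control [] rs = ([], keep rs)"
| "control (Write j a # k) rs = (k, (keep rs)[j := (a, MoveStay)])"
| "control (Move j m # k) rs = (k, (keep rs)[j := (rs ! j, m)])"
| "control (Seq c1 c2 # k) rs = (c1 # c2 # k, keep rs)"
| "control (If j a c1 c2 # k) rs = ((if rs ! j = a then c1 else c2) # k, keep rs)"
| "control (While j a c # k) rs = (if rs ! j = a then k else c # While j a c # k, keep rs)"

text \<open>A loop is itself the continuation of its body. Hence iterating does not lengthen the
  list, and the set is finite.\<close>

primrec conts :: "com \<Rightarrow> com list \<Rightarrow> com list set" where
  "conts (Write j a) k = {Write j a # k}"
| "conts (Move j m) k = {Move j m # k}"
| "conts (Seq c1 c2) k = insert (Seq c1 c2 # k) (conts c1 (c2 # k) \<union> conts c2 k)"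
| "conts (If j a c1 c2) k = insert (If j a c1 c2 # k) (conts c1 k \<union> conts c2 k)"
| "conts (While j a c) k = insert (While j a c # k) (conts c (While j a c # k))"

lemma finite_conts: "finite (conts c k)"
  by (induction c arbitrary: k) auto

lemma start_in_conts: "c # k \<in> conts c k"
  by (cases c) auto

lemma Nil_notin_conts: "[] \<notin> conts c k"
  by (induction c arbitrary: k) auto

lemma control_in_conts: "q \<in> conts c k \<Longrightarrow> fst (control q rs) \<in> insert k (conts c k)"
proof (induction c arbitrary: k)
  case (Seq c1 c2)
  show ?case
    using Seq.prems Seq.IH(1)[of "c2 # k"] Seq.IH(2)[of k] start_in_conts[of c1 "c2 # k"] start_in_conts[of c2 k]
    by auto
next
  case (If j a c1 c2)
  show ?case
    using If.prems If.IH(1)[of k] If.IH(2)[of k] start_in_conts[of c1 k] start_in_conts[of c2 k] by auto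
next
  case (While j a c)
  show ?case
    using While.prems While.IH[of "While j a c # k"] start_in_conts[of c "While j a c # k"]
    by (auto split: if_splits)
qed auto

primrec cont_within :: "nat \<Rightarrow> nat \<Rightarrow> com list \<Rightarrow> bool" where
  "cont_within K S [] \<longleftrightarrow> True"
| "cont_within K S (c # k) \<longleftrightarrow> com_within K S c \<and> cont_within K S k"

lemma cont_within_conts:
  "com_within K S c \<Longrightarrow> cont_within K S k \<Longrightarrow> q \<in> conts c k \<Longrightarrow> cont_within K S q"
proof (induction c arbitrary: k)
  case (Seq c1 c2)
  then show ?case using Seq.IH(1)[of "c2 # k"] Seq.IH(2)[of k] by auto
next
  case (While j a c)
  then show ?case using While.IH[of "While j a c # k"] by auto
qed auto

lemma control_within:
  assumes "cont_within K S q" "length rs = K" "\<forall>r\<in>set rs. r < S"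
  shows "length (snd (control q rs)) = K \<and> (\<forall>a\<in>set (snd (control q rs)). fst a < S)"
  using assms
proof (induction q rs rule: control.induct)
  case (2 j a k rs)
  then show ?case
    by (auto simp: keep_def dest!: set_update_subset_insert[THEN subsetD])
next
  case (3 j m k rs)
  then show ?case
    by (auto simp: keep_def dest!: set_update_subset_insert[THEN subsetD])
qed (auto simp: keep_def)

definition cont_step :: "com list \<times> tape list \<Rightarrow> com list \<times> tape list" where
  "cont_step = (\<lambda>(q, tps). case control q (map tape_read tps) of (q', acts) \<Rightarrow> (q', map2 tape_act acts tps))"

lemma map2_keep: "map2 tape_act (keep (map tape_read tps)) tps = tps"
  by (rule nth_equalityI) (auto simp: keep_def split: prod.splits, (case_tac "tps ! i"; simp)+)

lemma map2_keep_update: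
  assumes "j < length tps"
  shows "map2 tape_act ((keep (map tape_read tps))[j := a]) tps = tps[j := tape_act a (tps ! j)]"
proof (rule nth_equalityI)
  fix i assume "i < length (map2 tape_act ((keep (map tape_read tps))[j := a]) tps)"
  then have i: "i < length tps" by (simp add: keep_def)
  obtain c h where ch: "tps ! i = (c, h)" by fastforce
  show "map2 tape_act ((keep (map tape_read tps))[j := a]) tps ! i = tps[j := tape_act a (tps ! j)] ! i"
    using i assms ch by (cases "i = j") (auto simp: keep_def)
qed (simp add: keep_def)

lemma map_upt_update:
  "j < K \<Longrightarrow> (map ts [0..<K])[j := a] = map (ts(j := a)) [0..<K]"
  by (rule nth_equalityI) (auto simp: nth_list_update)

lemma map2_keep_upt:
  "map2 tape_act (keep (map (tape_read \<circ> ts) [0..<K])) (map ts [0..<K]) = map ts [0..<K]"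
  using map2_keep[of "map ts [0..<K]"] by simp

lemma map2_keep_update_upt:
  assumes "j < K"
  shows "map2 tape_act ((keep (map (tape_read \<circ> ts) [0..<K]))[j := a]) (map ts [0..<K])
    = map (ts(j := tape_act a (ts j))) [0..<K]"
  using map2_keep_update[of j "map ts [0..<K]" a] map_upt_update[OF assms, of ts "tape_act a (ts j)"]
    assms by simp

lemma exec_cont_step:
  assumes "exec c ts t ts'" "com_within K S c"
  shows "(cont_step ^^ t) (c # k, map ts [0..<K]) = (k, map ts' [0..<K])"
  using assms
proof (induction arbitrary: k rule: exec.induct)
  case (Write j a ts)
  then show ?case
    by (cases "ts j") (auto simp: cont_step_def map2_keep_update_upt simp del: fun_upd_apply)
next
  case (Move j m ts)
  then show ?case
    by (cases "ts j") (auto simp: cont_step_def map2_keep_update_upt simp del: fun_upd_apply)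
next
  case (Seq c1 ts t1 ts1 c2 t2 ts2)
  \<comment> \<open>\<open>funpow_add\<close> applies the right summand first, hence the exchange to
    \<open>t2 + t1\<close>.\<close>
  have "(cont_step ^^ Suc (t1 + t2)) (Seq c1 c2 # k, map ts [0..<K])
      = (cont_step ^^ (t2 + t1)) (c1 # c2 # k, map ts [0..<K])"
    by (simp only: funpow_Suc_right add.commute) (simp add: cont_step_def map2_keep_upt)
  with Seq show ?case by (simp only: funpow_add) simp
next
  case (IfTrue ts j a c1 t ts' c2)
  then show ?case
    by (simp only: funpow_Suc_right) (simp add: cont_step_def map2_keep_upt)
next
  case (IfFalse ts j a c2 t ts' c1)
  then show ?case
    by (simp only: funpow_Suc_right) (simp add: cont_step_def map2_keep_upt)
next
  case (WhileStop ts j a c)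
  then show ?case by (simp add: cont_step_def map2_keep_upt)
next
  case (WhileStep ts j a c t1 ts1 t2 ts2)
  have "(cont_step ^^ Suc (t1 + t2)) (While j a c # k, map ts [0..<K])
      = (cont_step ^^ (t2 + t1)) (c # While j a c # k, map ts [0..<K])"
    using WhileStep by (simp only: funpow_Suc_right add.commute) (simp add: cont_step_def map2_keep_upt)
  with WhileStep show ?case by (simp only: funpow_add) simp
qed

lemma com_machine:
  assumes within: "com_within K S c" and K: "K \<ge> 1" and S: "S \<ge> 3"
  obtains M where "wf_tm M" "tm_tapes M = K"
    "\<And>ts t ts'. exec c ts t ts' \<Longrightarrow>
      (tm_step M ^^ t) (0, map ts [0..<K]) = (tm_states M, map ts' [0..<K])"
proof -
  define Q where "Q = conts c []"
  have "finite (Q - {[c]})" by (simp add: Q_def finite_conts)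
  then obtain xs where xs: "set xs = Q - {[c]}" "distinct xs"
    using finite_distinct_list by blast
  \<comment> \<open>\<open>[c]\<close> comes first so that its number is the start state 0; the
    empty continuation is given the number \<open>n\<close>, which is the halting state.\<close>
  define L where "L = [c] # xs"
  define n where "n = length L"
  have L: "set L = Q" "distinct L"
    using xs start_in_conts[of c "[]"] by (auto simp: L_def Q_def)
  define pos where "pos q = (if q = [] then n else THE i. i < n \<and> L ! i = q)" for q
  have pos: "pos q < n \<and> L ! pos q = q" if "q \<in> Q" for q
  proof -
    have "\<exists>!i. i < n \<and> L ! i = q"
      using that L distinct_Ex1[of L q] by (simp add: n_def)
    from theI'[OF this] show ?thesis
      using that Nil_notin_conts[of c "[]"] by (auto simp: pos_def Q_def)
  qed
  have pos_Nil: "pos [] = n" by (simp add: pos_def)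
  define M where "M = \<lparr>tm_tapes = K, tm_symbols = S, tm_states = n,
    tm_delta = \<lambda>i rs. (pos (fst (control (L ! i) rs)), snd (control (L ! i) rs))\<rparr>"
  have next_in: "fst (control q rs) \<in> insert [] Q" if "q \<in> Q" for q rs
    using control_in_conts that by (simp add: Q_def)
  have wf: "wf_tm M"
    unfolding wf_tm_def
  proof (intro conjI allI impI, goal_cases)
    case (3 q rs)
    then have "L ! q \<in> Q" using L(1) by (auto simp: M_def n_def)
    then show ?case
      using next_in[of "L ! q" rs] pos[of "fst (control (L ! q) rs)"] pos_Nil by (auto simp: M_def)
  next
    case (4 q rs)
    then have "L ! q \<in> Q" using L(1) by (auto simp: M_def n_def)
    then show ?case
      using control_within[of K S "L ! q" rs] cont_within_conts[OF within, of "[]" "L ! q"] 4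
      by (simp add: M_def Q_def)
  next
    case (5 q rs)
    then have "L ! q \<in> Q" using L(1) by (auto simp: M_def n_def)
    then show ?case
      using control_within[of K S "L ! q" rs] cont_within_conts[OF within, of "[]" "L ! q"] 5
      by (simp add: M_def Q_def)
  qed (use K S in \<open>auto simp: M_def\<close>)
  have step: "tm_step M (pos q, tps) = (pos (fst (cont_step (q, tps))), snd (cont_step (q, tps)))
      \<and> fst (cont_step (q, tps)) \<in> insert [] Q" if "q \<in> insert [] Q" for q tps
    using that next_in[of q "map tape_read tps"] pos[of q]
    by (auto simp: M_def cont_step_def pos_Nil map2_keep split: prod.splits)
  have steps: "(tm_step M ^^ t) (pos q, tps) =
      (pos (fst ((cont_step ^^ t) (q, tps))), snd ((cont_step ^^ t) (q, tps)))
      \<and> fst ((cont_step ^^ t) (q, tps)) \<in> insert [] Q" if "q \<in> insert [] Q" for q tps t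
  proof (induction t)
    case 0
    then show ?case using that by simp
  next
    case (Suc t)
    then show ?case
      using step[of "fst ((cont_step ^^ t) (q, tps))" "snd ((cont_step ^^ t) (q, tps))"] by simp
  qed
  have "pos [c] = 0"
  proof -
    have "[c] \<in> Q" by (simp add: Q_def start_in_conts)
    then have "L ! pos [c] = L ! 0" "pos [c] < n" using pos by (auto simp: L_def)
    then show ?thesis using nth_eq_iff_index_eq[OF L(2), of "pos [c]" 0] by (simp add: n_def L_def)
  qed
  then have "(tm_step M ^^ t) (0, map ts [0..<K]) = (tm_states M, map ts' [0..<K])"
    if "exec c ts t ts'" for ts t ts'
    using steps[of "[c]" t "map ts [0..<K]"] exec_cont_step[OF that within, of "[]"]
    by (simp add: Q_def start_in_conts pos_Nil M_def)
  with wf show ?thesis by (intro that[of M]) (auto simp: M_def)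
qed

section \<open>Transfer to polynomial time, and upper bounds on running times\<close>

definition input_tapes :: "bool list \<Rightarrow> nat \<Rightarrow> tape" where
  "input_tapes x = (\<lambda>_. (\<lambda>_. 0, 0))(0 := (string_cells x, 0))"

lemma polytimeI:
  assumes "\<And>x. \<exists>t ts. t \<le> poly p (length x) \<and> exec c (input_tapes x) t ts \<and>
    fst (ts 0) = string_cells (f x)"
  shows "polytime f"
proof -
  obtain K0 S0 where "com_within K0 S0 c" using com_within_ex by blast
  define K where "K = Suc K0"
  have "com_within K (max 3 S0) c"
    by (rule com_within_mono[OF \<open>com_within K0 S0 c\<close>]) (auto simp: K_def)
  then obtain M where M: "wf_tm M" "tm_tapes M = K"
    "\<And>ts t ts'. exec c ts t ts' \<Longrightarrow>
      (tm_step M ^^ t) (0, map ts [0..<K]) = (tm_states M, map ts' [0..<K])"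
    using com_machine[of K "max 3 S0" c] by (auto simp: K_def)
  have init: "tm_init M x = (0, map (input_tapes x) [0..<K])" for x
    unfolding tm_init_def M(2) K_def upt_conv_Cons[OF zero_less_Suc]
    by (auto simp: input_tapes_def map_replicate_const intro!: nth_equalityI)
  have "tm_computes_in_time M f (poly p)"
    unfolding tm_computes_in_time_def
  proof
    fix x
    obtain t ts where "t \<le> poly p (length x)" "exec c (input_tapes x) t ts"
      "fst (ts 0) = string_cells (f x)" using assms by blast
    then show "\<exists>t \<le> poly p (length x). \<exists>q ts.
        (tm_step M ^^ t) (tm_init M x) = (q, ts) \<and>
        q = tm_states M \<and> fst (ts ! 0) = string_cells (f x)"
      using M(3) by (intro exI[of _ t] conjI exI[of _ "tm_states M"] exI[of _ "map ts [0..<K]"])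
        (auto simp: init K_def nth_append simp del: upt_Suc)
  qed
  with M(1) show ?thesis unfolding polytime_def by blast
qed

definition runs :: "com \<Rightarrow> (nat \<Rightarrow> tape) \<Rightarrow> nat \<Rightarrow> (nat \<Rightarrow> tape) \<Rightarrow> bool" where
  "runs c ts T ts' \<longleftrightarrow> (\<exists>t\<le>T. exec c ts t ts')"

lemma runs_mono: "runs c ts T ts' \<Longrightarrow> T \<le> T' \<Longrightarrow> runs c ts T' ts'"
  unfolding runs_def using order_trans by blast

lemma runs_Seq: "runs c1 ts T1 ts1 \<Longrightarrow> runs c2 ts1 T2 ts2 \<Longrightarrow> runs (Seq c1 c2) ts (T1 + T2 + 1) ts2"
  unfolding runs_def using exec.Seq[of c1 ts _ ts1 c2 _ ts2] add_mono by fastforce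

lemma runs_Seq':
  "runs c1 ts T1 ts1 \<Longrightarrow> runs c2 ts1 T2 ts2 \<Longrightarrow> T1 + T2 + 1 \<le> T \<Longrightarrow> runs (Seq c1 c2) ts T ts2"
  using runs_Seq runs_mono by blast

lemma runs_IfTrue: "tape_read (ts j) = a \<Longrightarrow> runs c1 ts T ts' \<Longrightarrow> runs (If j a c1 c2) ts (T + 1) ts'"
  unfolding runs_def using exec.IfTrue[of ts j a c1 _ ts' c2] by fastforce

lemma runs_IfFalse: "tape_read (ts j) \<noteq> a \<Longrightarrow> runs c2 ts T ts' \<Longrightarrow> runs (If j a c1 c2) ts (T + 1) ts'"
  unfolding runs_def using exec.IfFalse[of ts j a c2 _ ts' c1] by fastforce

lemma runs_Write:
  "ts' = ts(j := ((fst (ts j))(snd (ts j) := a), snd (ts j))) \<Longrightarrow> runs (Write j a) ts 1 ts'"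
  unfolding runs_def by (rule exI[of _ 1]) (simp add: exec.Write[simplified])

lemma runs_Move:
  "ts' = ts(j := (fst (ts j), snd (ts j) + head_shift m)) \<Longrightarrow> runs (Move j m) ts 1 ts'"
  unfolding runs_def by (rule exI[of _ 1]) (simp add: exec.Move[simplified])

text \<open>The states of the loop are indexed by the number of iterations still to come, so the
  index falls to 0 where the exit condition holds.\<close>

lemma runs_While:
  assumes "\<And>i. i < n \<Longrightarrow> runs c (S (Suc i)) T (S i)"
    and "\<And>i. i < n \<Longrightarrow> tape_read (S (Suc i) j) \<noteq> a"
    and "tape_read (S 0 j) = a"
  shows "runs (While j a c) (S n) (n * (T + 1) + 1) (S 0)"
  using assms
proof (induction n)
  case 0
  then show ?case
    unfolding runs_def by (intro exI[of _ 1]) (simp add: exec.WhileStop[simplified])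
next
  case (Suc n)
  obtain t1 where t1: "t1 \<le> T" "exec c (S (Suc n)) t1 (S n)"
    using Suc.prems(1)[of n] by (auto simp: runs_def)
  obtain t2 where t2: "t2 \<le> n * (T + 1) + 1" "exec (While j a c) (S n) t2 (S 0)"
    using Suc.IH Suc.prems unfolding runs_def by (metis less_SucI)
  have "exec (While j a c) (S (Suc n)) (Suc (t1 + t2)) (S 0)"
    using Suc.prems(2)[of n] t1 t2 by (intro exec.WhileStep) auto
  moreover have "Suc (t1 + t2) \<le> Suc n * (T + 1) + 1" using t1 t2 by simp
  ultimately show ?case unfolding runs_def by blast
qed

lemma poly_nat_mono: "x \<le> y \<Longrightarrow> poly (p :: nat poly) x \<le> poly p y"
  by (induction p) (simp_all add: mult_mono)

section \<open>Register machines on tapes\<close>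

text \<open>
  Tape \<open>0\<close> is a write-only output tape, tape \<open>1\<close> holds the input behind the end marker \<open>3\<close>, and the
  content of register \<open>j\<close> is the head position on tape \<open>j + 2\<close>, where a marker at the origin permits
  a test for zero.
\<close>

definition marked :: "bool list \<Rightarrow> int \<Rightarrow> nat" where
  "marked x i = (if i = 0 then 3 else string_cells x (i - 1))"

definition st :: "bool list \<Rightarrow> bool list \<Rightarrow> nat \<Rightarrow> (nat \<Rightarrow> nat) \<Rightarrow> nat \<Rightarrow> tape" where
  "st x u h s j = (case j of 0 \<Rightarrow> (string_cells u, int (length u)) | Suc i \<Rightarrow>
     (case i of 0 \<Rightarrow> (marked x, int h) | Suc k \<Rightarrow> (marked [], int (s k))))"

lemma read_register: "tape_read (st x u h s (Suc (Suc j))) = (if s j = 0 then 3 else 0)"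
  by (simp add: st_def marked_def string_cells_def)

lemma read_input:
  "tape_read (st x u h s (Suc 0)) =
    (if h = 0 then 3 else if h \<le> length x then bit_symbol (x ! (h - 1)) else 0)"
  by (simp add: st_def marked_def string_cells_def nat_diff_distrib)

abbreviation "Inc j \<equiv> Move (Suc (Suc j)) MoveRight"
abbreviation "Dec j \<equiv> Move (Suc (Suc j)) MoveLeft"
abbreviation "Until_zero j \<equiv> While (Suc (Suc j)) 3"
definition "Zero j = Until_zero j (Dec j)"
definition "Transfer i j = Until_zero i (Seq (Dec i) (Inc j))"
definition "Emit b = Seq (Write 0 (bit_symbol b)) (Move 0 MoveRight)"

lemma runs_Inc: "s' = s(j := Suc (s j)) \<Longrightarrow> runs (Inc j) (st x u h s) 1 (st x u h s')"
  by (rule runs_Move) (auto simp: st_def fun_eq_iff split: nat.splits)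

lemma runs_Dec: "s j \<noteq> 0 \<Longrightarrow> s' = s(j := s j - 1) \<Longrightarrow> runs (Dec j) (st x u h s) 1 (st x u h s')"
  by (rule runs_Move) (auto simp: st_def fun_eq_iff split: nat.splits)

lemma runs_head_right: "runs (Move (Suc 0) MoveRight) (st x u h s) 1 (st x u (Suc h) s)"
  by (rule runs_Move) (auto simp: st_def fun_eq_iff split: nat.splits)

lemma runs_head_left: "runs (Move (Suc 0) MoveLeft) (st x u (Suc h) s) 1 (st x u h s)"
  by (rule runs_Move) (auto simp: st_def fun_eq_iff split: nat.splits)

lemma string_cells_snoc: "string_cells (u @ [b]) = (string_cells u)(int (length u) := bit_symbol b)"
  by (auto simp: string_cells_def fun_eq_iff nth_append)

lemma runs_Emit: "runs (Emit b) (st x u h s) 3 (st x (u @ [b]) h s)"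
proof -
  let ?ts = "(st x u h s)(0 := (string_cells (u @ [b]), int (length u)))"
  have "runs (Write 0 (bit_symbol b)) (st x u h s) 1 ?ts"
    by (rule runs_Write) (simp add: st_def string_cells_snoc)
  moreover have "runs (Move 0 MoveRight) ?ts 1 (st x (u @ [b]) h s)"
    by (rule runs_Move) (auto simp: st_def fun_eq_iff split: nat.splits)
  ultimately show ?thesis
    unfolding Emit_def by (rule runs_Seq') simp
qed

lemma runs_Zero:
  assumes "s' = s(j := 0)"
  shows "runs (Zero j) (st x u h s) (2 * s j + 1) (st x u h s')"
proof -
  let ?S = "\<lambda>i. st x u h (s(j := i))"
  have "runs (Until_zero j (Dec j)) (?S (s j)) (s j * (1 + 1) + 1) (?S 0)"
  proof (rule runs_While)
    fix i
    show "runs (Dec j) (?S (Suc i)) 1 (?S i)" by (rule runs_Dec) auto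
  qed (auto simp: read_register)
  then show ?thesis using assms by (simp add: Zero_def mult_2)
qed

lemma runs_Transfer:
  assumes "i \<noteq> j" "s' = s(i := 0, j := s j + s i)"
  shows "runs (Transfer i j) (st x u h s) (4 * s i + 1) (st x u h s')"
proof -
  let ?S = "\<lambda>r. st x u h (s(i := r, j := s j + s i - r))"
  have "runs (Until_zero i (Seq (Dec i) (Inc j))) (?S (s i)) (s i * (3 + 1) + 1) (?S 0)"
  proof (rule runs_While)
    fix r assume r: "r < s i"
    have "runs (Dec i) (?S (Suc r)) 1 (st x u h (s(i := r, j := s j + s i - Suc r)))"
      by (rule runs_Dec) (use assms in auto)
    moreover have "runs (Inc j) (st x u h (s(i := r, j := s j + s i - Suc r))) 1 (?S r)"
      by (rule runs_Inc) (use assms r in \<open>auto simp: fun_eq_iff\<close>)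
    ultimately show "runs (Seq (Dec i) (Inc j)) (?S (Suc r)) 3 (?S r)"
      by (rule runs_Seq') simp
  qed (use assms in \<open>auto simp: read_register\<close>)
  then show ?thesis using assms by (simp add: Transfer_def mult.commute)
qed

lemma runs_rewind:
  "runs (While (Suc 0) 3 (Move (Suc 0) MoveLeft)) (st x u h s) (h * (1 + 1) + 1) (st x u 0 s)"
  by (rule runs_While[of h _ "\<lambda>i. st x u i s"])
    (auto simp: read_input bit_symbol_def intro: runs_head_left[simplified])

section \<open>Functions computable with registers in polynomial time\<close>

text \<open>
  An environment \<open>es\<close> lists the values of the bound variables, the most recently bound one first;
  \<open>\<rho>\<close> says in which registers they are held. Registers from \<open>e\<close> on are free, and \<open>e\<close> receives the
  result. Polynomial time is measured in any bound \<open>m\<close> on the input length and on the variables.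
\<close>

definition bounded_env :: "nat \<Rightarrow> bool list \<Rightarrow> nat list \<Rightarrow> nat \<Rightarrow> bool" where
  "bounded_env n x es m \<longleftrightarrow> length es = n \<and> length x \<le> m \<and> (\<forall>v\<in>set es. v \<le> m)"

definition poly_bounded :: "nat \<Rightarrow> (bool list \<Rightarrow> nat list \<Rightarrow> nat) \<Rightarrow> bool" where
  "poly_bounded n F \<longleftrightarrow> (\<exists>q. \<forall>x es m. bounded_env n x es m \<longrightarrow> F x es \<le> poly q m)"

definition stores :: "nat \<Rightarrow> (nat \<Rightarrow> nat) \<Rightarrow> nat \<Rightarrow> nat list \<Rightarrow> (nat \<Rightarrow> nat) \<Rightarrow> bool" where
  "stores n \<rho> e es s \<longleftrightarrow> (\<forall>k<n. s (\<rho> k) = es ! k) \<and> (\<forall>j\<ge>e. s j = 0)"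

text \<open>The program may depend on where the variables are kept, so the same function can be
  compiled at any depth of nesting. The size bound belongs to the notion because a value may become
  a loop count or a bound variable of a surrounding construct.\<close>

definition fn :: "nat \<Rightarrow> (bool list \<Rightarrow> nat list \<Rightarrow> nat) \<Rightarrow> bool" where
  "fn n F \<longleftrightarrow> poly_bounded n F \<and>
    (\<forall>e \<rho>. (\<forall>k<n. \<rho> k < e) \<longrightarrow> (\<exists>c p. \<forall>x es s u m.
      bounded_env n x es m \<longrightarrow> stores n \<rho> e es s \<longrightarrow>
      runs c (st x u 0 s) (poly p m) (st x u 0 (s(e := F x es)))))"

definition outp :: "nat \<Rightarrow> (bool list \<Rightarrow> nat list \<Rightarrow> bool list) \<Rightarrow> bool" where
  "outp n G \<longleftrightarrow>
    (\<forall>e \<rho>. (\<forall>k<n. \<rho> k < e) \<longrightarrow> (\<exists>c p. \<forall>x es s u m.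
      bounded_env n x es m \<longrightarrow> stores n \<rho> e es s \<longrightarrow>
      runs c (st x u 0 s) (poly p m) (st x (u @ G x es) 0 s)))"

section \<open>Basic functions and bounded primitive recursion\<close>

lemma fn_cong:
  assumes "\<And>x es. length es = n \<Longrightarrow> F x es = G x es"
  shows "fn n F \<longleftrightarrow> fn n G"
proof -
  have *: "fn n G" if "fn n F" "\<And>x es. length es = n \<Longrightarrow> F x es = G x es" for F G
    using that unfolding fn_def poly_bounded_def bounded_env_def by (simp cong: conj_cong)
  show ?thesis using *[of F G] *[of G F] assms by auto
qed

lemma fnD:
  assumes "fn n F" "\<forall>k<n. \<rho> k < e"
  obtains c p where "\<And>x es s u m. bounded_env n x es m \<Longrightarrow> stores n \<rho> e es s \<Longrightarrow>
      runs c (st x u 0 s) (poly p m) (st x u 0 (s(e := F x es)))"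
  using assms unfolding fn_def by blast

lemma fn_poly_bounded: "fn n F \<Longrightarrow> poly_bounded n F"
  by (simp add: fn_def)

lemma poly_bounded_le: "poly_bounded n F \<Longrightarrow> (\<And>x es. length es = n \<Longrightarrow> G x es \<le> F x es) \<Longrightarrow> poly_bounded n G"
  unfolding poly_bounded_def bounded_env_def by (meson order_trans)

lemma poly_bounded_const: "poly_bounded n (\<lambda>x es. c)"
  unfolding poly_bounded_def by (rule exI[of _ "[:c:]"]) simp

lemma poly_bounded_add:
  assumes "poly_bounded n F" "poly_bounded n G"
  shows "poly_bounded n (\<lambda>x es. F x es + G x es)"
proof -
  obtain p q where "\<forall>x es m. bounded_env n x es m \<longrightarrow> F x es \<le> poly p m"
    "\<forall>x es m. bounded_env n x es m \<longrightarrow> G x es \<le> poly q m"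
    using assms unfolding poly_bounded_def by blast
  then show ?thesis unfolding poly_bounded_def by (intro exI[of _ "p + q"]) (simp add: add_mono)
qed

lemma poly_bounded_mult:
  assumes "poly_bounded n F" "poly_bounded n G"
  shows "poly_bounded n (\<lambda>x es. F x es * G x es)"
proof -
  obtain p q where "\<forall>x es m. bounded_env n x es m \<longrightarrow> F x es \<le> poly p m"
    "\<forall>x es m. bounded_env n x es m \<longrightarrow> G x es \<le> poly q m"
    using assms unfolding poly_bounded_def by blast
  then show ?thesis unfolding poly_bounded_def by (intro exI[of _ "p * q"]) (simp add: mult_mono)
qed

text \<open>Register \<open>e\<close> is 0 already; \<open>Zero e\<close> just serves as a command
  without effect.\<close>

lemma fn_0: "fn n (\<lambda>x es. 0)"
  unfolding fn_def
proof (intro conjI allI impI)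
  show "poly_bounded n (\<lambda>x es. 0)" by (rule poly_bounded_const)
  fix e :: nat and \<rho>
  have "runs (Zero e) (st x u 0 s) (poly 1 m) (st x u 0 (s(e := 0)))"
    if "stores n \<rho> e es s" for x u s es m
    using runs_Zero[of "s(e := 0)" s e x u 0] that by (simp add: stores_def)
  then show "\<exists>c p. \<forall>x es s u m. bounded_env n x es m \<longrightarrow> stores n \<rho> e es s \<longrightarrow>
      runs c (st x u 0 s) (poly p m) (st x u 0 (s(e := 0)))" by blast
qed

lemma fn_Suc:
  assumes "fn n F" shows "fn n (\<lambda>x es. Suc (F x es))"
  unfolding fn_def
proof (intro conjI allI impI)
  show "poly_bounded n (\<lambda>x es. Suc (F x es))"
    using poly_bounded_add[OF fn_poly_bounded[OF assms] poly_bounded_const[of n 1]] by simp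
  fix e :: nat and \<rho> assume "\<forall>k<n. \<rho> k < e"
  then obtain c p where c: "\<And>x es s u m. bounded_env n x es m \<Longrightarrow> stores n \<rho> e es s \<Longrightarrow>
      runs c (st x u 0 s) (poly p m) (st x u 0 (s(e := F x es)))"
    using fnD[OF assms] by blast
  have "runs (Seq c (Inc e)) (st x u 0 s) (poly (p + [:2:]) m) (st x u 0 (s(e := Suc (F x es))))"
    if "bounded_env n x es m" "stores n \<rho> e es s" for x u s es m
    by (rule runs_Seq'[OF c[OF that] runs_Inc]) auto
  then show "\<exists>c p. \<forall>x es s u m. bounded_env n x es m \<longrightarrow> stores n \<rho> e es s \<longrightarrow>
      runs c (st x u 0 s) (poly p m) (st x u 0 (s(e := Suc (F x es))))" by blast
qed

text \<open>A head position can only be copied by running it down. The variable is emptied into both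
  \<open>e\<close> and the scratch register \<open>Suc e\<close>, and the latter is then emptied
  back into the variable.\<close>

lemma fn_hd: "fn (Suc n) (\<lambda>x es. hd es)"
  unfolding fn_def
proof (intro conjI allI impI)
  have le: "hd es \<le> m" if "bounded_env (Suc n) x es m" for x es m
    using that by (cases es) (auto simp: bounded_env_def)
  then show "poly_bounded (Suc n) (\<lambda>x es. hd es)"
    unfolding poly_bounded_def by (intro exI[of _ "[:0, 1:]"]) auto
  fix e :: nat and \<rho> assume \<rho>: "\<forall>k<Suc n. \<rho> k < e"
  define c where "c = Seq (Until_zero (\<rho> 0) (Seq (Dec (\<rho> 0)) (Seq (Inc e) (Inc (Suc e)))))
    (Transfer (Suc e) (\<rho> 0))"
  have "runs c (st x u 0 s) (poly [:3, 10:] m) (st x u 0 (s(e := hd es)))"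
    if b: "bounded_env (Suc n) x es m" and s: "stores (Suc n) \<rho> e es s" for x u s es m
  proof -
    define v where "v = hd es"
    have "es \<noteq> []" using b by (auto simp: bounded_env_def)
    then have v: "s (\<rho> 0) = v" "s e = 0" "s (Suc e) = 0" and r: "\<rho> 0 < e"
      using s \<rho> by (auto simp: stores_def v_def hd_conv_nth)
    let ?S = "\<lambda>i. st x u 0 (s(\<rho> 0 := i, e := v - i, Suc e := v - i))"
    have "runs (Until_zero (\<rho> 0) (Seq (Dec (\<rho> 0)) (Seq (Inc e) (Inc (Suc e))))) (?S v)
      (v * (5 + 1) + 1) (?S 0)"
    proof (rule runs_While)
      fix i assume i: "i < v"
      let ?s1 = "s(\<rho> 0 := i, e := v - Suc i, Suc e := v - Suc i)"
      let ?s2 = "s(\<rho> 0 := i, e := v - i, Suc e := v - Suc i)"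
      have "runs (Dec (\<rho> 0)) (?S (Suc i)) 1 (st x u 0 ?s1)"
        by (rule runs_Dec) (use r in auto)
      moreover have "runs (Inc e) (st x u 0 ?s1) 1 (st x u 0 ?s2)"
        by (rule runs_Inc) (use r i in \<open>auto simp: fun_eq_iff\<close>)
      moreover have "runs (Inc (Suc e)) (st x u 0 ?s2) 1 (?S i)"
        by (rule runs_Inc) (use r i in \<open>auto simp: fun_eq_iff\<close>)
      ultimately show "runs (Seq (Dec (\<rho> 0)) (Seq (Inc e) (Inc (Suc e)))) (?S (Suc i)) 5 (?S i)"
        by (intro runs_Seq'[OF _ runs_Seq[OF _ _]]) auto
    qed (use r in \<open>auto simp: read_register\<close>)
    moreover have "runs (Transfer (Suc e) (\<rho> 0)) (?S 0) (4 * v + 1) (st x u 0 (s(e := v)))"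
      using runs_Transfer[of "Suc e" "\<rho> 0" "s(e := v)" "s(\<rho> 0 := 0, e := v - 0, Suc e := v - 0)" x u 0] r v
      by (auto simp: fun_eq_iff)
    moreover have "?S v = st x u 0 s" using v by (auto intro!: arg_cong[of _ _ "st x u 0"])
    ultimately have c: "runs c (st x u 0 s) (v * (5 + 1) + 1 + (4 * v + 1) + 1) (st x u 0 (s(e := v)))"
      unfolding c_def by (simp only: runs_Seq)
    have "v \<le> m" using le[OF b] by (simp add: v_def)
    then show ?thesis unfolding v_def[symmetric] by (intro runs_mono[OF c]) simp
  qed
  then show "\<exists>c p. \<forall>x es s u m. bounded_env (Suc n) x es m \<longrightarrow> stores (Suc n) \<rho> e es s \<longrightarrow>
      runs c (st x u 0 s) (poly p m) (st x u 0 (s(e := hd es)))" by blast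
qed

lemma bounded_env_tl: "bounded_env (Suc n) x es m \<Longrightarrow> bounded_env n x (tl es) m"
  by (cases es) (auto simp: bounded_env_def)

text \<open>Skipping the innermost variable needs no code, only a shift of the register assignment.
  Together with \<open>fn_hd\<close> this gives access to all variables.\<close>

lemma fn_tl:
  assumes "fn n F" shows "fn (Suc n) (\<lambda>x es. F x (tl es))"
  unfolding fn_def
proof (intro conjI allI impI)
  show "poly_bounded (Suc n) (\<lambda>x es. F x (tl es))"
    using fn_poly_bounded[OF assms] bounded_env_tl unfolding poly_bounded_def by blast
  fix e :: nat and \<rho> assume \<rho>: "\<forall>k<Suc n. \<rho> k < e"
  then have "\<forall>k<n. (\<rho> \<circ> Suc) k < e" by auto
  then obtain c p where c: "\<And>x es s u m. bounded_env n x es m \<Longrightarrow> stores n (\<rho> \<circ> Suc) e es s \<Longrightarrow>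
      runs c (st x u 0 s) (poly p m) (st x u 0 (s(e := F x es)))"
    by (rule fnD[OF assms]) blast
  have s: "stores n (\<rho> \<circ> Suc) e (tl es) s" if "bounded_env (Suc n) x es m" "stores (Suc n) \<rho> e es s" for x es m s
    using that by (cases es) (auto simp: bounded_env_def stores_def)
  have "runs c (st x u 0 s) (poly p m) (st x u 0 (s(e := F x (tl es))))"
    if "bounded_env (Suc n) x es m" "stores (Suc n) \<rho> e es s" for x es m s u
    by (rule c[OF bounded_env_tl[OF that(1)] s[OF that]])
  then show "\<exists>c p. \<forall>x es s u m. bounded_env (Suc n) x es m \<longrightarrow> stores (Suc n) \<rho> e es s \<longrightarrow>
      runs c (st x u 0 s) (poly p m) (st x u 0 (s(e := F x (tl es))))" by blast
qed

text \<open>Register \<open>e\<close> counts the remaining rounds and finally takes the result,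
  \<open>e + 1\<close> holds the accumulator, \<open>e + 2\<close> the index and
  \<open>e + 3\<close> the next value. The bound on all intermediate values matters because numbers
  are kept in unary: iterated doubling would leave polynomial time.\<close>

lemma fn_rec:
  assumes N: "fn n N" and A: "fn n A"
    and B: "fn (Suc (Suc n)) (\<lambda>x es. B x (tl (tl es)) (hd (tl es)) (hd es))"
    and bound: "\<exists>q. \<forall>x es m. bounded_env n x es m \<longrightarrow>
      (\<forall>i\<le>N x es. rec_nat (A x es) (B x es) i \<le> poly q m)"
  shows "fn n (\<lambda>x es. rec_nat (A x es) (B x es) (N x es))"
  unfolding fn_def
proof (intro conjI allI impI)
  obtain q where q: "\<And>x es m i. bounded_env n x es m \<Longrightarrow> i \<le> N x es \<Longrightarrow>
      rec_nat (A x es) (B x es) i \<le> poly q m"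
    using bound by blast
  obtain qN where qN: "\<And>x es m. bounded_env n x es m \<Longrightarrow> N x es \<le> poly qN m"
    using fn_poly_bounded[OF N] unfolding poly_bounded_def by blast
  show "poly_bounded n (\<lambda>x es. rec_nat (A x es) (B x es) (N x es))"
    unfolding poly_bounded_def using q by blast
  fix e :: nat and \<rho> assume \<rho>: "\<forall>k<n. \<rho> k < e"
  define \<rho>' where "\<rho>' k = (case k of 0 \<Rightarrow> e + 1 | Suc i \<Rightarrow> (case i of 0 \<Rightarrow> e + 2 | Suc j \<Rightarrow> \<rho> j))" for k
  obtain cN pN where cN: "\<And>x es s u m. bounded_env n x es m \<Longrightarrow> stores n \<rho> e es s \<Longrightarrow>
      runs cN (st x u 0 s) (poly pN m) (st x u 0 (s(e := N x es)))"
    by (rule fnD[OF N \<rho>]) blast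
  have "\<forall>k<n. \<rho> k < e + 1" using \<rho> by auto
  then obtain cA pA where cA: "\<And>x es s u m. bounded_env n x es m \<Longrightarrow> stores n \<rho> (e + 1) es s \<Longrightarrow>
      runs cA (st x u 0 s) (poly pA m) (st x u 0 (s(e + 1 := A x es)))"
    by (rule fnD[OF A]) blast
  have "\<forall>k<Suc (Suc n). \<rho>' k < e + 3" using \<rho> by (force simp: \<rho>'_def split: nat.splits)
  then obtain cB pB where cB: "\<And>x es s u m. bounded_env (Suc (Suc n)) x es m \<Longrightarrow>
      stores (Suc (Suc n)) \<rho>' (e + 3) es s \<Longrightarrow>
      runs cB (st x u 0 s) (poly pB m) (st x u 0 (s(e + 3 := B x (tl (tl es)) (hd (tl es)) (hd es))))"
    by (rule fnD[OF B]) blast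
  define body where "body = Seq cB (Seq (Zero (e + 1)) (Seq (Transfer (e + 3) (e + 1))
    (Seq (Inc (e + 2)) (Dec e))))"
  define c where "c = Seq cN (Seq cA (Seq (Until_zero e body) (Seq (Zero (e + 2)) (Transfer (e + 1) e))))"
  \<comment> \<open>The body sees two further variables, the accumulator and the index. Its time
    bound is therefore taken at \<open>m\<close> plus the bounds for both.\<close>
  define pb where "pb = pcompose pB ([:0, 1:] + q + qN) + [:6:] * q + [:8:]"
  define p where "p = pN + pA + qN * (pb + [:1:]) + [:2:] * qN + [:4:] * q + [:7:]"
  have "runs c (st x u 0 s) (poly p m) (st x u 0 (s(e := rec_nat (A x es) (B x es) (N x es))))"
    if b: "bounded_env n x es m" and s: "stores n \<rho> e es s" for x u s es m
  proof -
    define M where "M = N x es"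
    define V where "V = rec_nat (A x es) (B x es)"
    have V: "V i \<le> poly q m" if "i \<le> M" for i using q[OF b, of i] that by (simp add: V_def M_def)
    have M: "M \<le> poly qN m" using qN[OF b] by (simp add: M_def)
    let ?s = "\<lambda>r. s(e := r, e + 1 := V (M - r), e + 2 := M - r)"
    let ?S = "\<lambda>r. st x u 0 (?s r)"
    have z: "s e = 0" "s (e + 1) = 0" "s (e + 2) = 0" "s (e + 3) = 0"
      using s by (auto simp: stores_def)
    have 1: "runs cN (st x u 0 s) (poly pN m) (st x u 0 (s(e := M)))"
      using cN[OF b s] by (simp add: M_def)
    have "stores n \<rho> (e + 1) es (s(e := M))" using s \<rho> by (auto simp: stores_def)
    from cA[OF b this] have 2: "runs cA (st x u 0 (s(e := M))) (poly pA m) (?S M)"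
      using z by (auto simp: V_def fun_upd_idem)
    have 3: "runs (Until_zero e body) (?S M) (M * (poly pb m + 1) + 1) (?S 0)"
    proof (rule runs_While)
      fix r assume r: "r < M"
      define i where "i = M - Suc r"
      have i: "i < M" "M - r = Suc i" using r by (auto simp: i_def)
      have "bounded_env (Suc (Suc n)) x (V i # i # es) (m + poly q m + poly qN m)"
        using b V[of i] i M by (auto simp: bounded_env_def intro: trans_le_add1)
      moreover have "stores (Suc (Suc n)) \<rho>' (e + 3) (V i # i # es) (?s (Suc r))"
        using s \<rho> by (auto simp: stores_def \<rho>'_def i_def less_Suc_eq_0_disj)
      ultimately have 1: "runs cB (?S (Suc r)) (poly pB (m + poly q m + poly qN m))
          (st x u 0 ((?s (Suc r))(e + 3 := V (Suc i))))"
        using cB[of x "V i # i # es" "m + poly q m + poly qN m" "?s (Suc r)" u] by (simp add: V_def)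
      have 2: "runs (Zero (e + 1)) (st x u 0 ((?s (Suc r))(e + 3 := V (Suc i)))) (2 * V i + 1)
          (st x u 0 ((?s (Suc r))(e + 3 := V (Suc i), e + 1 := 0)))"
        using runs_Zero[OF refl, of "e + 1" x u 0 "(?s (Suc r))(e + 3 := V (Suc i))"] by (simp add: i_def)
      have 3: "runs (Transfer (e + 3) (e + 1)) (st x u 0 ((?s (Suc r))(e + 3 := V (Suc i), e + 1 := 0)))
          (4 * V (Suc i) + 1) (st x u 0 ((?s (Suc r))(e + 1 := V (Suc i))))"
        using runs_Transfer[of "e + 3" "e + 1" "(?s (Suc r))(e + 1 := V (Suc i))"
            "(?s (Suc r))(e + 3 := V (Suc i), e + 1 := 0)" x u 0] z
        by (auto simp: fun_eq_iff)
      have 4: "runs (Inc (e + 2)) (st x u 0 ((?s (Suc r))(e + 1 := V (Suc i)))) 1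
          (st x u 0 ((?s (Suc r))(e + 1 := V (Suc i), e + 2 := Suc i)))"
        by (rule runs_Inc) (simp add: i_def)
      have 5: "runs (Dec e) (st x u 0 ((?s (Suc r))(e + 1 := V (Suc i), e + 2 := Suc i))) 1 (?S r)"
        by (rule runs_Dec) (use i in \<open>auto simp: fun_eq_iff\<close>)
      have "runs body (?S (Suc r)) (poly pB (m + poly q m + poly qN m) + ((2 * V i + 1) +
          ((4 * V (Suc i) + 1) + (1 + 1 + 1) + 1) + 1) + 1) (?S r)"
        unfolding body_def by (intro runs_Seq[OF 1] runs_Seq[OF 2] runs_Seq[OF 3] runs_Seq[OF 4] 5)
      then show "runs body (?S (Suc r)) (poly pb m) (?S r)"
        by (rule runs_mono) (use V[of i] V[of "Suc i"] i in \<open>simp add: pb_def poly_pcompose\<close>)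
    qed (auto simp: read_register)
    have 4: "runs (Zero (e + 2)) (?S 0) (2 * M + 1) (st x u 0 (s(e + 1 := V M)))"
      using runs_Zero[of "s(e + 1 := V M)" "?s 0" "e + 2" x u 0] z by (auto simp: fun_eq_iff)
    have 5: "runs (Transfer (e + 1) e) (st x u 0 (s(e + 1 := V M))) (4 * V M + 1) (st x u 0 (s(e := V M)))"
      using runs_Transfer[of "e + 1" e "s(e := V M)" "s(e + 1 := V M)" x u 0] z by (auto simp: fun_eq_iff)
    have "runs c (st x u 0 s) (poly pN m + (poly pA m + ((M * (poly pb m + 1) + 1) +
        ((2 * M + 1) + (4 * V M + 1) + 1) + 1) + 1) + 1) (st x u 0 (s(e := V M)))"
      unfolding c_def by (intro runs_Seq[OF 1] runs_Seq[OF 2] runs_Seq[OF 3] runs_Seq[OF 4] 5)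
    moreover have "M * (poly pb m + 1) \<le> poly qN m * (poly pb m + 1)"
      using M by (rule mult_right_mono) simp
    then have "poly pN m + (poly pA m + ((M * (poly pb m + 1) + 1) +
        ((2 * M + 1) + (4 * V M + 1) + 1) + 1) + 1) + 1 \<le> poly p m"
      using M V[of M] by (simp add: p_def)
    ultimately show ?thesis unfolding V_def M_def by (rule runs_mono)
  qed
  then show "\<exists>c p. \<forall>x es s u m. bounded_env n x es m \<longrightarrow> stores n \<rho> e es s \<longrightarrow>
      runs c (st x u 0 s) (poly p m) (st x u 0 (s(e := rec_nat (A x es) (B x es) (N x es))))"
    by blast
qed

text \<open>Input symbols are never blank, so counting can stop at the first blank behind the
  marker.\<close>

lemma fn_length: "fn n (\<lambda>x es. length x)"
  unfolding fn_def
proof (intro conjI allI impI)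
  show "poly_bounded n (\<lambda>x es. length x)"
    unfolding poly_bounded_def by (intro exI[of _ "[:0, 1:]"]) (simp add: bounded_env_def)
  fix e :: nat and \<rho>
  define body where "body = Seq (Inc e) (Move (Suc 0) MoveRight)"
  define c where "c = Seq (Move (Suc 0) MoveRight) (Seq (While (Suc 0) 0 body)
    (While (Suc 0) 3 (Move (Suc 0) MoveLeft)))"
  have "runs c (st x u 0 s) (poly [:7, 6:] m) (st x u 0 (s(e := length x)))"
    if b: "bounded_env n x es m" and s: "stores n \<rho> e es s" for x u s es m
  proof -
    let ?S = "\<lambda>r. st x u (Suc (length x - r)) (s(e := length x - r))"
    have 1: "runs (Move (Suc 0) MoveRight) (st x u 0 s) 1 (?S (length x))"
      using runs_head_right[of x u 0 s] s by (simp add: stores_def fun_upd_idem)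
    have 2: "runs (While (Suc 0) 0 body) (?S (length x)) (length x * (3 + 1) + 1) (?S 0)"
    proof (rule runs_While)
      fix r assume r: "r < length x"
      have "runs (Inc e) (?S (Suc r)) 1 (st x u (Suc (length x - Suc r)) (s(e := length x - r)))"
        by (rule runs_Inc) (use r in \<open>auto simp: fun_eq_iff\<close>)
      moreover have "runs (Move (Suc 0) MoveRight)
          (st x u (Suc (length x - Suc r)) (s(e := length x - r))) 1 (?S r)"
        using runs_head_right[of x u "Suc (length x - Suc r)"] r by (simp add: Suc_diff_Suc)
      ultimately show "runs body (?S (Suc r)) 3 (?S r)"
        unfolding body_def by (rule runs_Seq') simp
    qed (auto simp: read_input bit_symbol_def)
    have 3: "runs (While (Suc 0) 3 (Move (Suc 0) MoveLeft)) (?S 0) (Suc (length x) * (1 + 1) + 1)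
        (st x u 0 (s(e := length x)))"
      using runs_rewind[of x u "Suc (length x)" "s(e := length x)"] by simp
    have "runs c (st x u 0 s) (1 + ((length x * (3 + 1) + 1) + (Suc (length x) * (1 + 1) + 1) + 1) + 1)
        (st x u 0 (s(e := length x)))"
      unfolding c_def by (intro runs_Seq[OF 1] runs_Seq[OF 2] 3)
    then show ?thesis by (rule runs_mono) (use b in \<open>simp add: bounded_env_def\<close>)
  qed
  then show "\<exists>c p. \<forall>x es s u m. bounded_env n x es m \<longrightarrow> stores n \<rho> e es s \<longrightarrow>
      runs c (st x u 0 s) (poly p m) (st x u 0 (s(e := length x)))" by blast
qed

text \<open>The index in \<open>e\<close> is used up as the distance to walk; one further move
  accounts for the marker in front of the input.\<close>

lemma fn_nth:
  assumes F: "fn n F"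
  shows "fn n (\<lambda>x es. of_bool (F x es < length x \<and> x ! F x es))"
  unfolding fn_def
proof (intro conjI allI impI)
  show "poly_bounded n (\<lambda>x es. of_bool (F x es < length x \<and> x ! F x es))"
    by (rule poly_bounded_le[OF poly_bounded_const[of n 1]]) simp
  obtain q where q: "\<And>x es m. bounded_env n x es m \<Longrightarrow> F x es \<le> poly q m"
    using fn_poly_bounded[OF F] unfolding poly_bounded_def by blast
  fix e :: nat and \<rho> assume "\<forall>k<n. \<rho> k < e"
  then obtain cF pF where cF: "\<And>x es s u m. bounded_env n x es m \<Longrightarrow> stores n \<rho> e es s \<Longrightarrow>
      runs cF (st x u 0 s) (poly pF m) (st x u 0 (s(e := F x es)))"
    by (rule fnD[OF F]) blast
  define seek where "seek = Until_zero e (Seq (Dec e) (Move (Suc 0) MoveRight))"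
  define c where "c = Seq cF (Seq seek (Seq (Move (Suc 0) MoveRight) (Seq (If (Suc 0) 2 (Inc e) (Zero e))
    (While (Suc 0) 3 (Move (Suc 0) MoveLeft)))))"
  have "runs c (st x u 0 s) (poly (pF + [:6:] * q + [:11:]) m)
      (st x u 0 (s(e := of_bool (F x es < length x \<and> x ! F x es))))"
    if b: "bounded_env n x es m" and s: "stores n \<rho> e es s" for x u s es m
  proof -
    define v where "v = F x es"
    define w :: nat where "w = of_bool (v < length x \<and> x ! v)"
    have z: "s e = 0" using s by (auto simp: stores_def)
    let ?S = "\<lambda>r. st x u (v - r) (s(e := r))"
    have 1: "runs cF (st x u 0 s) (poly pF m) (?S v)" using cF[OF b s] by (simp add: v_def)
    have 2: "runs seek (?S v) (v * (3 + 1) + 1) (?S 0)"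
      unfolding seek_def
    proof (rule runs_While)
      fix r assume r: "r < v"
      have "runs (Dec e) (?S (Suc r)) 1 (st x u (v - Suc r) (s(e := r)))"
        by (rule runs_Dec) auto
      moreover have "runs (Move (Suc 0) MoveRight) (st x u (v - Suc r) (s(e := r))) 1 (?S r)"
        using runs_head_right[of x u "v - Suc r" "s(e := r)"] r by (simp add: Suc_diff_Suc)
      ultimately show "runs (Seq (Dec e) (Move (Suc 0) MoveRight)) (?S (Suc r)) 3 (?S r)"
        by (rule runs_Seq') simp
    qed (auto simp: read_register)
    have 3: "runs (Move (Suc 0) MoveRight) (?S 0) 1 (st x u (Suc v) s)"
      using runs_head_right[of x u v s] z by (simp add: fun_upd_idem)
    have 4: "runs (If (Suc 0) 2 (Inc e) (Zero e)) (st x u (Suc v) s) (1 + 1) (st x u (Suc v) (s(e := w)))"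
    proof (cases "v < length x \<and> x ! v")
      case True
      then show ?thesis
        by (intro runs_IfTrue runs_Inc) (auto simp: read_input bit_symbol_def w_def z)
    next
      case False
      then have "w = 0" by (auto simp: w_def)
      then have "runs (Zero e) (st x u (Suc v) s) 1 (st x u (Suc v) (s(e := w)))"
        using runs_Zero[of "s(e := w)" s e x u "Suc v"] z by simp
      moreover have "tape_read (st x u (Suc v) s (Suc 0)) \<noteq> 2"
        using False by (auto simp: read_input bit_symbol_def)
      ultimately show ?thesis by (intro runs_IfFalse)
    qed
    have "runs c (st x u 0 s) (poly pF m + ((v * (3 + 1) + 1) + (1 + ((1 + 1) +
        (Suc v * (1 + 1) + 1) + 1) + 1) + 1) + 1) (st x u 0 (s(e := w)))"
      unfolding c_def by (intro runs_Seq[OF 1] runs_Seq[OF 2] runs_Seq[OF 3] runs_Seq[OF 4] runs_rewind)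
    then show ?thesis unfolding w_def v_def
      by (rule runs_mono) (use q[OF b] in simp)
  qed
  then show "\<exists>c p. \<forall>x es s u m. bounded_env n x es m \<longrightarrow> stores n \<rho> e es s \<longrightarrow>
      runs c (st x u 0 s) (poly p m) (st x u 0 (s(e := of_bool (F x es < length x \<and> x ! F x es))))"
    by blast
qed

text \<open>A total lookup: positions behind the end count as \<open>False\<close>, so that computed
  indices need no guard.\<close>

definition bit_at :: "bool list \<Rightarrow> nat \<Rightarrow> bool" where
  "bit_at x i \<longleftrightarrow> i < length x \<and> x ! i"

lemma fn_bit_at: "fn n F \<Longrightarrow> fn n (\<lambda>x es. of_bool (bit_at x (F x es)))"
  unfolding bit_at_def by (rule fn_nth)

section \<open>Programs that write output\<close>

lemma outpD:
  assumes "outp n G" "\<forall>k<n. \<rho> k < e"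
  obtains c p where "\<And>x es s u m. bounded_env n x es m \<Longrightarrow> stores n \<rho> e es s \<Longrightarrow>
      runs c (st x u 0 s) (poly p m) (st x (u @ G x es) 0 s)"
  using assms unfolding outp_def by blast

lemma outp_append:
  assumes "outp n F" "outp n G"
  shows "outp n (\<lambda>x es. F x es @ G x es)"
  unfolding outp_def
proof (intro allI impI)
  fix e :: nat and \<rho> assume \<rho>: "\<forall>k<n. \<rho> k < e"
  obtain c1 p1 where c1: "\<And>x es s u m. bounded_env n x es m \<Longrightarrow> stores n \<rho> e es s \<Longrightarrow>
      runs c1 (st x u 0 s) (poly p1 m) (st x (u @ F x es) 0 s)"
    by (rule outpD[OF assms(1) \<rho>]) blast
  obtain c2 p2 where c2: "\<And>x es s u m. bounded_env n x es m \<Longrightarrow> stores n \<rho> e es s \<Longrightarrow>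
      runs c2 (st x u 0 s) (poly p2 m) (st x (u @ G x es) 0 s)"
    by (rule outpD[OF assms(2) \<rho>]) blast
  have "runs (Seq c1 c2) (st x u 0 s) (poly (p1 + p2 + [:1:]) m) (st x (u @ F x es @ G x es) 0 s)"
    if "bounded_env n x es m" "stores n \<rho> e es s" for x es s u m
    using runs_Seq[OF c1[OF that, of u] c2[OF that, of "u @ F x es"]] by simp
  then show "\<exists>c p. \<forall>x es s u m. bounded_env n x es m \<longrightarrow> stores n \<rho> e es s \<longrightarrow>
      runs c (st x u 0 s) (poly p m) (st x (u @ F x es @ G x es) 0 s)" by blast
qed

lemma outp_bit:
  assumes P: "fn n (\<lambda>x es. of_bool (P x es))"
  shows "outp n (\<lambda>x es. [P x es])"
  unfolding outp_def
proof (intro allI impI)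
  fix e :: nat and \<rho> assume \<rho>: "\<forall>k<n. \<rho> k < e"
  obtain c p where c: "\<And>x es s u m. bounded_env n x es m \<Longrightarrow> stores n \<rho> e es s \<Longrightarrow>
      runs c (st x u 0 s) (poly p m) (st x u 0 (s(e := of_bool (P x es))))"
    by (rule fnD[OF P \<rho>]) blast
  \<comment> \<open>The registers must be left as they were found, so \<open>e\<close> has to become
    0 again; for \<open>True\<close> a single \<open>Dec\<close> does this.\<close>
  define d where "d = Seq c (If (Suc (Suc e)) 3 (Emit False) (Seq (Dec e) (Emit True)))"
  have "runs d (st x u 0 s) (poly (p + [:7:]) m) (st x (u @ [P x es]) 0 s)"
    if b: "bounded_env n x es m" and s: "stores n \<rho> e es s" for x es s u m
  proof -
    have z: "s e = 0" using s by (auto simp: stores_def)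
    have "runs (If (Suc (Suc e)) 3 (Emit False) (Seq (Dec e) (Emit True)))
        (st x u 0 (s(e := of_bool (P x es)))) (5 + 1) (st x (u @ [P x es]) 0 s)"
    proof (cases "P x es")
      case True
      have "runs (Dec e) (st x u 0 (s(e := 1))) 1 (st x u 0 s)"
        by (rule runs_Dec) (use z in auto)
      from runs_Seq'[OF this runs_Emit] have
        "runs (Seq (Dec e) (Emit True)) (st x u 0 (s(e := 1))) 5 (st x (u @ [True]) 0 s)" by simp
      with True show ?thesis by (intro runs_IfFalse) (simp_all add: read_register)
    next
      case False
      then show ?thesis using runs_mono[OF runs_Emit[of False x u 0 s], of 5] z
        by (intro runs_IfTrue) (simp_all add: read_register fun_upd_idem)
    qed
    from runs_Seq'[OF c[OF b s] this] show ?thesis by (simp add: d_def)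
  qed
  then show "\<exists>c p. \<forall>x es s u m. bounded_env n x es m \<longrightarrow> stores n \<rho> e es s \<longrightarrow>
      runs c (st x u 0 s) (poly p m) (st x (u @ [P x es]) 0 s)" by blast
qed

lemma outp_concat_map:
  assumes N: "fn n N" and G: "outp (Suc n) (\<lambda>x es. G x (tl es) (hd es))"
  shows "outp n (\<lambda>x es. concat (map (G x es) [0..<N x es]))"
  unfolding outp_def
proof (intro allI impI)
  obtain qN where qN: "\<And>x es m. bounded_env n x es m \<Longrightarrow> N x es \<le> poly qN m"
    using fn_poly_bounded[OF N] unfolding poly_bounded_def by blast
  fix e :: nat and \<rho> assume \<rho>: "\<forall>k<n. \<rho> k < e"
  define \<rho>' where "\<rho>' k = (case k of 0 \<Rightarrow> e + 1 | Suc j \<Rightarrow> \<rho> j)" for k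
  obtain cN pN where cN: "\<And>x es s u m. bounded_env n x es m \<Longrightarrow> stores n \<rho> e es s \<Longrightarrow>
      runs cN (st x u 0 s) (poly pN m) (st x u 0 (s(e := N x es)))"
    by (rule fnD[OF N \<rho>]) blast
  have "\<forall>k<Suc n. \<rho>' k < e + 2" using \<rho> by (force simp: \<rho>'_def split: nat.splits)
  then obtain cG pG where cG: "\<And>x es s u m. bounded_env (Suc n) x es m \<Longrightarrow>
      stores (Suc n) \<rho>' (e + 2) es s \<Longrightarrow>
      runs cG (st x u 0 s) (poly pG m) (st x (u @ G x (tl es) (hd es)) 0 s)"
    by (rule outpD[OF G]) blast
  define body where "body = Seq cG (Seq (Inc (e + 1)) (Dec e))"
  define c where "c = Seq cN (Seq (Until_zero e body) (Zero (e + 1)))"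
  define pb where "pb = pcompose pG ([:0, 1:] + qN) + [:4:]"
  define p where "p = pN + qN * (pb + [:1:]) + [:2:] * qN + [:4:]"
  have "runs c (st x u 0 s) (poly p m) (st x (u @ concat (map (G x es) [0..<N x es])) 0 s)"
    if b: "bounded_env n x es m" and s: "stores n \<rho> e es s" for x u s es m
  proof -
    define M where "M = N x es"
    define W where "W i = u @ concat (map (G x es) [0..<i])" for i
    have M: "M \<le> poly qN m" using qN[OF b] by (simp add: M_def)
    let ?s = "\<lambda>r. s(e := r, e + 1 := M - r)"
    let ?S = "\<lambda>r. st x (W (M - r)) 0 (?s r)"
    have z: "s e = 0" "s (e + 1) = 0" using s by (auto simp: stores_def)
    have 1: "runs cN (st x u 0 s) (poly pN m) (?S M)"
      using cN[OF b s] z by (simp add: M_def W_def fun_upd_idem)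
    have 2: "runs (Until_zero e body) (?S M) (M * (poly pb m + 1) + 1) (?S 0)"
    proof (rule runs_While)
      fix r assume r: "r < M"
      define i where "i = M - Suc r"
      have i: "i < M" "M - r = Suc i" using r by (auto simp: i_def)
      have "bounded_env (Suc n) x (i # es) (m + poly qN m)"
        using b i M by (auto simp: bounded_env_def intro: trans_le_add1)
      moreover have "stores (Suc n) \<rho>' (e + 2) (i # es) (?s (Suc r))"
        using s \<rho> by (auto simp: stores_def \<rho>'_def i_def less_Suc_eq_0_disj)
      ultimately have 1: "runs cG (?S (Suc r)) (poly pG (m + poly qN m)) (st x (W (Suc i)) 0 (?s (Suc r)))"
        using cG[of x "i # es" "m + poly qN m" "?s (Suc r)" "W i"] by (simp add: W_def i_def)
      have 2: "runs (Inc (e + 1)) (st x (W (Suc i)) 0 (?s (Suc r))) 1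
          (st x (W (Suc i)) 0 (s(e := Suc r, e + 1 := Suc i)))"
        by (rule runs_Inc) (simp add: i_def)
      have 3: "runs (Dec e) (st x (W (Suc i)) 0 (s(e := Suc r, e + 1 := Suc i))) 1 (?S r)"
        unfolding i by (rule runs_Dec) (auto simp: fun_eq_iff)
      have "runs body (?S (Suc r)) (poly pG (m + poly qN m) + (1 + 1 + 1) + 1) (?S r)"
        unfolding body_def by (intro runs_Seq[OF 1] runs_Seq[OF 2] 3)
      then show "runs body (?S (Suc r)) (poly pb m) (?S r)"
        by (rule runs_mono) (simp add: pb_def poly_pcompose)
    qed (auto simp: read_register)
    have 3: "runs (Zero (e + 1)) (?S 0) (2 * M + 1) (st x (W M) 0 s)"
      using runs_Zero[of s "?s 0" "e + 1" x "W M" 0] z by (auto simp: fun_eq_iff)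
    have "runs c (st x u 0 s) (poly pN m + ((M * (poly pb m + 1) + 1) + (2 * M + 1) + 1) + 1)
        (st x (W M) 0 s)"
      unfolding c_def by (intro runs_Seq[OF 1] runs_Seq[OF 2] 3)
    moreover have "M * (poly pb m + 1) \<le> poly qN m * (poly pb m + 1)"
      using M by (rule mult_right_mono) simp
    then have "poly pN m + ((M * (poly pb m + 1) + 1) + (2 * M + 1) + 1) + 1 \<le> poly p m"
      using M by (simp add: p_def)
    ultimately show ?thesis unfolding W_def M_def by (rule runs_mono)
  qed
  then show "\<exists>c p. \<forall>x es s u m. bounded_env n x es m \<longrightarrow> stores n \<rho> e es s \<longrightarrow>
      runs c (st x u 0 s) (poly p m) (st x (u @ concat (map (G x es) [0..<N x es])) 0 s)"
    by blast
qed

text \<open>The form of \<open>fn_rec\<close> for applications: the bound on intermediate values is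
  given by a function already known to be polynomially bounded.\<close>

lemma fn_rec_bounded:
  assumes "fn n N" "fn n A" "fn (Suc (Suc n)) (\<lambda>x es. B x (tl (tl es)) (hd (tl es)) (hd es))"
    and H: "poly_bounded n H"
      "\<And>x es i. length es = n \<Longrightarrow> i \<le> N x es \<Longrightarrow> rec_nat (A x es) (B x es) i \<le> H x es"
    and F: "\<And>x es. length es = n \<Longrightarrow> F x es = rec_nat (A x es) (B x es) (N x es)"
  shows "fn n F"
proof -
  obtain q where q: "\<And>x es m. bounded_env n x es m \<Longrightarrow> H x es \<le> poly q m"
    using H(1) unfolding poly_bounded_def by blast
  have "rec_nat (A x es) (B x es) i \<le> poly q m"
    if "bounded_env n x es m" "i \<le> N x es" for x es m i
    using q[OF that(1)] H(2)[of es i x] that by (fastforce simp: bounded_env_def)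
  then have "fn n (\<lambda>x es. rec_nat (A x es) (B x es) (N x es))"
    by (intro fn_rec assms(1-3)) blast
  then show ?thesis using fn_cong[of n F, OF F] by simp
qed

section \<open>Arithmetic, logic, counting and finite tables\<close>

lemma fn_const: "fn n (\<lambda>x es. c)"
  by (induction c) (auto intro: fn_0 fn_Suc)

lemma rec_nat_add: "rec_nat a (\<lambda>i. Suc) n = a + n"
  by (induction n) auto

lemma fn_add:
  assumes A: "fn n A" and B: "fn n B"
  shows "fn n (\<lambda>x es. A x es + B x es)"
  by (rule fn_rec_bounded[OF B A, of "\<lambda>x es i. Suc"])
    (auto simp: rec_nat_add intro: fn_Suc fn_hd poly_bounded_add[OF fn_poly_bounded fn_poly_bounded, OF A B])

lemma rec_nat_mult: "rec_nat 0 (\<lambda>i acc. acc + a) n = n * (a :: nat)"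
  by (induction n) auto

lemma fn_mult:
  assumes A: "fn n A" and B: "fn n B"
  shows "fn n (\<lambda>x es. A x es * B x es)"
  by (rule fn_rec_bounded[OF A fn_0, of "\<lambda>x es i acc. acc + B x es"])
    (auto simp: rec_nat_mult intro!: fn_add fn_hd fn_tl B
      intro: poly_bounded_mult[OF fn_poly_bounded fn_poly_bounded, OF A B])

lemma rec_nat_pred: "rec_nat 0 (\<lambda>i acc. i) n = n - 1"
  by (cases n) auto

lemma fn_pred:
  assumes A: "fn n A"
  shows "fn n (\<lambda>x es. A x es - 1)"
  by (rule fn_rec_bounded[OF A fn_0, of "\<lambda>x es i acc. i" A])
    (auto simp: rec_nat_pred intro: fn_hd fn_tl fn_poly_bounded[OF A])

lemma rec_nat_diff: "rec_nat a (\<lambda>i acc. acc - 1) n = a - (n :: nat)"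
  by (induction n) auto

lemma fn_diff:
  assumes A: "fn n A" and B: "fn n B"
  shows "fn n (\<lambda>x es. A x es - B x es)"
  by (rule fn_rec_bounded[OF B A, of "\<lambda>x es i acc. acc - 1" A])
    (auto simp only: rec_nat_diff diff_le_self intro: fn_hd fn_pred fn_poly_bounded[OF A])

lemma rec_nat_if: "rec_nat b (\<lambda>i acc. a) n = (if n = 0 then b else a)"
  by (cases n) auto

text \<open>A loop executed \<open>of_bool\<close> many times is a conditional: the start value
  survives no round and is overwritten by one.\<close>

lemma fn_If:
  assumes P: "fn n (\<lambda>x es. of_bool (P x es))" and A: "fn n A" and B: "fn n B"
  shows "fn n (\<lambda>x es. if P x es then A x es else B x es)"
  by (rule fn_rec_bounded[OF P B, of "\<lambda>x es i acc. A x es" "\<lambda>x es. A x es + B x es"])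
    (auto simp: rec_nat_if intro: fn_tl[OF fn_tl[OF A]] poly_bounded_add[OF fn_poly_bounded fn_poly_bounded, OF A B])

lemma fn_If_bool:
  assumes "fn n (\<lambda>x es. of_bool (P x es))" "fn n (\<lambda>x es. of_bool (Q x es))" "fn n (\<lambda>x es. of_bool (R x es))"
  shows "fn n (\<lambda>x es. of_bool (if P x es then Q x es else R x es))"
  using fn_If[OF assms] by (simp only: if_distrib)

lemma fn_le:
  assumes A: "fn n A" and B: "fn n B"
  shows "fn n (\<lambda>x es. of_bool (A x es \<le> B x es))"
proof -
  have "of_bool (a \<le> b) = 1 - (a - b)" for a b :: nat by auto
  then show ?thesis by (simp only:) (intro fn_diff fn_const A B)
qed

lemma fn_conj:
  assumes P: "fn n (\<lambda>x es. of_bool (P x es))" and Q: "fn n (\<lambda>x es. of_bool (Q x es))"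
  shows "fn n (\<lambda>x es. of_bool (P x es \<and> Q x es))"
  using fn_mult[OF P Q] by (simp only: of_bool_conj)

lemma fn_not:
  assumes P: "fn n (\<lambda>x es. of_bool (P x es))"
  shows "fn n (\<lambda>x es. of_bool (\<not> P x es))"
proof -
  have "of_bool (\<not> p) = 1 - (of_bool p :: nat)" for p by auto
  then show ?thesis by (simp only:) (intro fn_diff fn_const P)
qed

lemma fn_disj:
  assumes P: "fn n (\<lambda>x es. of_bool (P x es))" and Q: "fn n (\<lambda>x es. of_bool (Q x es))"
  shows "fn n (\<lambda>x es. of_bool (P x es \<or> Q x es))"
  using fn_not[OF fn_conj[OF fn_not[OF P] fn_not[OF Q]]] by simp

lemma fn_imp:
  assumes P: "fn n (\<lambda>x es. of_bool (P x es))" and Q: "fn n (\<lambda>x es. of_bool (Q x es))"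
  shows "fn n (\<lambda>x es. of_bool (P x es \<longrightarrow> Q x es))"
  using fn_disj[OF fn_not[OF P] Q] by (simp only: imp_conv_disj)

lemma fn_iff:
  assumes P: "fn n (\<lambda>x es. of_bool (P x es))" and Q: "fn n (\<lambda>x es. of_bool (Q x es))"
  shows "fn n (\<lambda>x es. of_bool (P x es \<longleftrightarrow> Q x es))"
  using fn_conj[OF fn_imp[OF P Q] fn_imp[OF Q P]] by (simp only: iff_conv_conj_imp)

lemma fn_less:
  assumes A: "fn n A" and B: "fn n B"
  shows "fn n (\<lambda>x es. of_bool (A x es < B x es))"
  using fn_not[OF fn_le[OF B A]] by (simp only: not_le)

lemma fn_eq:
  assumes A: "fn n A" and B: "fn n B"
  shows "fn n (\<lambda>x es. of_bool (A x es = B x es))"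
  using fn_conj[OF fn_le[OF A B] fn_le[OF B A]] by (simp only: order.eq_iff)

lemma fn_noteq:
  assumes A: "fn n A" and B: "fn n B"
  shows "fn n (\<lambda>x es. of_bool (A x es \<noteq> B x es))"
  by (rule fn_not[OF fn_eq[OF A B]])

lemma rec_nat_Ex: "rec_nat 0 (\<lambda>i acc. of_bool (acc \<noteq> 0 \<or> P i)) n = (of_bool (\<exists>i<n. P i) :: nat)"
  by (induction n) (auto simp: less_Suc_eq)

lemma fn_Ex:
  assumes N: "fn n N" and P: "fn (Suc n) (\<lambda>x es. of_bool (P x (tl es) (hd es)))"
  shows "fn n (\<lambda>x es. of_bool (\<exists>i<N x es. P x es i))"
proof (rule fn_rec_bounded[OF N fn_0, of "\<lambda>x es i acc. of_bool (acc \<noteq> 0 \<or> P x es i)" "\<lambda>x es. 1"])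
  show "fn (Suc (Suc n)) (\<lambda>x es. of_bool (hd es \<noteq> 0 \<or> P x (tl (tl es)) (hd (tl es))))"
    by (intro fn_disj fn_noteq fn_hd fn_const fn_tl[OF P])
qed (simp_all only: rec_nat_Ex poly_bounded_const of_bool_less_eq_one)

lemma fn_All:
  assumes N: "fn n N" and P: "fn (Suc n) (\<lambda>x es. of_bool (P x (tl es) (hd es)))"
  shows "fn n (\<lambda>x es. of_bool (\<forall>i<N x es. P x es i))"
  using fn_not[OF fn_Ex[OF N, of "\<lambda>x es i. \<not> P x es i", OF fn_not[OF P]]] by simp

lemma rec_nat_card: "rec_nat 0 (\<lambda>i acc. acc + of_bool (P i)) n = card {i. i < n \<and> P i}"
proof (induction n)
  case (Suc n)
  have "{i. i < Suc n \<and> P i} = (if P n then insert n {i. i < n \<and> P i} else {i. i < n \<and> P i})"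
    by (auto simp: less_Suc_eq)
  with Suc show ?case by simp
qed simp

lemma fn_card:
  assumes N: "fn n N" and P: "fn (Suc n) (\<lambda>x es. of_bool (P x (tl es) (hd es)))"
  shows "fn n (\<lambda>x es. card {i. i < N x es \<and> P x es i})"
proof (rule fn_rec_bounded[OF N fn_0, of "\<lambda>x es i acc. acc + of_bool (P x es i)" N])
  show "fn (Suc (Suc n)) (\<lambda>x es. hd es + of_bool (P x (tl (tl es)) (hd (tl es))))"
    by (intro fn_add fn_hd fn_tl[OF P])
  fix x es i
  have "card {j. j < i \<and> P x es j} \<le> card {..<i}" by (intro card_mono) auto
  then show "rec_nat 0 (\<lambda>i acc. acc + of_bool (P x es i)) i \<le> N x es" if "i \<le> N x es"
    using that by (simp only: rec_nat_card) simp
qed (simp_all only: rec_nat_card fn_poly_bounded[OF N])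

text \<open>The quotient is the number of positive multiples of \<open>b\<close> up to
  \<open>a\<close>, which reduces division to bounded counting.\<close>

lemma div_eq_card: "a div b = (if b = 0 then 0 else card {i. i < a \<and> Suc i * b \<le> (a :: nat)})"
proof (cases "b = 0")
  case False
  have "{i. i < a \<and> Suc i * b \<le> a} = {..<a div b}"
  proof (intro set_eqI iffI)
    fix i
    show "i \<in> {..<a div b}" if "i \<in> {i. i < a \<and> Suc i * b \<le> a}"
      using that False less_eq_div_iff_mult_less_eq[of b "Suc i" a] by (simp add: Suc_le_eq)
    show "i \<in> {i. i < a \<and> Suc i * b \<le> a}" if "i \<in> {..<a div b}"
      using that False less_le_trans[OF _ div_le_dividend[of a b], of i]
        less_eq_div_iff_mult_less_eq[of b "Suc i" a]
      by (simp add: Suc_le_eq)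
  qed
  with False show ?thesis by simp
qed simp

lemma fn_div:
  assumes A: "fn n A" and B: "fn n B"
  shows "fn n (\<lambda>x es. A x es div B x es)"
  unfolding div_eq_card
  by (intro fn_If fn_eq fn_const fn_card fn_le fn_mult fn_Suc fn_hd fn_tl[OF A] fn_tl[OF B] A B)

lemma fn_mod:
  assumes A: "fn n A" and B: "fn n B"
  shows "fn n (\<lambda>x es. A x es mod B x es)"
  unfolding minus_div_mult_eq_mod[symmetric] by (intro fn_diff fn_mult fn_div A B)

lemma fn_poly: "fn n A \<Longrightarrow> fn n (\<lambda>x es. poly p (A x es))"
  by (induction p) (auto intro: fn_0 fn_add fn_mult fn_const)

text \<open>For a fixed \<open>c\<close> an arbitrary function on numbers below \<open>c\<close>
  unfolds into \<open>c\<close> nested conditionals. The transition function of a machine is later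
  treated as such a table.\<close>

lemma fn_table:
  assumes A: "fn n A"
  shows "fn n (\<lambda>x es. if A x es < c then g (A x es) else 0)"
proof (induction c)
  case (Suc c)
  have "(if A x es < Suc c then g (A x es) else 0)
    = (if A x es = c then g c else if A x es < c then g (A x es) else 0)" for x es
    by auto
  then show ?case by (simp only:) (intro fn_If fn_eq fn_const A Suc)
qed (simp add: fn_0)

lemma fn_table2:
  assumes A: "fn n A" and B: "fn n B"
  shows "fn n (\<lambda>x es. if A x es < c \<and> B x es < d then g (A x es) (B x es) else 0)"
proof (induction c)
  case (Suc c)
  have "(if A x es < Suc c \<and> B x es < d then g (A x es) (B x es) else 0)
    = (if A x es = c then if B x es < d then g c (B x es) else 0
       else if A x es < c \<and> B x es < d then g (A x es) (B x es) else 0)" for x es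
    by (auto simp: less_Suc_eq)
  then show ?case by (simp only:) (intro fn_If fn_eq fn_const fn_table A B Suc)
qed (simp add: fn_0)

lemmas fn_intros = fn_const fn_hd fn_Suc fn_add fn_mult fn_diff fn_If fn_le fn_less fn_noteq fn_eq
  fn_conj fn_not fn_disj fn_imp fn_iff fn_card fn_div fn_mod fn_length fn_bit_at fn_If_bool

section \<open>From output programs to polynomial-time Turing machines\<close>

text \<open>Only finitely many origin markers can be written in advance, whereas \<open>st\<close>
  has one on every register tape. As tapes that a command does not mention have no influence on it,
  the difference does not matter.\<close>

lemma exec_local:
  assumes "exec c ts t ts'" "com_within K S c" "\<And>j. j < K \<Longrightarrow> rs j = ts j"
  shows "\<exists>rs'. exec c rs t rs' \<and> (\<forall>j<K. rs' j = ts' j)"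
  using assms
proof (induction arbitrary: rs rule: exec.induct)
  case (Write j a ts)
  show ?case
  proof (intro exI conjI allI impI)
    show "exec (Write j a) rs 1 (rs(j := ((fst (rs j))(snd (rs j) := a), snd (rs j))))"
      by (rule exec.Write)
  qed (use Write in simp)
next
  case (Move j m ts)
  show ?case
  proof (intro exI conjI allI impI)
    show "exec (Move j m) rs 1 (rs(j := (fst (rs j), snd (rs j) + head_shift m)))"
      by (rule exec.Move)
  qed (use Move in simp)
next
  case (Seq c1 ts t1 ts1 c2 t2 ts2)
  obtain rs1 where "exec c1 rs t1 rs1" "\<forall>j<K. rs1 j = ts1 j" using Seq.IH(1)[of rs] Seq.prems by auto
  moreover from this obtain rs2 where "exec c2 rs1 t2 rs2" "\<forall>j<K. rs2 j = ts2 j"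
    using Seq.IH(2)[of rs1] Seq.prems by auto
  ultimately show ?case using exec.Seq by blast
next
  case (IfTrue ts j a c1 t ts' c2)
  obtain rs' where "exec c1 rs t rs'" "\<forall>j<K. rs' j = ts' j" using IfTrue.IH[of rs] IfTrue.prems by auto
  moreover have "tape_read (rs j) = a" using IfTrue by simp
  ultimately show ?case using exec.IfTrue by blast
next
  case (IfFalse ts j a c2 t ts' c1)
  obtain rs' where "exec c2 rs t rs'" "\<forall>j<K. rs' j = ts' j" using IfFalse.IH[of rs] IfFalse.prems by auto
  moreover have "tape_read (rs j) \<noteq> a" using IfFalse by simp
  ultimately show ?case using exec.IfFalse by blast
next
  case (WhileStop ts j a c)
  then have "tape_read (rs j) = a" by simp
  then show ?case using WhileStop exec.WhileStop by blast
next
  case (WhileStep ts j a c t1 ts1 t2 ts2)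
  obtain rs1 where "exec c rs t1 rs1" "\<forall>j<K. rs1 j = ts1 j"
    using WhileStep.IH(1)[of rs] WhileStep.prems by auto
  moreover from this obtain rs2 where "exec (While j a c) rs1 t2 rs2" "\<forall>j<K. rs2 j = ts2 j"
    using WhileStep.IH(2)[of rs1] WhileStep.prems by auto
  moreover have "tape_read (rs j) \<noteq> a" using WhileStep by simp
  ultimately show ?case using exec.WhileStep by blast
qed

primrec Mark :: "nat \<Rightarrow> com" where
  "Mark 0 = Write 1 3"
| "Mark (Suc k) = Seq (Mark k) (Write (Suc (Suc k)) 3)"

lemma runs_Mark:
  "runs (Mark k) (input_tapes x) (2 * k + 1)
    (\<lambda>j. if j = 0 then (string_cells x, 0) else if j \<le> Suc k then (marked [], 0) else (\<lambda>_. 0, 0))"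
proof (induction k)
  case 0
  show ?case unfolding Mark.simps
    by (rule runs_mono[OF runs_Write])
      (auto simp: fun_eq_iff input_tapes_def marked_def string_cells_def)
next
  case (Suc k)
  show ?case unfolding Mark.simps
    by (rule runs_Seq'[OF Suc runs_Write])
      (auto simp: fun_eq_iff input_tapes_def marked_def string_cells_def)
qed

text \<open>The input arrives on the tape that has to end with the output alone, so it is moved
  behind the marker of tape 1 and erased on tape 0. Rewinding crosses one cell more on tape 1 than
  the input has and leaves the head of tape 0 at -1; the last move corrects this.\<close>

definition Load :: com where
  "Load = Seq (Move 1 MoveRight) (Seq
    (While 0 0 (Seq (If 0 1 (Write 1 1) (Write 1 2))
      (Seq (Write 0 0) (Seq (Move 0 MoveRight) (Move 1 MoveRight)))))
    (Seq (While 1 3 (Seq (Move 1 MoveLeft) (Move 0 MoveLeft))) (Move 0 MoveRight)))"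

lemma marked_snoc: "marked (y @ [b]) = (marked y)(int (length y) + 1 := bit_symbol b)"
  by (auto simp: marked_def string_cells_def fun_eq_iff nth_append)

lemma runs_Load:
  assumes ts: "ts 0 = (string_cells x, 0)" "ts 1 = (marked [], 0)"
  shows "runs Load ts (13 * length x + 12) (ts(0 := (\<lambda>_. 0, 0), 1 := (marked x, 0)))"
proof -
  let ?L = "length x"
  define S where "S r = ts(0 := (\<lambda>p. if p < int (?L - r) then 0 else string_cells x p, int (?L - r)),
    1 := (marked (take (?L - r) x), int (?L - r) + 1))" for r
  have 1: "runs (Move 1 MoveRight) ts 1 (S ?L)"
    by (rule runs_Move) (auto simp: S_def fun_eq_iff ts[simplified] string_cells_def)
  have 2: "runs (While 0 0 (Seq (If 0 1 (Write 1 1) (Write 1 2))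
      (Seq (Write 0 0) (Seq (Move 0 MoveRight) (Move 1 MoveRight))))) (S ?L) (?L * (8 + 1) + 1) (S 0)"
  proof (rule runs_While)
    fix r assume r: "r < ?L"
    define i where "i = ?L - Suc r"
    have i: "i < ?L" "?L - r = Suc i" "?L - Suc r = i" using r by (auto simp: i_def)
    let ?c = "\<lambda>i p. if p < int i then 0 else string_cells x p"
    have read: "tape_read (S (Suc r) 0) = bit_symbol (x ! i)"
      using i by (simp add: S_def string_cells_def)
    let ?T = "ts(0 := (?c i, int i), 1 := (marked (take (Suc i) x), int i + 1))"
    have w: "runs (Write 1 (bit_symbol (x ! i))) (S (Suc r)) 1 ?T"
      by (rule runs_Write) (use i in \<open>auto simp: S_def fun_eq_iff take_Suc_conv_app_nth marked_snoc\<close>)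
    have 1: "runs (If 0 1 (Write 1 1) (Write 1 2)) (S (Suc r)) (1 + 1) ?T"
    proof (cases "x ! i")
      case True
      then show ?thesis using w read by (intro runs_IfFalse) (auto simp: bit_symbol_def)
    next
      case False
      then show ?thesis using w read by (intro runs_IfTrue) (auto simp: bit_symbol_def)
    qed
    have 2: "runs (Write 0 0) ?T 1 (?T(0 := (?c (Suc i), int i)))"
      by (rule runs_Write) (auto simp: fun_eq_iff)
    have 3: "runs (Move 0 MoveRight) (?T(0 := (?c (Suc i), int i))) 1 (?T(0 := (?c (Suc i), int i + 1)))"
      by (rule runs_Move) (auto simp: fun_eq_iff)
    have 4: "runs (Move 1 MoveRight) (?T(0 := (?c (Suc i), int i + 1))) 1 (S r)"
      by (rule runs_Move) (auto simp: S_def fun_eq_iff i)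
    show "runs (Seq (If 0 1 (Write 1 1) (Write 1 2))
        (Seq (Write 0 0) (Seq (Move 0 MoveRight) (Move 1 MoveRight)))) (S (Suc r)) 8 (S r)"
      by (rule runs_mono[OF runs_Seq[OF 1 runs_Seq[OF 2 runs_Seq[OF 3 4]]]]) simp
    show "tape_read (S (Suc r) 0) \<noteq> 0" using read by (simp add: bit_symbol_def)
  qed (simp add: S_def string_cells_def)
  define R where "R h = ts(0 := (\<lambda>_. 0, int h - 1), 1 := (marked x, int h))" for h
  have eq: "S 0 = R (Suc ?L)"
    by (auto simp: S_def R_def fun_eq_iff string_cells_def)
  have 3: "runs (While 1 3 (Seq (Move 1 MoveLeft) (Move 0 MoveLeft))) (R (Suc ?L))
      (Suc ?L * (3 + 1) + 1) (R 0)"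
  proof (rule runs_While)
    fix h assume "h < Suc ?L"
    have 1: "runs (Move 1 MoveLeft) (R (Suc h)) 1 ((R h)(0 := (\<lambda>_. 0, int h)))"
      by (rule runs_Move) (auto simp: R_def fun_eq_iff)
    have 2: "runs (Move 0 MoveLeft) ((R h)(0 := (\<lambda>_. 0, int h))) 1 (R h)"
      by (rule runs_Move) (auto simp: R_def fun_eq_iff)
    show "runs (Seq (Move 1 MoveLeft) (Move 0 MoveLeft)) (R (Suc h)) 3 (R h)"
      by (rule runs_mono[OF runs_Seq[OF 1 2]]) simp
    show "tape_read (R (Suc h) 1) \<noteq> 3"
      by (simp add: R_def marked_def string_cells_def bit_symbol_def)
  qed (simp add: R_def marked_def)
  have 4: "runs (Move 0 MoveRight) (R 0) 1 (ts(0 := (\<lambda>_. 0, 0), 1 := (marked x, 0)))"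
    by (rule runs_Move) (auto simp: R_def fun_eq_iff)
  note 5 = runs_Seq[OF 3 4]
  note 6 = runs_Seq[OF 2 5[folded eq]]
  show ?thesis unfolding Load_def by (rule runs_Seq'[OF 1 6]) simp
qed

theorem polytime_outp:
  assumes "outp 0 G"
  shows "polytime (\<lambda>x. G x [])"
proof -
  obtain c p where c: "\<And>x es s u m. bounded_env 0 x es m \<Longrightarrow> stores 0 (\<lambda>_. 0) 0 es s \<Longrightarrow>
      runs c (st x u 0 s) (poly p m) (st x (u @ G x es) 0 s)"
    by (rule outpD[OF assms, of "\<lambda>_. 0" 0]) auto
  obtain K0 S where "com_within K0 S c" using com_within_ex by blast
  then have K: "com_within (Suc K0) S c" by (rule com_within_mono) auto
  show ?thesis
  proof (rule polytimeI)
    fix x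
    let ?s = "\<lambda>_ :: nat. 0 :: nat"
    define A where "A = (\<lambda>j. if j = 0 then (string_cells x, 0) else if j \<le> Suc K0 then (marked [], 0)
      else (\<lambda>_. 0, 0 :: int))"
    define B where "B = A(0 := (\<lambda>_. 0, 0), 1 := (marked x, 0))"
    have "runs (Mark K0) (input_tapes x) (2 * K0 + 1) A" using runs_Mark[of K0 x] by (simp add: A_def)
    moreover have "runs Load A (13 * length x + 12) B"
      unfolding B_def by (rule runs_Load) (auto simp: A_def)
    moreover have "runs c (st x [] 0 ?s) (poly p (length x)) (st x (G x []) 0 ?s)"
      using c[of x "[]" "length x" ?s "[]"] by (simp add: bounded_env_def stores_def)
    then obtain t where t: "t \<le> poly p (length x)" "exec c (st x [] 0 ?s) t (st x (G x []) 0 ?s)"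
      unfolding runs_def by blast
    have "B j = st x [] 0 ?s j" if "j < Suc K0" for j
      using that by (auto simp: A_def B_def st_def string_cells_def split: nat.splits)
    from exec_local[OF t(2) K this] obtain ts where ts: "exec c B t ts" "ts 0 = st x (G x []) 0 ?s 0"
      by auto
    have "runs c B (poly p (length x)) ts" using t ts unfolding runs_def by blast
    ultimately have "runs (Seq (Mark K0) (Seq Load c)) (input_tapes x)
        (2 * K0 + 1 + (13 * length x + 12 + poly p (length x) + 1) + 1) ts"
      by (intro runs_Seq)
    then show "\<exists>t ts. t \<le> poly ([:2 * K0 + 15, 13:] + p) (length x) \<and>
        exec (Seq (Mark K0) (Seq Load c)) (input_tapes x) t ts \<and> fst (ts 0) = string_cells (G x [])"
      unfolding runs_def using ts(2) by (fastforce simp: st_def algebra_simps)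
  qed
qed

section \<open>Constraint satisfaction as independent domination in bipartite graphs\<close>

text \<open>
  Variables \<open>v < N\<close> take values below \<open>D\<close>; the pair of \<open>v\<close> and its value \<open>a\<close> is coded as \<open>v * D + a\<close>,
  and \<open>F\<close> lists the forbidden triples of such pairs.
\<close>

definition solves :: "nat \<Rightarrow> nat \<Rightarrow> (nat \<Rightarrow> nat \<Rightarrow> nat \<Rightarrow> bool) \<Rightarrow> (nat \<Rightarrow> nat) \<Rightarrow> bool" where
  "solves N D F g \<longleftrightarrow> (\<forall>v<N. g v < D) \<and>
    (\<forall>v1<N. \<forall>v2<N. \<forall>v3<N. \<not> F (v1 * D + g v1) (v2 * D + g v2) (v3 * D + g v3))"

text \<open>
  With \<open>P = N * D\<close>, the vertices \<open>e\<close> and \<open>P + e\<close> state that the pair \<open>e < P\<close> is chosen or not chosen.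
  Then follow \<open>P + 1\<close> twins for every variable, adjacent to the pairs of this variable, and \<open>P + 1\<close>
  twins for every triple, adjacent to the negated members of the triple if it is forbidden. A triple
  that is not forbidden is tied to the vertex \<open>P\<close>, which will be chosen in every solution. A set of
  at most \<open>P\<close> vertices cannot contain all twins, so that twins have to be dominated from outside.
\<close>

definition csp_base :: "nat \<Rightarrow> nat \<Rightarrow> nat" where
  "csp_base N D = 2 * (N * D) + N * (N * D + 1)"

definition csp_size :: "nat \<Rightarrow> nat \<Rightarrow> nat" where
  "csp_size N D = csp_base N D + (N * D) * (N * D) * (N * D) * (N * D + 1)"

text \<open>The offset of a twin in its block is a number in mixed radix with the number of the copy
  as leading digit. Taking residues discards this digit, so all twins have the same
  neighbours.\<close>

definition csp_adj :: "nat \<Rightarrow> nat \<Rightarrow> (nat \<Rightarrow> nat \<Rightarrow> nat \<Rightarrow> bool) \<Rightarrow> nat \<Rightarrow> nat \<Rightarrow> bool" where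
  "csp_adj N D F u w \<longleftrightarrow>
    (u < N * D \<and> w = N * D + u) \<or>
    (u < N * D \<and> 2 * (N * D) \<le> w \<and> w < csp_base N D \<and> (w - 2 * (N * D)) mod N = u div D) \<or>
    (N * D \<le> u \<and> u < 2 * (N * D) \<and> csp_base N D \<le> w \<and> w < csp_size N D \<and>
      (if F ((w - csp_base N D) mod (N * D)) ((w - csp_base N D) div (N * D) mod (N * D))
            ((w - csp_base N D) div (N * D * (N * D)) mod (N * D))
       then u - N * D = (w - csp_base N D) mod (N * D) \<or>
         u - N * D = (w - csp_base N D) div (N * D) mod (N * D) \<or>
         u - N * D = (w - csp_base N D) div (N * D * (N * D)) mod (N * D)
       else u = N * D))"

definition csp_edges :: "nat \<Rightarrow> nat \<Rightarrow> (nat \<Rightarrow> nat \<Rightarrow> nat \<Rightarrow> bool) \<Rightarrow> nat set set" where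
  "csp_edges N D F = {{u, w} | u w. csp_adj N D F u w}"

lemma in_csp_edges: "{u, w} \<in> csp_edges N D F \<longleftrightarrow> csp_adj N D F u w \<or> csp_adj N D F w u"
  unfolding csp_edges_def by (auto simp: doubleton_eq_iff)

lemma csp_base_ge: "2 * (N * D) \<le> csp_base N D" and csp_size_ge: "csp_base N D \<le> csp_size N D"
  by (simp_all add: csp_base_def csp_size_def)

lemma csp_adj_less: "csp_adj N D F u w \<Longrightarrow> u < w \<and> w < csp_size N D"
  using csp_base_ge[of N D] csp_size_ge[of N D] unfolding csp_adj_def by linarith

lemma simple_graph_csp: "simple_graph {..<csp_size N D} (csp_edges N D F)"
  unfolding simple_graph_def csp_edges_def using csp_adj_less[of N D F]
  by (fastforce simp: card_2_iff)

text \<open>Choosing ends meet only rejecting ends and variable twins, and triple twins meet only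
  rejecting ends. So triple twins join the choosing side and variable twins the rejecting
  side.\<close>

lemma bipartite_csp: "bipartite {..<csp_size N D} (csp_edges N D F)"
proof -
  define A where "A = {u. u < N * D \<or> csp_base N D \<le> u \<and> u < csp_size N D}"
  define B where "B = {u. N * D \<le> u \<and> u < csp_base N D}"
  have "\<not> csp_adj N D F u w" if "u \<in> A \<and> w \<in> A \<or> u \<in> B \<and> w \<in> B" for u w
    using that csp_base_ge[of N D] by (auto simp: csp_adj_def A_def B_def)
  then have "independent_set (csp_edges N D F) A" "independent_set (csp_edges N D F) B"
    unfolding independent_set_def in_csp_edges by blast+
  moreover have "A \<union> B = {..<csp_size N D}" "A \<inter> B = {}"
    using csp_base_ge[of N D] csp_size_ge[of N D] by (auto simp: A_def B_def)
  ultimately show ?thesis unfolding bipartite_def by blast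
qed

text \<open>Taking from every edge the end that describes \<open>g\<close> gives at most
  \<open>N * D\<close> vertices. By \<open>F0\<close> the pair 0 cannot be a value of
  \<open>g\<close>, so its rejecting end \<open>P\<close> is taken and dominates the twins of all
  triples that are not forbidden.\<close>

lemma kRiDF_csp_if_solves:
  assumes g: "solves N D F g" and F0: "\<And>e2 e3. F 0 e2 e3" and N: "0 < N" and D: "0 < D"
  obtains f where "kRiDF 1 {..<csp_size N D} (csp_edges N D F) f" "weight {..<csp_size N D} f \<le> N * D"
proof -
  define P where "P = N * D"
  have P: "0 < P" using N D by (simp add: P_def)
  define sel where "sel e \<longleftrightarrow> e mod D = g (e div D)" for e
  define S where "S = (\<lambda>e. if sel e then e else P + e) ` {..<P}"
  define f :: "nat \<Rightarrow> nat" where "f v = of_bool (v \<in> S)" for v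
  let ?V = "{..<csp_size N D}"
  have pos: "e \<in> S \<longleftrightarrow> sel e" and neg: "P + e \<in> S \<longleftrightarrow> \<not> sel e" if "e < P" for e
    using that by (auto simp: S_def split: if_splits)
  have S_less: "v < 2 * P" if "v \<in> S" for v using that by (auto simp: S_def split: if_splits)
  have S_V: "S \<subseteq> ?V" using S_less csp_base_ge[of N D] csp_size_ge[of N D] by (force simp: P_def)
  have div_less: "e div D < N" if "e < P" for e
    using that by (simp add: P_def less_mult_imp_div_less)
  have indep: "\<not> csp_adj N D F u w" if "u \<in> S" "w \<in> S" for u w
  proof
    assume "csp_adj N D F u w"
    then have "u < P" "w = P + u"
      using S_less[OF that(2)] csp_base_ge[of N D] by (auto simp: csp_adj_def P_def)
    then show False using that pos neg by auto
  qed
  have dom: "\<exists>u\<in>S. csp_adj N D F u v \<or> csp_adj N D F v u" if v: "v < csp_size N D" "v \<notin> S" for v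
  proof -
    consider "v < P" | "P \<le> v" "v < 2 * P" | "2 * P \<le> v" "v < csp_base N D" | "csp_base N D \<le> v"
      by linarith
    then show ?thesis
    proof cases
      case 1
      then have "P + v \<in> S" "csp_adj N D F v (P + v)" using v pos neg by (auto simp: csp_adj_def P_def)
      then show ?thesis by blast
    next
      case 2
      then have "v - P < P" by linarith
      then have "v - P \<in> S" "csp_adj N D F (v - P) v"
        using v pos[of "v - P"] neg[of "v - P"] 2 by (auto simp: csp_adj_def P_def)
      then show ?thesis by blast
    next
      case 3
      define i where "i = (v - 2 * P) mod N"
      define e where "e = i * D + g i"
      have i: "i < N" and gi: "g i < D" using N g by (auto simp: i_def solves_def)
      have ed: "e div D = i" "e mod D = g i" using gi by (auto simp: e_def)
      have "e < Suc i * D" using gi by (simp add: e_def)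
      also have "\<dots> \<le> P" unfolding P_def using i by (intro mult_right_mono) auto
      finally have "e < P" .
      moreover have "sel e" by (simp add: sel_def ed)
      ultimately have "e \<in> S" "csp_adj N D F e v"
        using pos 3 ed by (auto simp: csp_adj_def i_def P_def)
      then show ?thesis by blast
    next
      case 4
      define r where "r = v - csp_base N D"
      define e1 e2 e3 where "e1 = r mod P" and "e2 = r div P mod P" and "e3 = r div (P * P) mod P"
      have e: "e1 < P" "e2 < P" "e3 < P" using P by (auto simp: e1_def e2_def e3_def)
      show ?thesis
      proof (cases "F e1 e2 e3")
        case True
        have eq: "e div D * D + g (e div D) = e" if "sel e" for e
          using that div_mult_mod_eq[of e D] by (simp add: sel_def)
        have "\<exists>e\<in>{e1, e2, e3}. \<not> sel e"
        proof (rule ccontr)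
          assume "\<not> ?thesis"
          then have *: "sel e1" "sel e2" "sel e3" by auto
          have "\<not> F (e1 div D * D + g (e1 div D)) (e2 div D * D + g (e2 div D)) (e3 div D * D + g (e3 div D))"
            using g e div_less unfolding solves_def by blast
          with True show False by (simp add: eq[OF *(1)] eq[OF *(2)] eq[OF *(3)])
        qed
        then obtain e where e': "e = e1 \<or> e = e2 \<or> e = e3" "\<not> sel e" by blast
        then have "e < P" using e by auto
        then have "P + e \<in> S" using neg e' by simp
        moreover have "csp_adj N D F (P + e) v"
          using 4 v(1) True e'(1) \<open>e < P\<close> unfolding csp_adj_def P_def[symmetric] r_def[symmetric]
          by (simp add: e1_def e2_def e3_def)
        ultimately show ?thesis by blast
      next
        case False
        have "\<not> sel 0"
        proof
          assume "sel 0"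
          then have "F (0 * D + g 0) (0 * D + g 0) (0 * D + g 0)" using F0 by (simp add: sel_def)
          then show False using g N unfolding solves_def by blast
        qed
        then have "P \<in> S" using neg[of 0] P by simp
        moreover have "csp_adj N D F P v"
          using 4 v(1) False P unfolding csp_adj_def P_def[symmetric] r_def[symmetric]
          by (simp add: e1_def e2_def e3_def)
        ultimately show ?thesis by blast
      qed
    qed
  qed
  have S_eq: "{v \<in> ?V. f v = 1} = S" "{v \<in> ?V. f v \<noteq> 0} = S" using S_V by (auto simp: f_def)
  have "kRiDF 1 ?V (csp_edges N D F) f"
    unfolding kRiDF_def
  proof (intro conjI ballI impI)
    fix i assume "i \<in> {1..1::nat}"
    then have i: "i = 1" by simp
    show "independent_set (csp_edges N D F) {v \<in> ?V. f v = i}"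
      unfolding i S_eq independent_set_def in_csp_edges using indep by blast
    fix v assume "v \<in> ?V" "f v = 0"
    then obtain u where "u \<in> S" "csp_adj N D F u v \<or> csp_adj N D F v u"
      using dom[of v] by (auto simp: f_def)
    then show "\<exists>u\<in>?V. {u, v} \<in> csp_edges N D F \<and> f u = i"
      using S_V by (intro bexI[of _ u]) (auto simp: in_csp_edges f_def i)
  qed (simp add: f_def)
  moreover have "card S \<le> P"
    unfolding S_def using card_image_le[OF finite_lessThan[of P]] by (rule order_trans) simp
  then have "weight ?V f \<le> N * D" unfolding weight_def S_eq by (simp add: P_def)
  ultimately show ?thesis by (rule that)
qed

lemma solves_if_kRiDF_csp:
  assumes f: "kRiDF 1 {..<csp_size N D} (csp_edges N D F) f"
    and weight: "weight {..<csp_size N D} f \<le> N * D" and N: "0 < N" and D: "0 < D"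
  obtains g where "solves N D F g"
proof -
  define P where "P = N * D"
  have P: "0 < P" using N D by (simp add: P_def)
  define B where "B = csp_base N D"
  define n where "n = csp_size N D"
  have B: "B = 2 * P + N * (P + 1)" and n: "n = B + P * P * P * (P + 1)"
    by (simp_all add: B_def n_def P_def csp_base_def csp_size_def)
  define S where "S = {v. v < n \<and> f v = 1}"
  have f01: "f v = 0 \<or> f v = 1" if "v < n" for v
  proof -
    have "f v \<in> {0..1}" using f that unfolding kRiDF_def n_def by blast
    then show ?thesis by auto
  qed
  have "S = {v \<in> {..<n}. f v \<noteq> 0}" using f01 by (force simp: S_def)
  then have card_S: "card S \<le> P" using weight by (simp add: weight_def P_def n_def)
  have finS: "finite S" by (simp add: S_def)
  have indep: "\<not> csp_adj N D F u w" if "u \<in> S" "w \<in> S" for u w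
  proof -
    have "independent_set (csp_edges N D F) {v \<in> {..<n}. f v = 1}"
      using f unfolding kRiDF_def n_def by simp
    then show ?thesis using that unfolding independent_set_def in_csp_edges S_def by auto
  qed
  have dom: "\<exists>u\<in>S. csp_adj N D F u v \<or> csp_adj N D F v u" if "v < n" "v \<notin> S" for v
  proof -
    have "f v = 0" using that f01[of v] by (auto simp: S_def)
    then have "\<exists>u<n. {u, v} \<in> csp_edges N D F \<and> f u = 1"
      using f that(1) unfolding kRiDF_def n_def by simp blast
    then show ?thesis unfolding in_csp_edges S_def by blast
  qed
  \<comment> \<open>If \<open>w\<close> is in \<open>S\<close>, no neighbour of it is. Every twin
    has the same neighbours and must then be in \<open>S\<close> itself, which is too much for the
    weight bound.\<close>
  have no_twin: "w \<notin> S"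
    if twins: "W \<subseteq> {..<n}" "finite W" "P < card W"
      "\<And>u w'. w' \<in> W \<Longrightarrow> csp_adj N D F u w' \<longleftrightarrow> csp_adj N D F u w"
      "\<And>u w'. w' \<in> W \<Longrightarrow> \<not> csp_adj N D F w' u" for W w
  proof
    assume "w \<in> S"
    then have "w' \<in> S" if "w' \<in> W" for w'
      using dom[of w'] indep[of _ w] twins(1,4,5) that by blast
    then have "card W \<le> card S" by (intro card_mono finS) blast
    with card_S twins(3) show False by simp
  qed
  have no_pos: "w \<notin> S" if w: "2 * P \<le> w" "w < B" for w
  proof (rule no_twin)
    let ?r = "(w - 2 * P) mod N"
    \<comment> \<open>The twins of \<open>w\<close>: the residue modulo \<open>N\<close> names the
      variable, and \<open>c\<close> runs through the \<open>P + 1\<close> copies.\<close>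
    let ?W = "(\<lambda>c. 2 * P + (?r + c * N)) ` {..P}"
    have "inj_on (\<lambda>c. 2 * P + (?r + c * N)) {..P}" using N by (auto simp: inj_on_def)
    then show "P < card ?W" by (simp add: card_image)
    have less: "2 * P + (?r + c * N) < B" if "c \<le> P" for c
    proof -
      have "?r + c * N < Suc c * N" using N by simp
      also have "\<dots> \<le> Suc P * N" using that by (intro mult_right_mono) auto
      finally show ?thesis by (simp add: B algebra_simps)
    qed
    then show "?W \<subseteq> {..<n}" by (auto simp: n intro: trans_less_add1)
    fix u w' assume "w' \<in> ?W"
    then obtain c where c: "w' = 2 * P + (?r + c * N)" "c \<le> P" by auto
    have "2 * P \<le> w'" "w' < B" "(w' - 2 * P) mod N = ?r" using c less by auto
    then show "csp_adj N D F u w' \<longleftrightarrow> csp_adj N D F u w"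
      using w unfolding csp_adj_def P_def[symmetric] B_def[symmetric] by auto
    show "\<not> csp_adj N D F w' u"
      using \<open>2 * P \<le> w'\<close> unfolding csp_adj_def P_def[symmetric] by auto
  qed simp
  have no_neg: "w \<notin> S" if w: "B \<le> w" "w < n" for w
  proof (rule no_twin)
    let ?Q = "P * P * P"
    let ?r = "(w - B) mod ?Q"
    let ?W = "(\<lambda>c. B + (?r + c * ?Q)) ` {..P}"
    have Q: "0 < ?Q" using P by simp
    have "inj_on (\<lambda>c. B + (?r + c * ?Q)) {..P}" using P by (auto simp: inj_on_def)
    then show "P < card ?W" by (simp add: card_image)
    have less: "B + (?r + c * ?Q) < n" if "c \<le> P" for c
    proof -
      have "?r + c * ?Q < Suc c * ?Q" using Q by simp
      also have "\<dots> \<le> Suc P * ?Q" using that by (intro mult_right_mono) auto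
      finally show ?thesis by (simp add: n algebra_simps)
    qed
    then show "?W \<subseteq> {..<n}" by auto
    fix u w' assume "w' \<in> ?W"
    then obtain c where c: "w' = B + (?r + c * ?Q)" "c \<le> P" by auto
    \<comment> \<open>The triple is given by the three lower digits in base \<open>P\<close>; they
      depend only on the residue modulo \<open>P * P * P\<close>, hence not on the copy.\<close>
    have mods: "a mod ?Q mod P = a mod P" "a mod ?Q div P mod P = a div P mod P"
      "a mod ?Q div (P * P) mod P = a div (P * P) mod P" for a
    proof -
      show "a mod ?Q mod P = a mod P" by (simp add: mod_mod_cancel)
      have "a mod (P * (P * P)) div P = a div P mod (P * P)"
        using P by (simp only: mod_mult2_eq) simp
      then show "a mod ?Q div P mod P = a div P mod P" by (simp add: mult.assoc mod_mod_cancel)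
      have "a mod ((P * P) * P) div (P * P) = a div (P * P) mod P"
        using P by (simp only: mod_mult2_eq[of a "P * P" P]) simp
      then show "a mod ?Q div (P * P) mod P = a div (P * P) mod P" by simp
    qed
    have r: "B \<le> w'" "w' < n" "(w' - B) mod ?Q = (w - B) mod ?Q" using c less by auto
    have "(w' - B) mod P = (w - B) mod P" "(w' - B) div P mod P = (w - B) div P mod P"
      "(w' - B) div (P * P) mod P = (w - B) div (P * P) mod P"
      using mods[of "w' - B"] mods[of "w - B"] unfolding r(3) by argo+
    then show "csp_adj N D F u w' \<longleftrightarrow> csp_adj N D F u w"
      using w r csp_base_ge[of N D] unfolding csp_adj_def P_def[symmetric] B_def[symmetric] n_def[symmetric]
      by auto
    show "\<not> csp_adj N D F w' u"
      using \<open>B \<le> w'\<close> csp_base_ge[of N D] unfolding csp_adj_def P_def[symmetric] B_def[symmetric] by auto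
  qed simp
  have S_less: "v < 2 * P" if "v \<in> S" for v
    using that no_pos[of v] no_neg[of v] by (auto simp: S_def not_less[symmetric])
  have "\<exists>a<D. v * D + a \<in> S" if v: "v < N" for v
  proof -
    \<comment> \<open>\<open>2 * P + v\<close> is the copy number 0 of the vertex for variable
      \<open>v\<close>. Not being in \<open>S\<close>, it is dominated by the choosing end of a pair
      of \<open>v\<close>.\<close>
    have "N \<le> N * (P + 1)" by simp
    then have "2 * P + v < B" using v unfolding B by linarith
    then have "2 * P + v < n" "2 * P + v \<notin> S" using no_pos[of "2 * P + v"] by (auto simp: n)
    then obtain u where u: "u \<in> S" "csp_adj N D F u (2 * P + v) \<or> csp_adj N D F (2 * P + v) u"
      using dom by blast
    then have "u div D = v"
      using v S_less[OF u(1)] \<open>2 * P + v < B\<close> unfolding csp_adj_def P_def[symmetric] B_def[symmetric]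
      by auto
    then have "u = v * D + u mod D" using div_mult_mod_eq[of u D] by simp
    then show ?thesis using u(1) D mod_less_divisor by metis
  qed
  then obtain g where g: "\<And>v. v < N \<Longrightarrow> g v < D \<and> v * D + g v \<in> S" by metis
  have "\<not> F (v1 * D + g v1) (v2 * D + g v2) (v3 * D + g v3)"
    if v: "v1 < N" "v2 < N" "v3 < N" for v1 v2 v3
  proof
    define e1 e2 e3 where "e1 = v1 * D + g v1" and "e2 = v2 * D + g v2" and "e3 = v3 * D + g v3"
    assume "F (v1 * D + g v1) (v2 * D + g v2) (v3 * D + g v3)"
    then have F: "F e1 e2 e3" by (simp add: e1_def e2_def e3_def)
    have less: "v * D + g v < P" if "v < N" for v
    proof -
      have "v * D + g v < Suc v * D" using g[OF that] by simp
      also have "\<dots> \<le> P" unfolding P_def using that by (intro mult_right_mono) auto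
      finally show ?thesis .
    qed
    have e: "e1 < P" "e2 < P" "e3 < P" and eS: "e1 \<in> S" "e2 \<in> S" "e3 \<in> S"
      using v g less by (auto simp: e1_def e2_def e3_def)
    \<comment> \<open>Copy number 0 of the vertex for this triple: the digits of \<open>r\<close> in
      base \<open>P\<close> are the three pairs.\<close>
    define r where "r = e1 + P * (e2 + P * e3)"
    have r: "r mod P = e1" "r div P mod P = e2" "r div (P * P) mod P = e3"
      using e by (auto simp: r_def div_mult2_eq)
    have "e2 + P * e3 < P * P"
    proof -
      have "e2 + P * e3 < P * Suc e3" using e by simp
      also have "\<dots> \<le> P * P" using e by (intro mult_left_mono) auto
      finally show ?thesis .
    qed
    then have "r < P * Suc (e2 + P * e3)" "P * Suc (e2 + P * e3) \<le> P * (P * P)"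
      using e by (auto simp: r_def simp del: mult_Suc_right intro: mult_left_mono) (simp add: algebra_simps)
    then have rQ: "r < P * P * P" by (simp add: mult.assoc)
    also have "\<dots> \<le> P * P * P * (P + 1)" by simp
    finally have "B + r < n" by (simp add: n)
    moreover have "B + r \<notin> S" using no_neg[of "B + r"] calculation by simp
    ultimately obtain u where u: "u \<in> S" "csp_adj N D F u (B + r) \<or> csp_adj N D F (B + r) u"
      using dom by blast
    have "2 * P \<le> B" by (simp add: B)
    \<comment> \<open>The dominating vertex is the rejecting end of one of the three pairs, whose
      choosing end is also in \<open>S\<close>; but the two ends are adjacent.\<close>
    then have "u - P = e1 \<or> u - P = e2 \<or> u - P = e3" "P \<le> u"
      using u(2) S_less[OF u(1)] F r unfolding csp_adj_def P_def[symmetric] B_def[symmetric]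
      by (auto split: if_splits)
    then obtain e where "u = P + e" "e \<in> S" "e < P" using eS e by (metis le_add_diff_inverse)
    then have "csp_adj N D F e u" by (simp add: csp_adj_def P_def)
    with indep u(1) \<open>e \<in> S\<close> show False by blast
  qed
  with g have "solves N D F g" unfolding solves_def by blast
  then show ?thesis by (rule that)
qed

section \<open>Accepting runs as solutions of constraint satisfaction problems\<close>

text \<open>A halted machine idles by rewriting the symbols it scans, so that all steps up to a
  common time bound can be treated alike.\<close>

definition tm_act :: "turing_machine \<Rightarrow> nat \<Rightarrow> nat list \<Rightarrow> nat \<times> (nat \<times> head_move) list" where
  "tm_act M q rs = (if q < tm_states M then tm_delta M q rs else (q, keep rs))"

lemma tm_step_act:
  "tm_step M (q, ts) = (fst (tm_act M q (map tape_read ts)), map2 tape_act (snd (tm_act M q (map tape_read ts))) ts)"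
  by (simp add: tm_act_def map2_keep split: prod.splits)

lemma tm_act_wf:
  assumes "wf_tm M" "q \<le> tm_states M" "length rs = tm_tapes M" "\<forall>r\<in>set rs. r < tm_symbols M"
  shows "fst (tm_act M q rs) \<le> tm_states M" "length (snd (tm_act M q rs)) = tm_tapes M"
    "\<forall>a\<in>set (snd (tm_act M q rs)). fst a < tm_symbols M"
  using assms by (auto simp: tm_act_def wf_tm_def keep_def)

text \<open>The verifier's input is determined by \<open>x\<close> in its first
  \<open>2 * length x + 2\<close> cells; only the cells behind them have to be guessed.\<close>

lemma string_cells_pair:
  "string_cells (string_pair x y) (int i) =
    (if i < 2 * length x then bit_symbol (x ! (i div 2)) else if i = 2 * length x then 1
     else if i = 2 * length x + 1 then 2 else string_cells y (int (i - (2 * length x + 2))))"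
proof (induction x arbitrary: i)
  case Nil
  consider "i = 0" | "i = 1" | j where "i = Suc (Suc j)" by (metis One_nat_def not0_implies_Suc)
  then show ?case
    by cases (auto simp: string_pair_def string_cells_def bit_symbol_def nat_add_distrib)
next
  case (Cons b x)
  have eq: "string_pair (b # x) y = b # b # string_pair x y" by (simp add: string_pair_def)
  consider "i = 0" | "i = 1" | j where "i = Suc (Suc j)" by (metis One_nat_def not0_implies_Suc)
  then show ?case
  proof cases
    case 3
    have "string_cells (string_pair (b # x) y) (int i) = string_cells (string_pair x y) (int j)"
      unfolding eq 3 by (auto simp: string_cells_def nat_add_distrib)
    with Cons[of j] 3 show ?thesis by auto
  qed (auto simp: eq string_cells_def)
qed

lemma length_string_pair: "length (string_pair x y) = 2 * length x + 2 + length y"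
  by (induction x) (auto simp: string_pair_def)

section \<open>The run of a verifier as a table\<close>

locale np_verifier =
  fixes M :: turing_machine and pT py :: "nat poly" and R :: language
  assumes wf: "wf_tm M" and computes: "tm_computes_in_time M (\<lambda>z. [z \<in> R]) (poly pT)"
begin

abbreviation "K \<equiv> tm_tapes M"

definition conf :: "bool list \<Rightarrow> nat \<Rightarrow> tm_config" where
  "conf z t = (tm_step M ^^ t) (tm_init M z)"

definition state :: "bool list \<Rightarrow> nat \<Rightarrow> nat" where "state z t = fst (conf z t)"
definition cell :: "bool list \<Rightarrow> nat \<Rightarrow> nat \<Rightarrow> int \<Rightarrow> nat" where "cell z t k = fst (snd (conf z t) ! k)"
definition head :: "bool list \<Rightarrow> nat \<Rightarrow> nat \<Rightarrow> int" where "head z t k = snd (snd (conf z t) ! k)"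
definition reads :: "bool list \<Rightarrow> nat \<Rightarrow> nat list" where
  "reads z t = map (\<lambda>k. cell z t k (head z t k)) [0..<K]"
definition acts :: "bool list \<Rightarrow> nat \<Rightarrow> (nat \<times> head_move) list" where
  "acts z t = snd (tm_act M (state z t) (reads z t))"

lemma K_pos: "0 < K"
  using wf by (simp add: wf_tm_def)

text \<open>The induction carries all invariants at once, since \<open>wf_tm\<close> promises legal
  results only for legal states and scanned symbols. The bound on heads limits the part of a tape
  that a run of given length can visit.\<close>

lemma length_conf: "length (snd (conf z t)) = K"
  and reads_eq: "map tape_read (snd (conf z t)) = reads z t"
  and cell_bound: "k < K \<Longrightarrow> cell z t k i < tm_symbols M"
  and state_bound: "state z t \<le> tm_states M"
  and head_bound: "k < K \<Longrightarrow> \<bar>head z t k\<bar> \<le> int t"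
proof -
  have reads: "map tape_read (snd (conf z t)) = reads z t" if "length (snd (conf z t)) = K" for t
  proof (rule nth_equalityI)
    fix k assume "k < length (map tape_read (snd (conf z t)))"
    then show "map tape_read (snd (conf z t)) ! k = reads z t ! k"
      using that by (cases "snd (conf z t) ! k") (simp add: reads_def cell_def head_def)
  qed (use that in \<open>simp add: reads_def\<close>)
  have "length (snd (conf z t)) = K \<and> (\<forall>k<K. \<forall>i. cell z t k i < tm_symbols M) \<and>
    state z t \<le> tm_states M \<and> (\<forall>k<K. \<bar>head z t k\<bar> \<le> int t)"
  proof (induction t)
    case 0
    have "3 \<le> tm_symbols M" using wf by (simp add: wf_tm_def)
    then show ?case using K_pos
      by (auto simp: conf_def tm_init_def cell_def state_def head_def string_cells_def bit_symbol_def nth_Cons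
          split: nat.splits)
  next
    case (Suc t)
    have rs: "length (reads z t) = K" "\<forall>r\<in>set (reads z t). r < tm_symbols M"
      using Suc by (auto simp: reads_def)
    note act = tm_act_wf[OF wf _ rs, of "state z t"]
    have conf: "conf z (Suc t) = (fst (tm_act M (state z t) (reads z t)),
        map2 tape_act (acts z t) (snd (conf z t)))"
      using tm_step_act[of M "state z t" "snd (conf z t)"] reads[of t] Suc
      by (simp add: conf_def acts_def state_def)
    have len: "length (acts z t) = K" using act Suc by (simp add: acts_def)
    have nth: "snd (conf z (Suc t)) ! k = tape_act (acts z t ! k) (cell z t k, head z t k)" if "k < K" for k
      using that len Suc by (simp add: conf cell_def head_def)
    have "fst (acts z t ! k) < tm_symbols M" if "k < K" for k
      using act(3) Suc that len nth_mem by (fastforce simp: acts_def)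
    then have c: "\<forall>k<K. \<forall>i. cell z (Suc t) k i < tm_symbols M"
    proof (intro allI impI)
      fix k i assume "k < K"
      moreover from this have "cell z (Suc t) k = (cell z t k)(head z t k := fst (acts z t ! k))"
        by (cases "acts z t ! k") (simp add: cell_def[of z "Suc t"] nth)
      ultimately show "cell z (Suc t) k i < tm_symbols M"
        using Suc \<open>\<And>k. k < K \<Longrightarrow> fst (acts z t ! k) < tm_symbols M\<close> by simp
    qed
    have "\<bar>head_shift m\<bar> \<le> 1" for m by (cases m) auto
    then have h: "\<bar>head z (Suc t) k\<bar> \<le> int (Suc t)" if "k < K" for k
    proof -
      have "head z (Suc t) k = head z t k + head_shift (snd (acts z t ! k))"
        using that by (cases "acts z t ! k") (simp add: head_def[of z "Suc t"] nth)
      moreover have "\<bar>head z t k\<bar> \<le> int t" "\<bar>head_shift (snd (acts z t ! k))\<bar> \<le> 1"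
        using Suc that \<open>\<And>m. \<bar>head_shift m\<bar> \<le> 1\<close> by auto
      ultimately show ?thesis by linarith
    qed
    have "state z (Suc t) \<le> tm_states M" using act(1) Suc by (simp add: state_def[of z "Suc t"] conf)
    moreover have "length (snd (conf z (Suc t))) = K" using len Suc by (simp add: conf)
    ultimately show ?case using c h by blast
  qed
  then show "length (snd (conf z t)) = K" "k < K \<Longrightarrow> cell z t k i < tm_symbols M"
    "state z t \<le> tm_states M" "k < K \<Longrightarrow> \<bar>head z t k\<bar> \<le> int t" by auto
  then show "map tape_read (snd (conf z t)) = reads z t" by (intro reads)
qed

lemma reads_wf: "length (reads z t) = K" "\<forall>r\<in>set (reads z t). r < tm_symbols M"
  using cell_bound by (auto simp: reads_def)

lemma length_acts: "length (acts z t) = K"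
  using tm_act_wf[OF wf state_bound reads_wf] by (simp add: acts_def)

lemma state_Suc: "state z (Suc t) = fst (tm_act M (state z t) (reads z t))"
  and cell_Suc: "k < K \<Longrightarrow> cell z (Suc t) k = (cell z t k)(head z t k := fst (acts z t ! k))"
  and head_Suc: "k < K \<Longrightarrow> head z (Suc t) k = head z t k + head_shift (snd (acts z t ! k))"
proof -
  have conf: "conf z (Suc t) = (fst (tm_act M (state z t) (reads z t)),
      map2 tape_act (acts z t) (snd (conf z t)))"
    using tm_step_act[of M "state z t" "snd (conf z t)"] reads_eq[of z t]
    by (simp add: conf_def acts_def state_def)
  then show "state z (Suc t) = fst (tm_act M (state z t) (reads z t))"
    by (simp add: state_def)
  have "snd (conf z (Suc t)) ! k = tape_act (acts z t ! k) (cell z t k, head z t k)" if "k < K" for k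
    using that length_acts length_conf by (simp add: conf cell_def head_def)
  then show "k < K \<Longrightarrow> cell z (Suc t) k = (cell z t k)(head z t k := fst (acts z t ! k))"
    and "k < K \<Longrightarrow> head z (Suc t) k = head z t k + head_shift (snd (acts z t ! k))"
    by (cases "acts z t ! k"; simp add: cell_def[of z "Suc t"] head_def[of z "Suc t"])+
qed

lemma conf_0:
  "state z 0 = 0" "cell z 0 0 = string_cells z" "0 < k \<Longrightarrow> k < K \<Longrightarrow> cell z 0 k i = 0" "k < K \<Longrightarrow> head z 0 k = 0"
  by (auto simp: conf_def tm_init_def cell_def state_def head_def nth_Cons split: nat.splits)

definition in_len :: "bool list \<Rightarrow> nat" where
  "in_len x = 2 * length x + 2 + poly py (length x)"

definition T :: "bool list \<Rightarrow> nat" where "T x = poly pT (in_len x)"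

text \<open>Further steps do not change a halted configuration, so the answer can be inspected at
  the uniform time \<open>T x\<close>. The symbol 2 at the origin is the output bit
  \<open>True\<close>.\<close>

lemma accepts_iff:
  assumes "length z \<le> in_len x"
  shows "cell z (T x) 0 0 = 2 \<longleftrightarrow> z \<in> R"
proof -
  obtain t where t: "t \<le> poly pT (length z)" "fst (conf z t) = tm_states M"
    "fst (snd (conf z t) ! 0) = string_cells [z \<in> R]"
    using computes unfolding tm_computes_in_time_def conf_def by fastforce
  have "t \<le> T x" using t(1) poly_nat_mono[OF assms, of pT] by (simp add: T_def)
  moreover have "conf z (t + i) = conf z t" for i
  proof (induction i)
    case (Suc i)
    then show ?case using t(2) by (cases "conf z t") (simp add: conf_def)
  qed simp
  ultimately have "conf z (T x) = conf z t" by (metis le_add_diff_inverse)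
  then show ?thesis using t(3) by (simp add: cell_def string_cells_def bit_symbol_def)
qed

text \<open>A view contains all that a transition depends on, and its index serves as a value.
  Repetitions in the list are harmless.\<close>

definition views :: "(nat \<times> nat list) list" where
  "views = (SOME vs. set vs = {..tm_states M} \<times> {rs. set rs \<subseteq> {..<tm_symbols M} \<and> length rs = K})"

lemma set_views: "set views = {..tm_states M} \<times> {rs. set rs \<subseteq> {..<tm_symbols M} \<and> length rs = K}"
  unfolding views_def by (rule someI_ex, rule finite_list) (simp add: finite_lists_length_eq)

abbreviation "NV \<equiv> length views"

text \<open>The default 0 gives this function and the following ones the shape required by
  \<open>fn_table\<close> and \<open>fn_table2\<close>.\<close>

definition vstate :: "nat \<Rightarrow> nat" where
  "vstate a = (if a < NV then fst (views ! a) else 0)"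
definition vread :: "nat \<Rightarrow> nat \<Rightarrow> nat" where
  "vread a k = (if a < NV \<and> k < K then snd (views ! a) ! k else 0)"
definition vnext :: "nat \<Rightarrow> nat" where
  "vnext a = (if a < NV then fst (tm_act M (fst (views ! a)) (snd (views ! a))) else 0)"
definition vwrite :: "nat \<Rightarrow> nat \<Rightarrow> nat" where
  "vwrite a k = (if a < NV \<and> k < K then fst (snd (tm_act M (fst (views ! a)) (snd (views ! a))) ! k) else 0)"
text \<open>The shift is increased by 1 to make a left move a natural number; a \<open>Suc\<close>
  in \<open>bad3\<close> compensates for this.\<close>

definition vmove :: "nat \<Rightarrow> nat \<Rightarrow> nat" where
  "vmove a k = (if a < NV \<and> k < K
    then nat (1 + head_shift (snd (snd (tm_act M (fst (views ! a)) (snd (views ! a))) ! k))) else 0)"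

lemma view_props:
  assumes "a < NV" "views ! a = (state z t, reads z t)"
  shows "vstate a = state z t" "vnext a = state z (Suc t)"
    "k < K \<Longrightarrow> vread a k = cell z t k (head z t k)"
    "k < K \<Longrightarrow> vwrite a k = fst (acts z t ! k)"
    "k < K \<Longrightarrow> int (vmove a k) = 1 + head_shift (snd (acts z t ! k))"
proof -
  have "0 \<le> 1 + head_shift m" for m by (cases m) auto
  then show "k < K \<Longrightarrow> int (vmove a k) = 1 + head_shift (snd (acts z t ! k))"
    using assms by (simp add: vmove_def acts_def)
qed (use assms in \<open>simp_all add: vstate_def vnext_def vread_def vwrite_def acts_def state_Suc reads_def\<close>)

text \<open>\<open>B x\<close> is the index given to the origin of a tape: up to time
  \<open>T x\<close> heads stay within distance \<open>T x\<close> of it, and the input extends over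
  at most \<open>in_len x\<close> cells to its right. \<open>D x\<close> exceeds all indices of
  cells, views and symbols and all codes \<kappa> in use.\<close>

definition B :: "bool list \<Rightarrow> nat" where "B x = T x + in_len x"
definition D :: "bool list \<Rightarrow> nat" where "D x = 2 * B x + (NV + 2 * K + tm_symbols M + 4)"

text \<open>
  A pair is coded as \<open>((\<kappa> * D + t) * D + j) * D + a\<close>. For \<open>1 \<le> \<kappa> \<le> K\<close> it says that at time \<open>t\<close> cell
  \<open>j - B\<close> of tape \<open>\<kappa> - 1\<close> contains \<open>a\<close>; for \<open>K < \<kappa> \<le> 2 * K\<close> that the head of tape \<open>\<kappa> - K - 1\<close> is at \<open>a - B\<close>
  at time \<open>t\<close>; for \<open>\<kappa> = 2 * K + 1\<close> that \<open>a\<close> is the index in \<open>views\<close> of the state and the symbols read at time \<open>t\<close>.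
  Heads and views do not depend on \<open>j\<close>. Variables with \<open>\<kappa> = 0\<close> only serve to make the pair \<open>0\<close> forbidden.
\<close>

definition bad_init :: "bool list \<Rightarrow> nat \<Rightarrow> nat \<Rightarrow> nat \<Rightarrow> bool" where
  "bad_init x \<kappa> j a \<longleftrightarrow> a \<noteq>
    (if \<kappa> \<noteq> 1 \<or> j < B x then 0
     else if j < B x + 2 * length x
       then if bit_at x ((j - B x) div 2) then 2 else 1
     else if j = B x + 2 * length x then 1
     else if j = B x + 2 * length x + 1 then 2
     else if j < B x + in_len x then (if a \<le> 2 then a else 0)
     else 0)"

text \<open>The first clause makes the pair 0 forbidden, as \<open>kRiDF_csp_if_solves\<close>
  requires; the last clause demands acceptance. On the tapes the only freedom at time 0 is in the
  certificate area, where \<open>bad_init\<close> admits the symbols 0, 1 and 2.\<close>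

definition bad1 :: "bool list \<Rightarrow> nat \<Rightarrow> nat \<Rightarrow> nat \<Rightarrow> nat \<Rightarrow> bool" where
  "bad1 x \<kappa> t j a \<longleftrightarrow>
    \<kappa> = 0 \<and> t = 0 \<and> j = 0 \<and> a = 0 \<or>
    \<kappa> = 2 * K + 1 \<and> (NV \<le> a \<or> t = 0 \<and> vstate a \<noteq> 0) \<or>
    K < \<kappa> \<and> \<kappa> \<le> 2 * K \<and> t = 0 \<and> a \<noteq> B x \<or>
    0 < \<kappa> \<and> \<kappa> \<le> K \<and> t = 0 \<and> bad_init x \<kappa> j a \<or>
    \<kappa> = 1 \<and> t = T x \<and> j = B x \<and> a \<noteq> 2"

text \<open>By the first clause a blank in the certificate area is followed by blanks only, so the
  guessed symbols spell a string. The second one passes the state on from view to view.\<close>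

definition bad2 :: "bool list \<Rightarrow> nat \<Rightarrow> nat \<Rightarrow> nat \<Rightarrow> nat \<Rightarrow> nat \<Rightarrow> nat \<Rightarrow> nat \<Rightarrow> nat \<Rightarrow> bool" where
  "bad2 x \<kappa> t j a \<kappa>' t' j' a' \<longleftrightarrow>
    \<kappa> = 1 \<and> \<kappa>' = 1 \<and> t = 0 \<and> t' = 0 \<and> j' = Suc j \<and> B x + 2 * length x + 2 \<le> j \<and> a = 0 \<and> a' \<noteq> 0 \<or>
    \<kappa> = 2 * K + 1 \<and> \<kappa>' = 2 * K + 1 \<and> t' = Suc t \<and> t < T x \<and> vstate a' \<noteq> vnext a"

text \<open>The clauses say that views show the scanned symbols, heads move and symbols are written
  as the view prescribes, and other cells persist. Comparing the head's value \<open>a'\<close> with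
  the index \<open>j''\<close> addresses the scanned cell.\<close>

definition bad3 :: "bool list \<Rightarrow> nat \<Rightarrow> nat \<Rightarrow> nat \<Rightarrow> nat \<Rightarrow> nat \<Rightarrow> nat \<Rightarrow> nat \<Rightarrow> nat \<Rightarrow>
    nat \<Rightarrow> nat \<Rightarrow> nat \<Rightarrow> nat \<Rightarrow> bool" where
  "bad3 x \<kappa> t j a \<kappa>' t' j' a' \<kappa>'' t'' j'' a'' \<longleftrightarrow> t' = t \<and> t < T x \<and> (
    \<kappa> = 2 * K + 1 \<and> \<kappa>' = K + \<kappa>'' \<and> 0 < \<kappa>'' \<and> \<kappa>'' \<le> K \<and> t'' = t \<and> a' = j'' \<and> a'' \<noteq> vread a (\<kappa>'' - 1) \<or>
    \<kappa> = 2 * K + 1 \<and> \<kappa>' = \<kappa>'' \<and> K < \<kappa>' \<and> \<kappa>' \<le> 2 * K \<and> t'' = Suc t \<and> Suc a'' \<noteq> a' + vmove a (\<kappa>' - Suc K) \<or>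
    \<kappa> = 2 * K + 1 \<and> \<kappa>' = K + \<kappa>'' \<and> 0 < \<kappa>'' \<and> \<kappa>'' \<le> K \<and> t'' = Suc t \<and> a' = j'' \<and> a'' \<noteq> vwrite a (\<kappa>'' - 1) \<or>
    \<kappa> = K + \<kappa>' \<and> \<kappa>' = \<kappa>'' \<and> 0 < \<kappa>'' \<and> \<kappa>'' \<le> K \<and> t'' = Suc t \<and> j' = j'' \<and> j' \<noteq> a \<and> a' \<noteq> a'')"

definition bad :: "bool list \<Rightarrow> nat \<Rightarrow> nat \<Rightarrow> nat \<Rightarrow> bool" where
  "bad x e1 e2 e3 \<longleftrightarrow>
    bad1 x (e1 div (D x * D x * D x)) (e1 div (D x * D x) mod D x) (e1 div D x mod D x) (e1 mod D x) \<or>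
    bad2 x (e1 div (D x * D x * D x)) (e1 div (D x * D x) mod D x) (e1 div D x mod D x) (e1 mod D x)
      (e2 div (D x * D x * D x)) (e2 div (D x * D x) mod D x) (e2 div D x mod D x) (e2 mod D x) \<or>
    bad3 x (e1 div (D x * D x * D x)) (e1 div (D x * D x) mod D x) (e1 div D x mod D x) (e1 mod D x)
      (e2 div (D x * D x * D x)) (e2 div (D x * D x) mod D x) (e2 div D x mod D x) (e2 mod D x)
      (e3 div (D x * D x * D x)) (e3 div (D x * D x) mod D x) (e3 div D x mod D x) (e3 mod D x)"

lemma D_pos: "0 < D x" by (simp add: D_def)

lemma bad_0: "bad x 0 e2 e3" by (simp add: bad_def bad1_def)

definition consistent :: "bool list \<Rightarrow> (nat \<Rightarrow> nat \<Rightarrow> nat \<Rightarrow> nat) \<Rightarrow> bool" where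
  "consistent x G \<longleftrightarrow> (\<forall>\<kappa><D x. \<forall>t<D x. \<forall>j<D x. G \<kappa> t j < D x \<and> \<not> bad1 x \<kappa> t j (G \<kappa> t j) \<and>
    (\<forall>\<kappa>'<D x. \<forall>t'<D x. \<forall>j'<D x. \<not> bad2 x \<kappa> t j (G \<kappa> t j) \<kappa>' t' j' (G \<kappa>' t' j') \<and>
      (\<forall>\<kappa>''<D x. \<forall>t''<D x. \<forall>j''<D x.
        \<not> bad3 x \<kappa> t j (G \<kappa> t j) \<kappa>' t' j' (G \<kappa>' t' j') \<kappa>'' t'' j'' (G \<kappa>'' t'' j''))))"

lemma digits:
  assumes "t < (d::nat)" "j < d" "a < d"
  shows "(((\<kappa> * d + t) * d + j) * d + a) div (d * d * d) = \<kappa>"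
    "(((\<kappa> * d + t) * d + j) * d + a) div (d * d) mod d = t"
    "(((\<kappa> * d + t) * d + j) * d + a) div d mod d = j"
    "(((\<kappa> * d + t) * d + j) * d + a) mod d = a"
  using assms by (simp_all add: div_mult2_eq)

lemma var_digits:
  assumes "v < d * d * d"
  shows "v = (v div (d * d) * d + v div d mod d) * d + v mod d" "v div (d * d) < d" "v div d mod d < d" "v mod d < (d::nat)"
proof -
  have d: "0 < d" using assms by (cases d) auto
  show "v = (v div (d * d) * d + v div d mod d) * d + v mod d"
    using div_mult_mod_eq[of "v div d" d] by (simp add: div_mult2_eq)
  show "v div (d * d) < d" using assms by (simp add: less_mult_imp_div_less mult.commute mult.left_commute)
qed (use assms in \<open>cases d; simp\<close>)+

lemma var_less:
  assumes "\<kappa> < d" "t < d" "j < (d::nat)"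
  shows "(\<kappa> * d + t) * d + j < d * d * d"
proof -
  have "\<kappa> * d + t < Suc \<kappa> * d" using assms by simp
  also have "\<dots> \<le> d * d" using assms by (intro mult_right_mono) auto
  finally have "Suc (\<kappa> * d + t) * d \<le> d * d * d" by (intro mult_right_mono) auto
  moreover have "(\<kappa> * d + t) * d + j < Suc (\<kappa> * d + t) * d" using assms by simp
  ultimately show ?thesis by linarith
qed

text \<open>A change of coordinates: a variable has the digits \<kappa>, \<open>t\<close>,
  \<open>j\<close> in base \<open>D x\<close>, and forming a pair appends the value as a fourth
  digit.\<close>

lemma solves_iff_consistent:
  "(\<exists>g. solves (D x * D x * D x) (D x) (bad x) g) \<longleftrightarrow> (\<exists>G. consistent x G)"
proof
  let ?d = "D x"
  assume "\<exists>g. solves (?d * ?d * ?d) ?d (bad x) g"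
  then obtain g where g: "solves (?d * ?d * ?d) ?d (bad x) g" by blast
  define G where "G \<kappa> t j = g ((\<kappa> * ?d + t) * ?d + j)" for \<kappa> t j
  have less: "G \<kappa> t j < ?d" if "\<kappa> < ?d" "t < ?d" "j < ?d" for \<kappa> t j
    using g var_less[OF that] by (simp add: solves_def G_def)
  have nb: "\<not> bad1 x \<kappa> t j (G \<kappa> t j) \<and> \<not> bad2 x \<kappa> t j (G \<kappa> t j) \<kappa>' t' j' (G \<kappa>' t' j') \<and>
    \<not> bad3 x \<kappa> t j (G \<kappa> t j) \<kappa>' t' j' (G \<kappa>' t' j') \<kappa>'' t'' j'' (G \<kappa>'' t'' j'')"
    if "\<kappa> < ?d" "t < ?d" "j < ?d" "\<kappa>' < ?d" "t' < ?d" "j' < ?d" "\<kappa>'' < ?d" "t'' < ?d" "j'' < ?d"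
    for \<kappa> t j \<kappa>' t' j' \<kappa>'' t'' j''
  proof -
    have "\<not> bad x (((\<kappa> * ?d + t) * ?d + j) * ?d + G \<kappa> t j) (((\<kappa>' * ?d + t') * ?d + j') * ?d + G \<kappa>' t' j')
      (((\<kappa>'' * ?d + t'') * ?d + j'') * ?d + G \<kappa>'' t'' j'')"
      using g var_less[OF that(1-3)] var_less[OF that(4-6)] var_less[OF that(7-9)]
      unfolding solves_def G_def by blast
    then show ?thesis
      unfolding bad_def digits[OF that(2,3) less[OF that(1-3)]] digits[OF that(5,6) less[OF that(4-6)]]
        digits[OF that(8,9) less[OF that(7-9)]] by blast
  qed
  have "consistent x G"
    unfolding consistent_def
  proof (intro allI impI conjI)
    fix \<kappa> t j assume 1: "\<kappa> < ?d" "t < ?d" "j < ?d"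
    show "G \<kappa> t j < ?d" by (rule less[OF 1])
    show "\<not> bad1 x \<kappa> t j (G \<kappa> t j)" using nb[OF 1 1 1] by blast
    fix \<kappa>' t' j' assume 2: "\<kappa>' < ?d" "t' < ?d" "j' < ?d"
    show "\<not> bad2 x \<kappa> t j (G \<kappa> t j) \<kappa>' t' j' (G \<kappa>' t' j')" using nb[OF 1 2 2] by blast
    fix \<kappa>'' t'' j'' assume 3: "\<kappa>'' < ?d" "t'' < ?d" "j'' < ?d"
    show "\<not> bad3 x \<kappa> t j (G \<kappa> t j) \<kappa>' t' j' (G \<kappa>' t' j') \<kappa>'' t'' j'' (G \<kappa>'' t'' j'')"
      using nb[OF 1 2 3] by blast
  qed
  then show "\<exists>G. consistent x G" by blast
next
  let ?d = "D x"
  assume "\<exists>G. consistent x G"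
  then obtain G where G: "consistent x G" by blast
  define g where "g v = G (v div (?d * ?d)) (v div ?d mod ?d) (v mod ?d)" for v
  have g_less: "g v < ?d" if "v < ?d * ?d * ?d" for v
    using G var_digits[OF that] unfolding consistent_def g_def by blast
  have dig: "(v * ?d + g v) div (?d * ?d * ?d) = v div (?d * ?d)"
    "(v * ?d + g v) div (?d * ?d) mod ?d = v div ?d mod ?d"
    "(v * ?d + g v) div ?d mod ?d = v mod ?d" "(v * ?d + g v) mod ?d = g v" if "v < ?d * ?d * ?d" for v
    using digits[of "v div ?d mod ?d" ?d "v mod ?d" "g v" "v div (?d * ?d)"] var_digits[OF that] g_less[OF that]
    by simp_all
  have "\<not> bad x (v1 * ?d + g v1) (v2 * ?d + g v2) (v3 * ?d + g v3)"
    if "v1 < ?d * ?d * ?d" "v2 < ?d * ?d * ?d" "v3 < ?d * ?d * ?d" for v1 v2 v3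
    unfolding bad_def dig[OF that(1)] dig[OF that(2)] dig[OF that(3)]
    using G[unfolded consistent_def, rule_format, OF var_digits(2-4)[OF that(1)]]
      conjunct1[OF G[unfolded consistent_def, rule_format, OF var_digits(2-4)[OF that(1)],
        THEN conjunct2, THEN conjunct2, rule_format, OF var_digits(2-4)[OF that(2)]]]
      conjunct2[OF G[unfolded consistent_def, rule_format, OF var_digits(2-4)[OF that(1)],
        THEN conjunct2, THEN conjunct2, rule_format, OF var_digits(2-4)[OF that(2)]],
        rule_format, OF var_digits(2-4)[OF that(3)]]
    by (simp add: g_def)
  with g_less have "solves (?d * ?d * ?d) ?d (bad x) g" unfolding solves_def by blast
  then show "\<exists>g. solves (?d * ?d * ?d) ?d (bad x) g" by blast
qed

section \<open>Consistent assignments correspond to accepting runs\<close>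

lemma consistentD:
  assumes "consistent x G" "\<kappa> < D x" "t < D x" "j < D x"
  shows "G \<kappa> t j < D x" "\<not> bad1 x \<kappa> t j (G \<kappa> t j)"
    "\<kappa>' < D x \<Longrightarrow> t' < D x \<Longrightarrow> j' < D x \<Longrightarrow> \<not> bad2 x \<kappa> t j (G \<kappa> t j) \<kappa>' t' j' (G \<kappa>' t' j')"
    "\<kappa>' < D x \<Longrightarrow> t' < D x \<Longrightarrow> j' < D x \<Longrightarrow> \<kappa>'' < D x \<Longrightarrow> t'' < D x \<Longrightarrow> j'' < D x \<Longrightarrow>
      \<not> bad3 x \<kappa> t j (G \<kappa> t j) \<kappa>' t' j' (G \<kappa>' t' j') \<kappa>'' t'' j'' (G \<kappa>'' t'' j'')"
proof -
  note A = assms(1)[unfolded consistent_def, rule_format, OF assms(2-4)]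
  show "G \<kappa> t j < D x" "\<not> bad1 x \<kappa> t j (G \<kappa> t j)" using A by simp_all
  note B = A[THEN conjunct2, THEN conjunct2, rule_format, of \<kappa>' t' j']
  show "\<kappa>' < D x \<Longrightarrow> t' < D x \<Longrightarrow> j' < D x \<Longrightarrow> \<not> bad2 x \<kappa> t j (G \<kappa> t j) \<kappa>' t' j' (G \<kappa>' t' j')"
    using B by simp
  show "\<kappa>' < D x \<Longrightarrow> t' < D x \<Longrightarrow> j' < D x \<Longrightarrow> \<kappa>'' < D x \<Longrightarrow> t'' < D x \<Longrightarrow> j'' < D x \<Longrightarrow>
      \<not> bad3 x \<kappa> t j (G \<kappa> t j) \<kappa>' t' j' (G \<kappa>' t' j') \<kappa>'' t'' j'' (G \<kappa>'' t'' j'')"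
    using B by simp
qed

lemma bounds:
  "B x + T x < D x" "T x \<le> B x" "2 * K + 1 < D x" "B x + in_len x < D x" "2 * length x + 2 \<le> in_len x"
  "NV < D x" "tm_symbols M < D x" "1 < D x"
  by (auto simp: D_def B_def in_len_def)

lemma input_of_consistent:
  assumes G: "consistent x G"
  obtains y where "length y \<le> poly py (length x)"
    "\<And>j. j < D x \<Longrightarrow> G 1 0 j = string_cells (string_pair x y) (int j - int (B x))"
proof -
  define m where "m = B x + 2 * length x + 2"
  define w where "w i = G 1 0 (m + i)" for i
  note b = bounds[of x]
  have good: "\<not> bad_init x 1 j (G 1 0 j)" if "j < D x" for j
    using consistentD(2)[OF G, of 1 0 j] that b K_pos by (simp add: bad1_def)
  have w_le: "w i \<le> 2" if "i < poly py (length x)" for i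
  proof -
    have "m + i < B x + in_len x" using that by (simp add: m_def in_len_def)
    then show ?thesis using good[of "m + i"] b
      by (auto simp: bad_init_def w_def m_def split: if_splits)
  qed
  have w_0: "w i = 0" if "poly py (length x) \<le> i" "m + i < D x" for i
  proof -
    have "B x + in_len x \<le> m + i" using that by (simp add: m_def in_len_def)
    then show ?thesis using good[of "m + i"] that b
      by (auto simp: bad_init_def w_def m_def split: if_splits)
  qed
  have w_Suc: "w (Suc i) = 0" if "w i = 0" "m + Suc i < D x" for i
    using consistentD(3)[OF G, of 1 0 "m + i" 1 0 "m + Suc i"] that b
    by (auto simp: bad2_def w_def m_def)
  \<comment> \<open>The certificate ends at the first guessed blank, or has maximal length if there
    is none.\<close>
  define l where "l = (LEAST i. i = poly py (length x) \<or> w i = 0)"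
  have l: "l = poly py (length x) \<or> w l = 0" unfolding l_def by (rule LeastI[of _ "poly py (length x)"]) simp
  have l_le: "l \<le> poly py (length x)" unfolding l_def by (rule Least_le) simp
  have before: "w i = 1 \<or> w i = 2" if "i < l" for i
  proof -
    have "w i \<noteq> 0" using not_less_Least[of i] that unfolding l_def by blast
    then show ?thesis using w_le[of i] that l_le by linarith
  qed
  have after: "w (l + i) = 0" if "m + (l + i) < D x" for i
    using that
  proof (induction i)
    case 0
    then show ?case using l w_0[of l] by auto
  next
    case (Suc i)
    then show ?case using w_Suc[of "l + i"] by simp
  qed
  define y where "y = map (\<lambda>i. w i = 2) [0..<l]"
  have "G 1 0 j = string_cells (string_pair x y) (int j - int (B x))" if j: "j < D x" for j
  proof -
    consider "j < B x" | i where "j = B x + i" "i < 2 * length x + 2" | i where "j = m + i"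
      unfolding m_def by (metis add.assoc le_add_diff_inverse not_less)
    then show ?thesis
    proof cases
      case 1
      then show ?thesis using good[OF j] by (simp add: bad_init_def string_cells_def)
    next
      case 2
      have "i < 2 * length x \<or> i = 2 * length x \<or> i = 2 * length x + 1" using 2 by linarith
      then show ?thesis using good[OF j] 2 string_cells_pair[of x y i]
        by (auto simp: bad_init_def bit_at_def bit_symbol_def split: if_splits)
    next
      case 3
      have "int j - int (B x) = int (2 * length x + 2 + i)" using 3 by (simp add: m_def)
      then have eq: "string_cells (string_pair x y) (int j - int (B x)) = string_cells y (int i)"
        using string_cells_pair[of x y "2 * length x + 2 + i"] by simp
      show ?thesis
      proof (cases "i < l")
        case True
        then show ?thesis unfolding eq using before[of i] 3
          by (auto simp: string_cells_def y_def bit_symbol_def w_def)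
      next
        case False
        then show ?thesis unfolding eq using after[of "i - l"] 3 j
          by (simp add: string_cells_def y_def w_def)
      qed
    qed
  qed
  then show ?thesis using l_le by (intro that[of y]) (simp_all add: y_def)
qed

lemma accepted_if_consistent:
  assumes G: "consistent x G"
  shows "\<exists>y. length y \<le> poly py (length x) \<and> string_pair x y \<in> R"
proof -
  obtain y where y: "length y \<le> poly py (length x)"
    and init: "\<And>j. j < D x \<Longrightarrow> G 1 0 j = string_cells (string_pair x y) (int j - int (B x))"
    using input_of_consistent[OF G] by blast
  define z where "z = string_pair x y"
  note b = bounds[of x] and D0 = D_pos[of x]
  have view_less: "G (2 * K + 1) t 0 < NV" if "t < D x" for t
    using consistentD(2)[OF G, of "2 * K + 1" t 0] that b D0 by (auto simp: bad1_def)
  \<comment> \<open>The constraints determine the table from one time to the next. Views and heads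
    have a copy for every \<open>j\<close>; the copy with \<open>j = 0\<close> represents
    them.\<close>
  have run: "vstate (G (2 * K + 1) t 0) = state z t \<and>
    (\<forall>k<K. int (G (Suc K + k) t 0) = head z t k + int (B x) \<and>
      (\<forall>j<D x. G (Suc k) t j = cell z t k (int j - int (B x))))" if "t \<le> T x" for t
    using that
  proof (induction t)
    case 0
    have "vstate (G (2 * K + 1) 0 0) = state z 0"
      using consistentD(2)[OF G, of "2 * K + 1" 0 0] b D0 by (auto simp: bad1_def conf_0)
    moreover have "int (G (Suc K + k) 0 0) = head z 0 k + int (B x)" if "k < K" for k
      using consistentD(2)[OF G, of "Suc K + k" 0 0] b D0 that by (auto simp: bad1_def conf_0)
    moreover have "G (Suc k) 0 j = cell z 0 k (int j - int (B x))" if "k < K" "j < D x" for k j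
    proof (cases "k = 0")
      case True
      then show ?thesis using init[OF that(2)] by (simp add: conf_0 z_def)
    next
      case False
      then show ?thesis using consistentD(2)[OF G, of "Suc k" 0 j] b D0 that
        by (auto simp: bad1_def conf_0 bad_init_def)
    qed
    ultimately show ?case by blast
  next
    case (Suc t)
    define a where "a = G (2 * K + 1) t 0"
    have t: "t < T x" "t < D x" "Suc t < D x" using Suc.prems b by auto
    have IH: "vstate a = state z t" "\<And>k. k < K \<Longrightarrow> int (G (Suc K + k) t 0) = head z t k + int (B x)"
      "\<And>k j. k < K \<Longrightarrow> j < D x \<Longrightarrow> G (Suc k) t j = cell z t k (int j - int (B x))"
      using Suc by (auto simp: a_def)
    have hd_less: "G (Suc K + k) t 0 < D x" if "k < K" for k
      using consistentD(1)[OF G, of "Suc K + k" t 0] that b t D0 by simp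
    have a: "a < NV" using view_less t by (simp add: a_def)
    have step: "\<not> bad3 x (2 * K + 1) t 0 a (Suc K + k) t 0 (G (Suc K + k) t 0) \<kappa> t' j (G \<kappa> t' j)"
      if "k < K" "\<kappa> < D x" "t' < D x" "j < D x" for k \<kappa> t' j
      using consistentD(4)[OF G, of "2 * K + 1" t 0 "Suc K + k" t 0 \<kappa> t' j] that b D0 t by (simp add: a_def)
    \<comment> \<open>So far the view is only known to have the right state. Using the value of the
      head variable as index of a cell shows that its symbols are right as well.\<close>
    have "vread a k = cell z t k (head z t k)" if "k < K" for k
      using step[of k "Suc k" t "G (Suc K + k) t 0"] IH(2)[OF that] IH(3)[OF that hd_less[OF that]]
        that b t hd_less[OF that] by (simp add: bad3_def)
    moreover have "length (snd (views ! a)) = K" using nth_mem[OF a] set_views by auto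
    ultimately have "snd (views ! a) = reads z t"
      using a by (intro nth_equalityI) (auto simp: reads_def vread_def)
    then have "views ! a = (state z t, reads z t)"
      using IH(1) a by (simp add: vstate_def prod_eq_iff)
    note v = view_props[OF a this]
    have "vstate (G (2 * K + 1) (Suc t) 0) = state z (Suc t)"
      using consistentD(3)[OF G, of "2 * K + 1" t 0 "2 * K + 1" "Suc t" 0] b D0 t v(2)
      by (simp add: bad2_def a_def)
    moreover have "int (G (Suc K + k) (Suc t) 0) = head z (Suc t) k + int (B x)" if "k < K" for k
    proof -
      have "Suc (G (Suc K + k) (Suc t) 0) = G (Suc K + k) t 0 + vmove a k"
        using step[of k "Suc K + k" "Suc t" 0] that b t D0 by (simp add: bad3_def)
      then have "int (Suc (G (Suc K + k) (Suc t) 0)) = int (G (Suc K + k) t 0) + int (vmove a k)"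
        by simp
      then show ?thesis using IH(2)[OF that] v(5)[OF that] by (simp add: head_Suc[OF that])
    qed
    moreover have "G (Suc k) (Suc t) j = cell z (Suc t) k (int j - int (B x))" if k: "k < K" and j: "j < D x" for k j
    proof (cases "j = G (Suc K + k) t 0")
      case True
      then have "int j - int (B x) = head z t k" using IH(2)[OF k] by simp
      moreover have "G (Suc k) (Suc t) j = vwrite a k"
        using step[of k "Suc k" "Suc t" j] k j b t True by (simp add: bad3_def)
      ultimately show ?thesis using v(4)[OF k] by (simp add: cell_Suc[OF k])
    next
      case False
      then have "int j - int (B x) \<noteq> head z t k" using IH(2)[OF k] by auto
      moreover have "G (Suc k) (Suc t) j = G (Suc k) t j"
        using consistentD(4)[OF G, of "Suc K + k" t 0 "Suc k" t j "Suc k" "Suc t" j] k j b t D0 False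
        by (simp add: bad3_def)
      ultimately show ?thesis using IH(3)[OF k j] by (simp add: cell_Suc[OF k])
    qed
    ultimately show ?case by blast
  qed
  have "G 1 (T x) (B x) = 2"
    using consistentD(2)[OF G, of 1 "T x" "B x"] b by (auto simp: bad1_def)
  moreover have "G (Suc 0) (T x) (B x) = cell z (T x) 0 (int (B x) - int (B x))"
    using run[of "T x"] K_pos b by auto
  ultimately have "cell z (T x) 0 0 = 2" by simp
  then have "z \<in> R" using accepts_iff[of z x] y by (simp add: z_def length_string_pair in_len_def)
  then show ?thesis using y z_def by blast
qed

definition view :: "bool list \<Rightarrow> nat \<Rightarrow> nat" where
  "view z t = (SOME a. a < NV \<and> views ! a = (state z t, reads z t))"

lemma view: "view z t < NV \<and> views ! view z t = (state z t, reads z t)"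
proof -
  have "(state z t, reads z t) \<in> set views"
    unfolding set_views using state_bound reads_wf by auto
  then have "\<exists>a. a < NV \<and> views ! a = (state z t, reads z t)" by (simp add: in_set_conv_nth)
  then show ?thesis unfolding view_def by (rule someI_ex)
qed

text \<open>Times range up to \<open>D x\<close>, beyond \<open>T x\<close>, where successive times
  are no longer linked by constraints; heads are frozen there to keep their values below
  \<open>D x\<close>. The value 1 for \<kappa> = 0 avoids the forbidden pair 0.\<close>

definition tableau :: "bool list \<Rightarrow> bool list \<Rightarrow> nat \<Rightarrow> nat \<Rightarrow> nat \<Rightarrow> nat" where
  "tableau x z \<kappa> t j =
    (if \<kappa> = 0 then 1
     else if \<kappa> \<le> K then cell z t (\<kappa> - 1) (int j - int (B x))
     else if \<kappa> \<le> 2 * K then nat (head z (min t (T x)) (\<kappa> - Suc K) + int (B x))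
     else if \<kappa> = 2 * K + 1 then view z t else 0)"

lemma consistent_tableau:
  assumes y: "length y \<le> poly py (length x)" and z: "z = string_pair x y" "z \<in> R"
  shows "consistent x (tableau x z)"
proof -
  note b = bounds[of x]
  have hb: "head z t k + int (B x) \<ge> 0" "head z t k + int (B x) < int (D x)" if "k < K" "t \<le> T x" for k t
    using head_bound[OF that(1), of z t] that b by linarith+
  have cells: "tableau x z \<kappa> t j = cell z t (\<kappa> - 1) (int j - int (B x))" if "0 < \<kappa>" "\<kappa> \<le> K" for \<kappa> t j
    using that by (simp add: tableau_def)
  have heads: "int (tableau x z \<kappa> t j) = head z t (\<kappa> - Suc K) + int (B x)"
    if "K < \<kappa>" "\<kappa> \<le> 2 * K" "t \<le> T x" for \<kappa> t j
    using that hb[of "\<kappa> - Suc K" t] by (simp add: tableau_def)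
  have vws: "tableau x z (Suc (2 * K)) t j = view z t" for t j by (simp add: tableau_def)
  note v = view_props[OF conjunct1[OF view] conjunct2[OF view]]
  have acc: "cell z (T x) 0 0 = 2"
    using accepts_iff[of z x] y z by (simp add: length_string_pair in_len_def)
  have less: "tableau x z \<kappa> t j < D x" for \<kappa> t j
  proof -
    have "cell z t (\<kappa> - 1) (int j - int (B x)) < D x" if "0 < \<kappa>" "\<kappa> \<le> K"
      using less_trans[OF cell_bound[of "\<kappa> - 1" z t "int j - int (B x)"] b(7)] that by linarith
    moreover have "nat (head z (min t (T x)) (\<kappa> - Suc K) + int (B x)) < D x" if "K < \<kappa>" "\<kappa> \<le> 2 * K"
    proof -
      have "\<kappa> - Suc K < K" using that by linarith
      from hb[OF this, of "min t (T x)"] show ?thesis by simp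
    qed
    moreover have "view z t < D x" using view[of z t] b by simp
    ultimately show ?thesis using b by (simp add: tableau_def)
  qed
  have init: "\<not> bad_init x \<kappa> j (cell z 0 (\<kappa> - 1) (int j - int (B x)))" if "0 < \<kappa>" "\<kappa> \<le> K" for \<kappa> j
  proof (cases "\<kappa> = 1")
    case False
    then show ?thesis using that by (simp add: bad_init_def conf_0)
  next
    case True
    show ?thesis
    proof (cases "j < B x")
      case True
      then show ?thesis using \<open>\<kappa> = 1\<close> by (simp add: bad_init_def conf_0 string_cells_def)
    next
      case False
      then obtain i where i: "j = B x + i" by (metis le_add_diff_inverse not_less)
      have "string_cells y q \<le> 2" for q by (simp add: string_cells_def bit_symbol_def)
      moreover have "string_cells y (int (i - (2 * length x + 2))) = 0" if "in_len x \<le> i"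
        using that y by (simp add: string_cells_def in_len_def)
      ultimately show ?thesis
        using \<open>\<kappa> = 1\<close> string_cells_pair[of x y i] b
        by (auto simp: bad_init_def bit_at_def conf_0 z i bit_symbol_def split: if_splits)
    qed
  qed
  have 1: "\<not> bad1 x \<kappa> t j (tableau x z \<kappa> t j)" for \<kappa> t j
  proof
    assume "bad1 x \<kappa> t j (tableau x z \<kappa> t j)"
    then consider "\<kappa> = 0" "tableau x z \<kappa> t j = 0"
      | "\<kappa> = 2 * K + 1" "NV \<le> tableau x z \<kappa> t j \<or> t = 0 \<and> vstate (tableau x z \<kappa> t j) \<noteq> 0"
      | "K < \<kappa>" "\<kappa> \<le> 2 * K" "t = 0" "tableau x z \<kappa> t j \<noteq> B x"
      | "0 < \<kappa>" "\<kappa> \<le> K" "t = 0" "bad_init x \<kappa> j (tableau x z \<kappa> t j)"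
      | "\<kappa> = 1" "t = T x" "j = B x" "tableau x z \<kappa> t j \<noteq> 2"
      unfolding bad1_def by metis
    then show False
    proof cases
      case 1
      then show ?thesis by (simp add: tableau_def)
    next
      case 2
      then show ?thesis using view[of z t] v(1)[of z t] by (auto simp: vws conf_0)
    next
      case 3
      then show ?thesis using heads[of \<kappa> t j] by (simp add: conf_0)
    next
      case 4
      then show ?thesis using init[of \<kappa> j] by (simp add: cells)
    next
      case 5
      then show ?thesis using acc K_pos by (simp add: cells)
    qed
  qed
  have 2: "\<not> bad2 x \<kappa> t j (tableau x z \<kappa> t j) \<kappa>' t' j' (tableau x z \<kappa>' t' j')" for \<kappa> t j \<kappa>' t' j'
  proof
    assume "bad2 x \<kappa> t j (tableau x z \<kappa> t j) \<kappa>' t' j' (tableau x z \<kappa>' t' j')"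
    then consider "\<kappa> = 1" "\<kappa>' = 1" "t = 0" "t' = 0" "j' = Suc j" "B x + 2 * length x + 2 \<le> j"
        "tableau x z \<kappa> t j = 0" "tableau x z \<kappa>' t' j' \<noteq> 0"
      | "\<kappa> = 2 * K + 1" "\<kappa>' = 2 * K + 1" "t' = Suc t" "vstate (tableau x z \<kappa>' t' j') \<noteq> vnext (tableau x z \<kappa> t j)"
      unfolding bad2_def by metis
    then show False
    proof cases
      case 1
      then obtain i where i: "j = B x + (2 * length x + 2 + i)" by (metis add.assoc le_add_diff_inverse)
      have "string_cells y (int i) = 0" "string_cells y (int (Suc i)) \<noteq> 0"
      proof -
        have "int j - int (B x) = int (2 * length x + 2 + i)"
          "int j' - int (B x) = int (2 * length x + 2 + Suc i)" using i 1 by auto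
        moreover have "string_cells z (int j - int (B x)) = 0" "string_cells z (int j' - int (B x)) \<noteq> 0"
          using 1 K_pos by (auto simp: cells conf_0)
        ultimately show "string_cells y (int i) = 0" "string_cells y (int (Suc i)) \<noteq> 0"
          using string_cells_pair[of x y "2 * length x + 2 + i"]
            string_cells_pair[of x y "2 * length x + 2 + Suc i"] by (simp_all add: z(1))
      qed
      then show ?thesis by (auto simp: string_cells_def bit_symbol_def split: if_splits)
    next
      case 2
      then show ?thesis using v(1)[of z t'] v(2)[of z t] by (simp add: vws)
    qed
  qed
  have 3: "\<not> bad3 x \<kappa> t j (tableau x z \<kappa> t j) \<kappa>' t' j' (tableau x z \<kappa>' t' j') \<kappa>'' t'' j'' (tableau x z \<kappa>'' t'' j'')"
    for \<kappa> t j \<kappa>' t' j' \<kappa>'' t'' j''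
  proof
    let ?a = "tableau x z \<kappa> t j" and ?a' = "tableau x z \<kappa>' t' j'" and ?a'' = "tableau x z \<kappa>'' t'' j''"
    assume "bad3 x \<kappa> t j ?a \<kappa>' t' j' ?a' \<kappa>'' t'' j'' ?a''"
    then have t: "t' = t" "t < T x" and
      "\<kappa> = 2 * K + 1 \<and> \<kappa>' = K + \<kappa>'' \<and> 0 < \<kappa>'' \<and> \<kappa>'' \<le> K \<and> t'' = t \<and> ?a' = j'' \<and> ?a'' \<noteq> vread ?a (\<kappa>'' - 1) \<or>
       \<kappa> = 2 * K + 1 \<and> \<kappa>' = \<kappa>'' \<and> K < \<kappa>' \<and> \<kappa>' \<le> 2 * K \<and> t'' = Suc t \<and> Suc ?a'' \<noteq> ?a' + vmove ?a (\<kappa>' - Suc K) \<or>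
       \<kappa> = 2 * K + 1 \<and> \<kappa>' = K + \<kappa>'' \<and> 0 < \<kappa>'' \<and> \<kappa>'' \<le> K \<and> t'' = Suc t \<and> ?a' = j'' \<and> ?a'' \<noteq> vwrite ?a (\<kappa>'' - 1) \<or>
       \<kappa> = K + \<kappa>' \<and> \<kappa>' = \<kappa>'' \<and> 0 < \<kappa>'' \<and> \<kappa>'' \<le> K \<and> t'' = Suc t \<and> j' = j'' \<and> j' \<noteq> ?a \<and> ?a' \<noteq> ?a''"
      (is "?r \<or> ?m \<or> ?w \<or> ?k") unfolding bad3_def by blast+
    then consider ?r | ?m | ?w | ?k by metis
    then show False
    proof cases
      case 1
      then obtain k where k: "\<kappa>'' = Suc k" "k < K" by (cases \<kappa>'') auto
      then have "int j'' - int (B x) = head z t k" using heads[of \<kappa>' t' j'] 1 t by auto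
      then show False using 1 k v(3)[OF k(2), of z t] by (auto simp: vws cells)
    next
      case 2
      then obtain k where k: "\<kappa>' = Suc K + k" "k < K" by (auto dest!: less_imp_Suc_add)
      have "int (Suc ?a'') = int ?a' + int (vmove ?a k)"
      proof -
        have eqs: "\<kappa> = Suc (2 * K)" "\<kappa>'' = Suc K + k" "t'' = Suc t" using 2 k by auto
        have "int ?a' = head z t k + int (B x)" "int ?a'' = head z (Suc t) k + int (B x)"
          using heads[of \<kappa>' t' j'] heads[of \<kappa>'' t'' j''] t k eqs by auto
        then show ?thesis
          using v(5)[OF k(2), of z t] head_Suc[OF k(2), of z t] by (simp add: eqs(1) vws)
      qed
      then have "Suc ?a'' = ?a' + vmove ?a k" by linarith
      then show False using 2 k by auto
    next
      case 3
      then obtain k where k: "\<kappa>'' = Suc k" "k < K" by (cases \<kappa>'') auto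
      then have "int j'' - int (B x) = head z t k" using heads[of \<kappa>' t' j'] 3 t by auto
      then show False using 3 k v(4)[OF k(2), of z t] by (auto simp: vws cells cell_Suc)
    next
      case 4
      then obtain k where k: "\<kappa>'' = Suc k" "k < K" by (cases \<kappa>'') auto
      then have "int j'' - int (B x) \<noteq> head z t k" using heads[of \<kappa> t j] 4 t by auto
      then show False using 4 k t by (auto simp: cells cell_Suc)
    qed
  qed
  show ?thesis unfolding consistent_def by (simp only: less 1 2 3 not_False_eq_True simp_thms)
qed

theorem csp_iff:
  "(\<exists>g. solves (D x * D x * D x) (D x) (bad x) g) \<longleftrightarrow>
    (\<exists>y. length y \<le> poly py (length x) \<and> string_pair x y \<in> R)"
  unfolding solves_iff_consistent using accepted_if_consistent consistent_tableau by blast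

end

section \<open>NP-hardness\<close>

lemma fn_csp_base: "fn n N \<Longrightarrow> fn n D \<Longrightarrow> fn n (\<lambda>x es. csp_base (N x es) (D x es))"
  unfolding csp_base_def by (intro fn_intros)

lemma fn_csp_size: "fn n N \<Longrightarrow> fn n D \<Longrightarrow> fn n (\<lambda>x es. csp_size (N x es) (D x es))"
  unfolding csp_size_def by (intro fn_intros fn_csp_base)

lemma fn_csp_adj:
  assumes "fn n N" "fn n D" "fn n U" "fn n W"
    and "\<And>E1 E2 E3. fn n E1 \<Longrightarrow> fn n E2 \<Longrightarrow> fn n E3 \<Longrightarrow> fn n (\<lambda>x es. of_bool (F x (E1 x es) (E2 x es) (E3 x es)))"
  shows "fn n (\<lambda>x es. of_bool (csp_adj (N x es) (D x es) (F x) (U x es) (W x es)))"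
  unfolding csp_adj_def by (intro fn_intros fn_csp_base fn_csp_size assms)

lemma rec_nat_div_power2: "rec_nat m (\<lambda>i acc. acc div 2) n = m div (2 :: nat) ^ n"
  by (induction n) (simp_all add: div_mult2_eq power_Suc2 del: power_Suc)

text \<open>The power of 2 itself need not be polynomially bounded. Repeated halving avoids it, and
  the intermediate values never exceed \<open>A\<close>.\<close>

lemma fn_div_power2:
  assumes A: "fn n A" and B: "fn n B"
  shows "fn n (\<lambda>x es. A x es div 2 ^ B x es)"
  by (rule fn_rec_bounded[OF B A, of "\<lambda>x es i acc. acc div 2" A])
    (auto simp only: rec_nat_div_power2 div_le_dividend intro: fn_intros fn_poly_bounded[OF A])

lemma length_nat_bits: "i < length (nat_bits m) \<longleftrightarrow> 0 < m div 2 ^ i"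
proof (induction m arbitrary: i rule: nat_bits.induct)
  case (1 m)
  show ?case
  proof (cases "m = 0")
    case True
    then show ?thesis by (simp add: nat_bits.simps)
  next
    case False
    then have eq: "nat_bits m = odd m # nat_bits (m div 2)" by (subst nat_bits.simps) simp
    show ?thesis using 1[OF False] False unfolding eq by (cases i) (simp_all add: div_mult2_eq)
  qed
qed

lemma nth_nat_bits: "i < length (nat_bits m) \<Longrightarrow> nat_bits m ! i = odd (m div 2 ^ i)"
proof (induction m arbitrary: i rule: nat_bits.induct)
  case (1 m)
  show ?case
  proof (cases "m = 0")
    case True
    then show ?thesis using 1 by (simp add: nat_bits.simps)
  next
    case False
    have eq: "nat_bits m = odd m # nat_bits (m div 2)" using False by (subst nat_bits.simps) simp
    show ?thesis using 1(1)[OF False] 1(2) unfolding eq by (cases i) (simp_all add: div_mult2_eq)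
  qed
qed

text \<open>A recursion-free form that fits \<open>outp_concat_map\<close>. The search for digit
  positions may stop at \<open>m\<close>, because \<open>2 ^ i \<le> m\<close> implies
  \<open>i < m\<close>.\<close>

lemma nat_bits_eq_concat:
  "nat_bits m = concat (map (\<lambda>i. [odd (m div 2 ^ i)]) [0..<card {i. i < m \<and> 0 < m div 2 ^ i}])"
proof -
  have "i < m" if "0 < m div 2 ^ i" for i
  proof -
    have "2 ^ i \<le> m" using that by (simp add: div_greater_zero_iff)
    then show ?thesis using less_exp[of i] by (rule less_le_trans[rotated])
  qed
  then have "{i. i < m \<and> 0 < m div 2 ^ i} = {..<length (nat_bits m)}"
    by (auto simp: length_nat_bits)
  then have card: "card {i. i < m \<and> 0 < m div 2 ^ i} = length (nat_bits m)" by simp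
  show ?thesis unfolding card concat_map_singleton
    by (rule nth_equalityI) (simp_all add: nth_nat_bits)
qed

lemma outp_nat_bits:
  assumes A: "fn n A"
  shows "outp n (\<lambda>x es. nat_bits (A x es))"
proof -
  have "odd m \<longleftrightarrow> m mod 2 = 1" for m :: nat by (simp add: odd_iff_mod_2_eq_one)
  then show ?thesis
    unfolding nat_bits_eq_concat
    by (simp only:) (intro outp_concat_map outp_bit fn_intros fn_div_power2 fn_tl[OF A] A)
qed

lemma outp_bits: "outp n (\<lambda>x es. [b])"
  by (intro outp_bit fn_const)

text \<open>Output cannot be read back, so the doubling of bits is demanded from the program that
  writes the first component.\<close>

lemma outp_string_pair:
  assumes "outp n (\<lambda>x es. concat (map (\<lambda>b. [b, b]) (F x es)))" "outp n G"
  shows "outp n (\<lambda>x es. string_pair (F x es) (G x es))"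
proof -
  have "[False, True] @ y = [False] @ ([True] @ y)" for y by simp
  then show ?thesis unfolding string_pair_def by (simp only:) (intro outp_append outp_bits assms)
qed

lemma outp_encode_instance:
  assumes N: "fn n N" and k: "fn n k" and l: "fn n l"
    and E: "fn (Suc (Suc n)) (\<lambda>x es. of_bool ({hd (tl es), hd es} \<in> E x (tl (tl es))))"
  shows "outp n (\<lambda>x es. encode_instance (N x es) (E x es) (k x es) (l x es))"
proof -
  have "concat (map (\<lambda>b. [b, b]) (replicate m True)) = concat (map (\<lambda>i. [True] @ [True]) [0..<m])" for m
    by (simp add: map_replicate_const)
  then have 1: "outp n (\<lambda>x es. concat (map (\<lambda>b. [b, b]) (replicate (N x es) True)))"
    by (simp only:) (intro outp_concat_map outp_append outp_bits N)
  have "concat (map (\<lambda>b. [b, b]) (concat (map f xs))) = concat (map (\<lambda>i. concat (map (\<lambda>b. [b, b]) (f i))) xs)"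
    for f :: "nat \<Rightarrow> bool list" and xs by (induction xs) auto
  then have "concat (map (\<lambda>b. [b, b]) (adjacency_bits m A)) =
      concat (map (\<lambda>i. concat (map (\<lambda>j. [{i, j} \<in> A] @ [{i, j} \<in> A]) [0..<m])) [0..<m])" for m A
    by (simp add: adjacency_bits_def comp_def)
  then have 2: "outp n (\<lambda>x es. concat (map (\<lambda>b. [b, b]) (adjacency_bits (N x es) (E x es))))"
    by (simp only:) (intro outp_concat_map outp_append outp_bit fn_tl[OF N] N E)
  have "concat (map (\<lambda>b. [b, b]) (nat_bits m)) =
      concat (map (\<lambda>i. [odd (m div 2 ^ i)] @ [odd (m div 2 ^ i)]) [0..<card {i. i < m \<and> 0 < m div 2 ^ i}])" for m
    by (subst nat_bits_eq_concat) (simp add: concat_map_singleton comp_def)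
  moreover have "odd m \<longleftrightarrow> m mod 2 = 1" for m :: nat by (simp add: odd_iff_mod_2_eq_one)
  ultimately have 3: "outp n (\<lambda>x es. concat (map (\<lambda>b. [b, b]) (nat_bits (k x es))))"
    by (simp only:) (intro outp_concat_map outp_append outp_bit fn_intros fn_div_power2 fn_tl[OF k] k)
  show ?thesis unfolding encode_instance_def
    by (intro outp_string_pair 1 2 3 outp_nat_bits l)
qed

section \<open>The reduction and its correctness\<close>

context np_verifier
begin

lemma fn_in_len: "fn n (\<lambda>x es. in_len x)"
  unfolding in_len_def by (intro fn_intros fn_poly)

lemma fn_T: "fn n (\<lambda>x es. T x)"
  unfolding T_def by (intro fn_poly fn_in_len)

lemma fn_B: "fn n (\<lambda>x es. B x)"
  unfolding B_def by (intro fn_intros fn_T fn_in_len)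

lemma fn_D: "fn n (\<lambda>x es. D x)"
  unfolding D_def by (intro fn_intros fn_B)

lemma fn_vstate: "fn n A \<Longrightarrow> fn n (\<lambda>x es. vstate (A x es))"
  unfolding vstate_def by (rule fn_table)

lemma fn_vnext: "fn n A \<Longrightarrow> fn n (\<lambda>x es. vnext (A x es))"
  unfolding vnext_def by (rule fn_table)

lemma fn_vread: "fn n A \<Longrightarrow> fn n C \<Longrightarrow> fn n (\<lambda>x es. vread (A x es) (C x es))"
  unfolding vread_def by (rule fn_table2)

lemma fn_vwrite: "fn n A \<Longrightarrow> fn n C \<Longrightarrow> fn n (\<lambda>x es. vwrite (A x es) (C x es))"
  unfolding vwrite_def by (rule fn_table2)

lemma fn_vmove: "fn n A \<Longrightarrow> fn n C \<Longrightarrow> fn n (\<lambda>x es. vmove (A x es) (C x es))"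
  unfolding vmove_def by (rule fn_table2)

lemma fn_bad:
  assumes "fn n E1" "fn n E2" "fn n E3"
  shows "fn n (\<lambda>x es. of_bool (bad x (E1 x es) (E2 x es) (E3 x es)))"
  unfolding bad_def bad1_def bad2_def bad3_def bad_init_def
  by (intro fn_intros fn_in_len fn_T fn_B fn_D fn_vstate fn_vnext fn_vread fn_vwrite fn_vmove assms)

definition reduction :: "bool list \<Rightarrow> bool list" where
  "reduction x = encode_instance (csp_size (D x * D x * D x) (D x))
    (csp_edges (D x * D x * D x) (D x) (bad x)) 1 (D x * D x * D x * D x)"

lemma polytime_reduction: "polytime reduction"
proof -
  have "outp 0 (\<lambda>x es. reduction x)"
    unfolding reduction_def
    by (intro outp_encode_instance fn_csp_size fn_intros fn_D)
      (simp only: in_csp_edges, intro fn_disj fn_csp_adj fn_intros fn_D fn_tl[OF fn_hd] fn_bad)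
  from polytime_outp[OF this] show ?thesis by simp
qed

lemma reduction_correct:
  "reduction x \<in> kRiDF_problem bipartite \<longleftrightarrow>
    (\<exists>y. length y \<le> poly py (length x) \<and> string_pair x y \<in> R)"
proof -
  let ?d = "D x" let ?N = "D x * D x * D x"
  let ?V = "{..<csp_size ?N ?d}" and ?E = "csp_edges ?N ?d (bad x)"
  have N: "0 < ?N" using D_pos by simp
  have "reduction x \<in> kRiDF_problem bipartite \<longleftrightarrow> (\<exists>f. kRiDF 1 ?V ?E f \<and> weight ?V f \<le> ?N * ?d)"
  proof
    assume "reduction x \<in> kRiDF_problem bipartite"
    then obtain n E k l f where *: "reduction x = encode_instance n E k l" "simple_graph {..<n} E"
      "kRiDF k {..<n} E f" "weight {..<n} f \<le> l"
      unfolding kRiDF_problem_def by blast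
    \<comment> \<open>The encoding determines the graph and both numbers, so the instance found in
      the language is the constructed one.\<close>
    from encode_instance_inject[OF *(1)[unfolded reduction_def] simple_graph_csp *(2)] *(3,4)
    show "\<exists>f. kRiDF 1 ?V ?E f \<and> weight ?V f \<le> ?N * ?d" by auto
  next
    assume "\<exists>f. kRiDF 1 ?V ?E f \<and> weight ?V f \<le> ?N * ?d"
    moreover have "1 \<le> ?N * ?d" using N D_pos[of x] by (simp add: Suc_le_eq)
    ultimately show "reduction x \<in> kRiDF_problem bipartite"
      unfolding kRiDF_problem_def reduction_def mem_Collect_eq
      by (intro exI[of _ "csp_size ?N ?d"] exI[of _ ?E] exI[of _ 1] exI[of _ "?N * ?d"] conjI
          simple_graph_csp bipartite_csp) simp_all
  qed
  also have "\<dots> \<longleftrightarrow> (\<exists>g. solves ?N ?d (bad x) g)"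
  proof
    assume "\<exists>f. kRiDF 1 ?V ?E f \<and> weight ?V f \<le> ?N * ?d"
    then obtain f where "kRiDF 1 ?V ?E f" "weight ?V f \<le> ?N * ?d" by blast
    then show "\<exists>g. solves ?N ?d (bad x) g"
      by (rule solves_if_kRiDF_csp[OF _ _ N D_pos[of x]]) blast
  next
    assume "\<exists>g. solves ?N ?d (bad x) g"
    then obtain g where "solves ?N ?d (bad x) g" by blast
    then show "\<exists>f. kRiDF 1 ?V ?E f \<and> weight ?V f \<le> ?N * ?d"
      by (rule kRiDF_csp_if_solves) (use bad_0 N D_pos in blast)+
  qed
  finally show ?thesis unfolding csp_iff .
qed

end

theorem NP_hard_kRiDF_bipartite: "NP_hard (kRiDF_problem bipartite)"
  unfolding NP_hard_def
proof
  fix L assume "L \<in> class_NP"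
  then obtain R and py :: "nat poly" where R: "R \<in> class_P" and
    L: "\<And>x. x \<in> L \<longleftrightarrow> (\<exists>y. length y \<le> poly py (length x) \<and> string_pair x y \<in> R)"
    unfolding class_NP_def by blast
  obtain M and pT :: "nat poly" where "wf_tm M" "tm_computes_in_time M (\<lambda>z. [z \<in> R]) (poly pT)"
    using R unfolding class_P_def polytime_def by blast
  then interpret np_verifier M pT py R by unfold_locales
  show "polytime_reducible L (kRiDF_problem bipartite)"
    unfolding polytime_reducible_def using polytime_reduction reduction_correct L by blast
qed

section \<open>Membership in NP\<close>

text \<open>A vertex of value 0 needs neighbours of \<open>k\<close> different values, but only
  \<open>n - 1\<close> other vertices exist.\<close>

lemma kRiDF_nonzero_if_card_le:
  assumes E: "simple_graph {..<n} E" and f: "kRiDF k {..<n} E f" and k: "n \<le> k" and v: "v < n"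
  shows "f v \<noteq> 0"
proof
  assume "f v = 0"
  have "{1..k} \<subseteq> f ` ({..<n} - {v})"
  proof
    fix i assume "i \<in> {1..k}"
    then obtain u where u: "u < n" "{u, v} \<in> E" "f u = i"
      using f v \<open>f v = 0\<close> unfolding kRiDF_def by blast
    then have "u \<noteq> v" using E unfolding simple_graph_def by fastforce
    then show "i \<in> f ` ({..<n} - {v})" using u by auto
  qed
  then have "card {1..k} \<le> card ({..<n} - {v})"
    by (intro order_trans[OF card_mono card_image_le]) auto
  then show False using v k by simp
qed

text \<open>If \<open>k\<close> exceeds \<open>n\<close>, all vertices are nonzero for the bound
  \<open>n\<close> as well as for \<open>k\<close>. The domination condition is then void and the
  weight is \<open>n\<close>, so only the comparison of \<open>n\<close> with \<open>l\<close>
  matters.\<close>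

lemma kRiDF_cap:
  assumes E: "simple_graph {..<n} E"
  shows "(\<exists>f. kRiDF (min n k) {..<n} E f \<and> weight {..<n} f \<le> min n l) \<longleftrightarrow>
    (\<exists>f. kRiDF k {..<n} E f \<and> weight {..<n} f \<le> l)"
proof -
  have w: "weight {..<n} f \<le> n" for f
    unfolding weight_def by (rule order_trans[OF card_mono[of "{..<n}"]]) auto
  show ?thesis
  proof (cases "k \<le> n")
    case True
    then have "min n k = k" by simp
    moreover have "weight {..<n} f \<le> min n l \<longleftrightarrow> weight {..<n} f \<le> l" for f using w[of f] by simp
    ultimately show ?thesis by simp
  next
    case False
    show ?thesis
    proof
      assume "\<exists>f. kRiDF (min n k) {..<n} E f \<and> weight {..<n} f \<le> min n l"
      then obtain f where f: "kRiDF n {..<n} E f" "weight {..<n} f \<le> l" using False by auto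
      have nz: "f v \<noteq> 0" if "v < n" for v using kRiDF_nonzero_if_card_le[OF E f(1) order_refl that] .
      have range: "f v \<le> n" if "v < n" for v using f(1) that by (auto simp: kRiDF_def)
      have "kRiDF k {..<n} E f"
        unfolding kRiDF_def
      proof (intro conjI ballI impI)
        fix v assume "v \<in> {..<n}"
        then show "f v \<in> {0..k}" using range[of v] False by auto
      next
        fix i assume i: "i \<in> {1..k}"
        show "independent_set E {v \<in> {..<n}. f v = i}"
        proof (cases "i \<le> n")
          case True
          then show ?thesis using f(1) i by (auto simp: kRiDF_def)
        next
          case False
          then have "{v \<in> {..<n}. f v = i} = {}" using range by auto
          then show ?thesis by (simp only:) (simp add: independent_set_def)
        qed
      qed (use nz in auto)
      with f(2) show "\<exists>f. kRiDF k {..<n} E f \<and> weight {..<n} f \<le> l" by blast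
    next
      assume "\<exists>f. kRiDF k {..<n} E f \<and> weight {..<n} f \<le> l"
      then obtain f where f: "kRiDF k {..<n} E f" "weight {..<n} f \<le> l" by blast
      have "f v \<noteq> 0" if "v < n" for v using kRiDF_nonzero_if_card_le[OF E f(1) _ that] False by simp
      then have "{v \<in> {..<n}. f v \<noteq> 0} = {..<n}" by auto
      then have "n \<le> l" using f(2) by (simp add: weight_def)
      \<comment> \<open>Giving all vertices different nonzero values makes every value class a
        single vertex.\<close>
      moreover have "kRiDF n {..<n} E Suc"
      proof -
        have "{u, u} \<notin> E" for u using E unfolding simple_graph_def by fastforce
        then show ?thesis by (auto simp: kRiDF_def independent_set_def)
      qed
      ultimately show "\<exists>f. kRiDF (min n k) {..<n} E f \<and> weight {..<n} f \<le> min n l"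
        using False w[of Suc] by (intro exI[of _ Suc]) auto
    qed
  qed
qed

lemma nat_bits_last: "0 < m \<Longrightarrow> nat_bits m \<noteq> [] \<and> last (nat_bits m)"
proof (induction m rule: nat_bits.induct)
  case (1 m)
  have eq: "nat_bits m = odd m # nat_bits (m div 2)" using 1(2) by (subst nat_bits.simps) simp
  show ?case
  proof (cases "m div 2 = 0")
    case True
    then have "m = 1" using 1(2) by presburger
    then show ?thesis unfolding eq by (simp add: nat_bits.simps[of 0])
  next
    case False
    then show ?thesis using 1 unfolding eq by simp
  qed
qed

text \<open>Together with \<open>nat_bits_last\<close> this describes the binary representations of
  positive numbers by a test on bits.\<close>

lemma nat_bits_surj: "bs \<noteq> [] \<Longrightarrow> last bs \<Longrightarrow> \<exists>m>0. nat_bits m = bs"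
proof (induction bs)
  case (Cons b bs)
  show ?case
  proof (cases "bs = []")
    case True
    then show ?thesis using Cons.prems
      by (intro exI[of _ 1]) (simp add: nat_bits.simps[of "Suc 0"] nat_bits.simps[of 0])
  next
    case False
    then obtain m where m: "0 < m" "nat_bits m = bs" using Cons by auto
    have "nat_bits (2 * m + of_bool b) = b # bs"
      using m by (subst nat_bits.simps) (cases b; simp)
    then show ?thesis using m by (intro exI[of _ "2 * m + of_bool b"]) simp
  qed
qed simp

text \<open>
  Horner's scheme for the number whose binary digits are \<open>X s, X (s + t), X (s + 2 * t), \<dots>\<close>, cut off
  at \<open>c\<close> so that it remains polynomially bounded.
\<close>

definition capped_value :: "nat \<Rightarrow> nat \<Rightarrow> (nat \<Rightarrow> bool) \<Rightarrow> nat \<Rightarrow> nat \<Rightarrow> nat" where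
  "capped_value c p X s t = rec_nat 0 (\<lambda>i acc.
    if c \<le> 2 * acc + of_bool (X (s + t * (p - Suc i))) then c
    else 2 * acc + of_bool (X (s + t * (p - Suc i)))) p"

text \<open>Cutting off after every step gives the same as cutting off once at the end, since a
  partial value that has reached \<open>c\<close> never falls below it. After \<open>r\<close> steps
  the \<open>r\<close> leading digits have been used.\<close>

lemma capped_value_nat_bits:
  assumes p: "p = length (nat_bits m)" and X: "\<And>i. i < p \<Longrightarrow> X (s + t * i) = nat_bits m ! i"
  shows "capped_value c p X s t = min c m"
proof -
  have "rec_nat 0 (\<lambda>i acc. if c \<le> 2 * acc + of_bool (X (s + t * (p - Suc i))) then c
      else 2 * acc + of_bool (X (s + t * (p - Suc i)))) r = min c (m div 2 ^ (p - r))" if "r \<le> p" for r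
    using that
  proof (induction r)
    case 0
    have "m div 2 ^ p = 0" using length_nat_bits[of p m] p by simp
    then show ?case by simp
  next
    case (Suc r)
    define i where "i = p - Suc r"
    have i: "i < p" "p - r = Suc i" using Suc.prems by (auto simp: i_def)
    have "m div 2 ^ i = 2 * (m div 2 ^ Suc i) + of_bool (X (s + t * i))"
    proof -
      have "a = 2 * (a div 2) + of_bool (odd a)" for a :: nat by (cases "odd a") simp_all
      from this[of "m div 2 ^ i"] show ?thesis
        using X[OF i(1)] nth_nat_bits[of i m] i p
        by (simp add: power_Suc2 div_mult2_eq del: power_Suc)
    qed
    with Suc show ?case unfolding i_def[symmetric] i(2) by (auto simp: i_def[symmetric] i(2) min_def)
  qed
  from this[of p] show ?thesis by (simp add: capped_value_def)
qed

lemma fn_capped_value: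
  assumes "fn n C" "fn n P" "fn n S"
    and X: "\<And>m A. fn m A \<Longrightarrow> fn m (\<lambda>x es. of_bool (X x (A x es)))"
  shows "fn n (\<lambda>x es. capped_value (C x es) (P x es) (X x) (S x es) t)"
proof -
  let ?B = "\<lambda>x es i acc. if C x es \<le> 2 * acc + of_bool (X x (S x es + t * (P x es - Suc i))) then C x es
    else 2 * acc + of_bool (X x (S x es + t * (P x es - Suc i)))"
  have le: "rec_nat 0 (?B x es) i \<le> C x es" for x es i
    by (cases i) auto
  show ?thesis
  proof (rule fn_rec_bounded[OF assms(2) fn_0, of ?B C])
    show "fn (Suc (Suc n)) (\<lambda>x es. ?B x (tl (tl es)) (hd (tl es)) (hd es))"
      by (intro fn_intros X fn_tl[OF fn_hd] fn_tl[OF fn_tl[OF assms(1)]] fn_tl[OF fn_tl[OF assms(2)]]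
          fn_tl[OF fn_tl[OF assms(3)]])
  qed (simp_all only: le fn_poly_bounded[OF assms(1)] capped_value_def)
qed

section \<open>Recognition of encoded instances\<close>

definition paired :: "(nat \<Rightarrow> bool) \<Rightarrow> nat \<Rightarrow> nat \<Rightarrow> bool" where
  "paired X s m \<longleftrightarrow> (\<forall>i<m. X (s + 2 * i) \<longleftrightarrow> X (s + 2 * i + 1)) \<and> \<not> X (s + 2 * m) \<and> X (s + 2 * m + 1)"

lemma paired_Suc: "paired X s (Suc m) \<longleftrightarrow> (X s \<longleftrightarrow> X (s + 1)) \<and> paired X (s + 2) m"
  unfolding paired_def by (simp add: All_less_Suc2)

lemma drop_eq_string_pair:
  assumes "paired (bit_at w) s m" "s + 2 * m + 2 \<le> length w"
  shows "drop s w = string_pair (map (\<lambda>i. bit_at w (s + 2 * i)) [0..<m]) (drop (s + 2 * m + 2) w)"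
  using assms
proof (induction m arbitrary: s)
  case 0
  have "drop s w = w ! s # w ! (s + 1) # drop (s + 2) w"
    using 0 Cons_nth_drop_Suc[of s w] Cons_nth_drop_Suc[of "Suc s" w] by simp
  then show ?case using 0 by (simp add: string_pair_def paired_def bit_at_def)
next
  case (Suc m)
  have *: "drop s w = w ! s # w ! (s + 1) # drop (s + 2) w"
    using Suc.prems Cons_nth_drop_Suc[of s w] Cons_nth_drop_Suc[of "Suc s" w] by simp
  have "bit_at w s = w ! s" "w ! (s + 1) = w ! s"
    using Suc.prems by (auto simp: paired_Suc bit_at_def)
  moreover have "drop (s + 2) w = string_pair (map (\<lambda>i. bit_at w (s + 2 + 2 * i)) [0..<m]) (drop (s + 2 + 2 * m + 2) w)"
    using Suc.IH[of "s + 2"] Suc.prems by (simp add: paired_Suc)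
  moreover have "map (\<lambda>i. bit_at w (s + 2 * i)) [0..<Suc m]
      = bit_at w s # map (\<lambda>i. bit_at w (s + 2 + 2 * i)) [0..<m]"
    by (rule nth_equalityI) (auto simp: nth_Cons simp del: upt_Suc split: nat.splits)
  ultimately show ?case using * by (simp add: string_pair_def del: upt_Suc)
qed

lemma bit_at_drop: "bit_at (drop s w) i \<longleftrightarrow> bit_at w (s + i)"
  by (auto simp: bit_at_def)

lemma bit_at_string_pair:
  "bit_at (string_pair u v) i \<longleftrightarrow>
    (if i < 2 * length u then u ! (i div 2) else i = 2 * length u + 1 \<or> 2 * length u + 2 \<le> i \<and> bit_at v (i - (2 * length u + 2)))"
proof -
  have bit: "bit_at w j \<longleftrightarrow> string_cells w (int j) = 2" for w j
    by (auto simp: bit_at_def string_cells_def bit_symbol_def)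
  show ?thesis unfolding bit string_cells_pair by (auto simp: bit_symbol_def)
qed

lemma paired_string_pair:
  assumes "drop s w = string_pair u v" "s \<le> length w"
  shows "paired (bit_at w) s (length u)" "\<And>i. i < length u \<Longrightarrow> bit_at w (s + 2 * i) = u ! i"
    "drop (s + 2 * length u + 2) w = v" "length w = s + 2 * length u + 2 + length v"
proof -
  have bit: "bit_at w (s + i) = bit_at (string_pair u v) i" for i
    using assms(1) bit_at_drop[of s w i] by simp
  show "\<And>i. i < length u \<Longrightarrow> bit_at w (s + 2 * i) = u ! i" unfolding bit by (simp add: bit_at_string_pair)
  show "paired (bit_at w) s (length u)"
    unfolding paired_def add.assoc bit by (simp add: bit_at_string_pair)
  have "drop (2 * length u + 2) (drop s w) = v"
    unfolding assms(1) by (induction u) (auto simp: string_pair_def)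
  then show "drop (s + 2 * length u + 2) w = v" by (simp add: add_ac)
  have "length (drop s w) = 2 * length u + 2 + length v"
    unfolding assms(1) by (induction u) (auto simp: string_pair_def)
  then show "length w = s + 2 * length u + 2 + length v" using assms(2) by simp
qed

lemma concat_map_upt:
  "concat (map (\<lambda>i. map (f i) [0..<n]) [0..<m]) = map (\<lambda>r. f (r div n) (r mod n)) [0..<m * n]"
proof (induction m)
  case (Suc m)
  have "[0..<Suc m * n] = [0..<m * n] @ map (\<lambda>j. j + m * n) [0..<n]"
    unfolding map_add_upt using upt_add_eq_append[of 0 "m * n" n] by (simp add: add.commute)
  then have "map (\<lambda>r. f (r div n) (r mod n)) [0..<Suc m * n] =
      map (\<lambda>r. f (r div n) (r mod n)) [0..<m * n] @ map (\<lambda>j. f ((j + m * n) div n) ((j + m * n) mod n)) [0..<n]"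
    by (simp only: map_append map_map comp_def)
  also have "map (\<lambda>j. f ((j + m * n) div n) ((j + m * n) mod n)) [0..<n] = map (f m) [0..<n]"
    by (rule map_cong) auto
  finally show ?case using Suc by simp
qed simp

lemma adjacency_bits_eq: "adjacency_bits n E = map (\<lambda>r. {r div n, r mod n} \<in> E) [0..<n * n]"
  unfolding adjacency_bits_def concat_map_upt ..

text \<open>The offsets here and in the next definitions arise because every component but the last
  is doubled and followed by a separator of two bits.\<close>

definition adj_bit :: "(nat \<Rightarrow> bool) \<Rightarrow> nat \<Rightarrow> nat \<Rightarrow> nat \<Rightarrow> bool" where
  "adj_bit X n i j \<longleftrightarrow> X (2 * n + 2 + 2 * (i * n + j))"

definition k_start :: "nat \<Rightarrow> nat" where
  "k_start n = 2 * n + 2 + 2 * (n * n) + 2"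

definition l_start :: "nat \<Rightarrow> nat \<Rightarrow> nat" where
  "l_start n p = k_start n + 2 * p + 2"

text \<open>The lengths of the components are parameters, to be found by exhaustive search instead
  of by parsing. Requiring the most significant digit of both numbers to be 1 excludes leading zeros
  and the number 0.\<close>

definition encoding_ok :: "nat \<Rightarrow> (nat \<Rightarrow> bool) \<Rightarrow> nat \<Rightarrow> nat \<Rightarrow> nat \<Rightarrow> bool" where
  "encoding_ok L X n p q \<longleftrightarrow> L = l_start n p + q \<and>
    (\<forall>i<n. X (2 * i)) \<and> paired X 0 n \<and> paired X (2 * n + 2) (n * n) \<and> paired X (k_start n) p \<and>
    0 < p \<and> X (k_start n + 2 * (p - 1)) \<and> 0 < q \<and> X (l_start n p + (q - 1)) \<and>
    (\<forall>i<n. \<forall>j<n. (adj_bit X n i j \<longleftrightarrow> adj_bit X n j i) \<and> \<not> adj_bit X n i i)"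

lemma adjacency_index: "i < n \<Longrightarrow> j < n \<Longrightarrow> i * n + j < n * (n::nat)"
proof -
  assume "i < n" "j < n"
  then have "i * n + j < Suc i * n" by simp
  also have "\<dots> \<le> n * n" using \<open>i < n\<close> by (intro mult_right_mono) auto
  finally show ?thesis .
qed

lemma encode_instance_bits:
  fixes k l :: nat
  assumes x: "x = encode_instance n E k l" and E: "simple_graph {..<n} E" and k: "1 \<le> k" and l: "1 \<le> l"
  defines "p \<equiv> length (nat_bits k)" and "q \<equiv> length (nat_bits l)"
  shows "encoding_ok (length x) (bit_at x) n p q"
    "\<And>i j. i < n \<Longrightarrow> j < n \<Longrightarrow> adj_bit (bit_at x) n i j \<longleftrightarrow> {i, j} \<in> E"
    "capped_value c p (bit_at x) (k_start n) 2 = min c k"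
    "capped_value c q (bit_at x) (l_start n p) 1 = min c l"
proof -
  define r2 where "r2 = string_pair (nat_bits k) (nat_bits l)"
  define r1 where "r1 = string_pair (adjacency_bits n E) r2"
  have len: "length (adjacency_bits n E) = n * n" by (simp add: adjacency_bits_eq)
  have "drop 0 x = string_pair (replicate n True) r1"
    by (simp add: x encode_instance_def r1_def r2_def)
  note s1 = paired_string_pair[OF this, simplified]
  have "drop (2 * n + 2) x = string_pair (adjacency_bits n E) r2" using s1(3) by (simp add: r1_def)
  note s2 = paired_string_pair[OF this, unfolded len]
  have le: "2 * n + 2 \<le> length x" using s1(4) by simp
  have "drop (k_start n) x = string_pair (nat_bits k) (nat_bits l)"
    using s2(3)[OF le] by (simp add: k_start_def r2_def)
  note s3 = paired_string_pair[OF this, folded p_def]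
  have le': "k_start n \<le> length x" using s2(4)[OF le] by (simp add: k_start_def)
  have l_bits: "bit_at x (l_start n p + i) = bit_at (nat_bits l) i" for i
    using s3(3)[OF le'] bit_at_drop[of "l_start n p" x i] by (simp add: l_start_def)
  have L: "length x = l_start n p + q" using s3(4)[OF le'] by (simp add: l_start_def q_def)
  show adj: "adj_bit (bit_at x) n i j \<longleftrightarrow> {i, j} \<in> E" if "i < n" "j < n" for i j
    using s2(2)[OF le adjacency_index[OF that]] that adjacency_index[OF that]
    by (simp add: adj_bit_def adjacency_bits_eq)
  have kl: "nat_bits k \<noteq> []" "last (nat_bits k)" "nat_bits l \<noteq> []" "last (nat_bits l)"
    using nat_bits_last k l by auto
  then have pq: "0 < p" "0 < q" by (auto simp: p_def q_def)
  have "bit_at x (k_start n + 2 * (p - 1))"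
    using s3(2)[OF le', of "p - 1"] pq kl by (simp add: p_def last_conv_nth)
  moreover have "bit_at x (l_start n p + (q - 1))"
    using l_bits[of "q - 1"] pq kl by (simp add: q_def last_conv_nth bit_at_def)
  moreover have "{i, i} \<notin> E" for i using E unfolding simple_graph_def by fastforce
  moreover have "\<forall>i<n. bit_at x (2 * i)" using s1(2) by auto
  ultimately show "encoding_ok (length x) (bit_at x) n p q"
    unfolding encoding_ok_def using L s1(1) s2(1)[OF le] s3(1)[OF le'] pq adj
    by (simp add: insert_commute)
  show "capped_value c p (bit_at x) (k_start n) 2 = min c k"
    by (rule capped_value_nat_bits) (use s3(2)[OF le'] in \<open>auto simp: p_def\<close>)
  show "capped_value c q (bit_at x) (l_start n p) 1 = min c l"
    by (rule capped_value_nat_bits) (simp_all add: l_bits q_def, simp add: bit_at_def)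
qed

lemma encode_instance_if_encoding_ok:
  assumes "encoding_ok (length x) (bit_at x) n p q"
  obtains E k l where "x = encode_instance n E k l" "simple_graph {..<n} E" "1 \<le> k" "1 \<le> l"
    "p = length (nat_bits k)" "q = length (nat_bits l)"
proof -
  let ?X = "bit_at x"
  note ok = assms[unfolded encoding_ok_def]
  define E where "E = {{i, j} | i j. i < n \<and> j < n \<and> adj_bit ?X n i j}"
  have E: "{i, j} \<in> E \<longleftrightarrow> adj_bit ?X n i j" if "i < n" "j < n" for i j
    using ok that unfolding E_def by (auto simp: doubleton_eq_iff)
  have simple: "simple_graph {..<n} E"
    unfolding simple_graph_def
  proof (intro conjI ballI)
    fix e assume "e \<in> E"
    then obtain i j where e: "e = {i, j}" "i < n" "j < n" "adj_bit ?X n i j" by (auto simp: E_def)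
    then have "i \<noteq> j" using ok by auto
    then show "e \<subseteq> {..<n}" "card e = 2" using e by auto
  qed simp
  let ?u = "map (\<lambda>i. ?X (k_start n + 2 * i)) [0..<p]" and ?v = "map (\<lambda>i. ?X (l_start n p + i)) [0..<q]"
  have "?u \<noteq> []" "last ?u" "?v \<noteq> []" "last ?v" using ok by (auto simp: last_map)
  then obtain k l where kl: "0 < k" "nat_bits k = ?u" "0 < l" "nat_bits l = ?v"
    using nat_bits_surj by metis
  have "drop (l_start n p) x = ?v"
    using ok by (intro nth_equalityI) (auto simp: bit_at_def)
  then have "drop (k_start n) x = string_pair (nat_bits k) (nat_bits l)"
    using drop_eq_string_pair[of x "k_start n" p] ok kl by (simp add: l_start_def)
  moreover have "map (\<lambda>i. ?X (2 * n + 2 + 2 * i)) [0..<n * n] = adjacency_bits n E"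
  proof -
    have "?X (2 * n + 2 + 2 * i) \<longleftrightarrow> {i div n, i mod n} \<in> E" if "i < n * n" for i
    proof -
      have "i div n < n" "i mod n < n" using that by (auto simp: less_mult_imp_div_less) (cases n; simp)
      then show ?thesis using E[of "i div n" "i mod n"] unfolding adj_bit_def by (simp only: div_mult_mod_eq)
    qed
    then show ?thesis unfolding adjacency_bits_eq by auto
  qed
  ultimately have "drop (2 * n + 2) x =
      string_pair (adjacency_bits n E) (string_pair (nat_bits k) (nat_bits l))"
    using drop_eq_string_pair[of x "2 * n + 2" "n * n"] ok by (simp add: l_start_def k_start_def)
  moreover have "map (\<lambda>i. ?X (0 + 2 * i)) [0..<n] = replicate n True"
    using ok by (intro nth_equalityI) auto
  ultimately have "x = encode_instance n E k l"
    using drop_eq_string_pair[of x 0 n] ok by (simp add: l_start_def k_start_def encode_instance_def)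
  then show ?thesis using simple kl by (intro that[of E k l]) auto
qed

section \<open>Certificates and their test\<close>

definition colour :: "(nat \<Rightarrow> bool) \<Rightarrow> nat \<Rightarrow> nat \<Rightarrow> nat \<Rightarrow> nat" where
  "colour Y n k v = card {i. i < k \<and> Y (n + v * n + i)}"

text \<open>The first \<open>n\<close> bits of \<open>Y\<close> tell the sides of a bipartition; the
  rest consists of one block of \<open>n\<close> bits for each vertex. Since \<open>colour\<close>
  counts ones, any bits give values up to \<open>k\<close> and no format has to be checked.\<close>

definition certificate_ok :: "(nat \<Rightarrow> bool) \<Rightarrow> (nat \<Rightarrow> bool) \<Rightarrow> nat \<Rightarrow> nat \<Rightarrow> nat \<Rightarrow> bool" where
  "certificate_ok X Y n k l \<longleftrightarrow>
    (\<forall>i<n. \<forall>j<n. adj_bit X n i j \<longrightarrow> \<not> (Y i \<longleftrightarrow> Y j)) \<and>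
    (\<forall>u<n. \<forall>v<n. adj_bit X n u v \<and> colour Y n k u = colour Y n k v \<longrightarrow> colour Y n k u = 0) \<and>
    (\<forall>v<n. colour Y n k v = 0 \<longrightarrow> (\<forall>i<k. \<exists>u<n. adj_bit X n u v \<and> colour Y n k u = Suc i)) \<and>
    card {v. v < n \<and> colour Y n k v \<noteq> 0} \<le> l"

lemma kRiDF_if_certificate_ok:
  assumes E: "simple_graph {..<n} E" and adj: "\<And>i j. i < n \<Longrightarrow> j < n \<Longrightarrow> adj_bit X n i j \<longleftrightarrow> {i, j} \<in> E"
    and ok: "certificate_ok X Y n k l"
  shows "bipartite {..<n} E" "\<exists>f. kRiDF k {..<n} E f \<and> weight {..<n} f \<le> l"
proof -
  note ok = ok[unfolded certificate_ok_def]
  let ?f = "colour Y n k"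
  have "independent_set E {i. i < n \<and> Y i}" "independent_set E {i. i < n \<and> \<not> Y i}"
    using ok adj unfolding independent_set_def by blast+
  moreover have "{i. i < n \<and> Y i} \<union> {i. i < n \<and> \<not> Y i} = {..<n}" "{i. i < n \<and> Y i} \<inter> {i. i < n \<and> \<not> Y i} = {}"
    by auto
  ultimately show "bipartite {..<n} E" unfolding bipartite_def by blast
  have le: "?f v \<le> k" for v
    unfolding colour_def using card_mono[of "{..<k}" "{i. i < k \<and> Y (n + v * n + i)}"] by auto
  have ind: "independent_set E {v \<in> {..<n}. ?f v = i}" if "i \<in> {1..k}" for i
    unfolding independent_set_def
  proof (intro ballI)
    fix u v assume "u \<in> {v \<in> {..<n}. ?f v = i}" "v \<in> {v \<in> {..<n}. ?f v = i}"
    then show "{u, v} \<notin> E" using ok[THEN conjunct2, THEN conjunct1, rule_format, of u v] adj[of u v] that by auto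
  qed
  have dom: "\<exists>u\<in>{..<n}. {u, v} \<in> E \<and> ?f u = i" if i: "i \<in> {1..k}" and v: "v < n" "?f v = 0" for i v
  proof -
    obtain i' where "i = Suc i'" "i' < k" using \<open>i \<in> {1..k}\<close> by (cases i) auto
    then obtain u where "u < n" "adj_bit X n u v" "?f u = i"
      using ok[THEN conjunct2, THEN conjunct2, THEN conjunct1, rule_format, OF v, of i'] by auto
    then show ?thesis using adj[of u v] v by auto
  qed
  have "kRiDF k {..<n} E ?f"
    unfolding kRiDF_def using le by (intro conjI ballI impI ind dom) (simp_all only: atLeastAtMost_iff lessThan_iff le0)
  moreover have "{v \<in> {..<n}. ?f v \<noteq> 0} = {v. v < n \<and> ?f v \<noteq> 0}" by auto
  then have "weight {..<n} ?f \<le> l" using ok by (simp add: weight_def)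
  ultimately show "\<exists>f. kRiDF k {..<n} E f \<and> weight {..<n} f \<le> l" by blast
qed

lemma certificate_ok_ex:
  assumes adj: "\<And>i j. i < n \<Longrightarrow> j < n \<Longrightarrow> adj_bit X n i j \<longleftrightarrow> {i, j} \<in> E"
    and bip: "bipartite {..<n} E" and k: "k \<le> n"
    and f: "kRiDF k {..<n} E f" "weight {..<n} f \<le> l"
  shows "\<exists>y. length y = n + n * n \<and> certificate_ok X (bit_at y) n k l"
proof -
  obtain A B where AB: "A \<union> B = {..<n}" "A \<inter> B = {}" "independent_set E A" "independent_set E B"
    using bip unfolding bipartite_def by blast
  \<comment> \<open>Block \<open>v\<close> has \<open>f v\<close> ones followed by zeros; by
    \<open>k \<le> n\<close> the count for \<open>v\<close> stays inside this block.\<close>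
  define y where "y = map (\<lambda>r. if r < n then r \<in> A else (r - n) mod n < f ((r - n) div n)) [0..<n + n * n]"
  have yA: "bit_at y i \<longleftrightarrow> i \<in> A" if "i < n" for i
    using that by (simp add: y_def bit_at_def)
  have f_le: "f v \<le> k" if "v < n" for v using f(1) that by (auto simp: kRiDF_def)
  have col: "colour (bit_at y) n k v = f v" if "v < n" for v
  proof -
    have "bit_at y (n + v * n + i) \<longleftrightarrow> i < f v" if "i < k" for i
    proof -
      have "i < n" using that k by simp
      then have "v * n + i < n * n" using adjacency_index \<open>v < n\<close> by simp
      then show ?thesis using \<open>i < n\<close> by (simp add: y_def bit_at_def add.assoc)
    qed
    then have "{i. i < k \<and> bit_at y (n + v * n + i)} = {..<f v}" using f_le[OF \<open>v < n\<close>] by auto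
    then show ?thesis by (simp add: colour_def)
  qed
  have "certificate_ok X (bit_at y) n k l"
    unfolding certificate_ok_def
  proof (intro conjI allI impI)
    fix i j assume "i < n" "j < n" "adj_bit X n i j"
    moreover have "i \<in> A \<union> B" "j \<in> A \<union> B" using AB(1) \<open>i < n\<close> \<open>j < n\<close> by auto
    ultimately show "\<not> (bit_at y i \<longleftrightarrow> bit_at y j)"
      using AB(3,4) adj yA unfolding independent_set_def by blast
  next
    fix u v assume uv: "u < n" "v < n" "adj_bit X n u v \<and> colour (bit_at y) n k u = colour (bit_at y) n k v"
    show "colour (bit_at y) n k u = 0"
    proof (rule ccontr)
      assume "\<not> ?thesis"
      then have "f u \<in> {1..k}" "f v = f u" "{u, v} \<in> E" using uv col adj f_le[of u] by auto
      then show False using f(1) uv unfolding kRiDF_def independent_set_def by blast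
    qed
  next
    fix v i assume v: "v < n" "colour (bit_at y) n k v = 0" and i: "i < k"
    then have "f v = 0" "Suc i \<in> {1..k}" using col by auto
    then obtain u where "u < n" "{u, v} \<in> E" "f u = Suc i" using f(1) v(1) unfolding kRiDF_def by blast
    then show "\<exists>u<n. adj_bit X n u v \<and> colour (bit_at y) n k u = Suc i" using adj col v by auto
  next
    have "{v. v < n \<and> colour (bit_at y) n k v \<noteq> 0} = {v \<in> {..<n}. f v \<noteq> 0}" using col by auto
    then show "card {v. v < n \<and> colour (bit_at y) n k v \<noteq> 0} \<le> l" using f(2) by (simp add: weight_def)
  qed
  then show ?thesis by (intro exI[of _ y]) (simp add: y_def)
qed

text \<open>The separator 01 is the first pair of different bits, so the leading pairs of equal bits
  are counted.\<close>

definition fst_length :: "bool list \<Rightarrow> nat" where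
  "fst_length z = card {i. i < length z \<and> (\<forall>j<Suc i. bit_at z (2 * j) \<longleftrightarrow> bit_at z (2 * j + 1))}"

definition fst_bit :: "bool list \<Rightarrow> nat \<Rightarrow> bool" where
  "fst_bit z i \<longleftrightarrow> i < fst_length z \<and> bit_at z (2 * i)"

definition snd_bit :: "bool list \<Rightarrow> nat \<Rightarrow> bool" where
  "snd_bit z i \<longleftrightarrow> bit_at z (2 * fst_length z + 2 + i)"

lemma fst_length: "fst_length (string_pair x y) = length x"
proof -
  let ?z = "string_pair x y"
  have "{i. i < length ?z \<and> (\<forall>j<Suc i. bit_at ?z (2 * j) \<longleftrightarrow> bit_at ?z (2 * j + 1))} = {..<length x}"
  proof (intro set_eqI iffI)
    fix i assume "i \<in> {i. i < length ?z \<and> (\<forall>j<Suc i. bit_at ?z (2 * j) \<longleftrightarrow> bit_at ?z (2 * j + 1))}"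
    moreover have "\<not> (bit_at ?z (2 * length x) \<longleftrightarrow> bit_at ?z (2 * length x + 1))"
      by (simp add: bit_at_string_pair)
    ultimately show "i \<in> {..<length x}" by (metis (mono_tags, lifting) lessThan_iff mem_Collect_eq not_less_eq)
  next
    fix i assume "i \<in> {..<length x}"
    then show "i \<in> {i. i < length ?z \<and> (\<forall>j<Suc i. bit_at ?z (2 * j) \<longleftrightarrow> bit_at ?z (2 * j + 1))}"
      by (auto simp: bit_at_string_pair length_string_pair)
  qed
  then show ?thesis by (simp add: fst_length_def)
qed

lemma fst_bit: "fst_bit (string_pair x y) = bit_at x"
  unfolding fun_eq_iff fst_bit_def fst_length bit_at_string_pair by (auto simp: bit_at_def)

lemma snd_bit: "snd_bit (string_pair x y) = bit_at y"
  by (auto simp: snd_bit_def fst_length bit_at_string_pair fun_eq_iff)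

text \<open>None of the three lengths exceeds that of the instance, so trying all of them takes
  polynomial time.\<close>

definition verifies :: "bool list \<Rightarrow> bool" where
  "verifies z \<longleftrightarrow> (\<exists>n<Suc (fst_length z). \<exists>p<Suc (fst_length z). \<exists>q<Suc (fst_length z).
    encoding_ok (fst_length z) (fst_bit z) n p q \<and>
    certificate_ok (fst_bit z) (snd_bit z) n (capped_value n p (fst_bit z) (k_start n) 2)
      (capped_value n q (fst_bit z) (l_start n p) 1))"

text \<open>A certificate has \<open>n + n * n\<close> bits, and \<open>n\<close> is at most the
  length of \<open>x\<close> because \<open>n\<close> is encoded in unary; this gives the
  polynomial. Capping both numbers at \<open>n\<close> is justified by
  \<open>kRiDF_cap\<close>.\<close>

lemma verifies_iff:
  "x \<in> kRiDF_problem bipartite \<longleftrightarrow>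
    (\<exists>y. length y \<le> poly [:0, 1, 1:] (length x) \<and> verifies (string_pair x y))"
proof
  assume "x \<in> kRiDF_problem bipartite"
  then obtain n E k l f where x: "x = encode_instance n E k l" "simple_graph {..<n} E" "1 \<le> k" "1 \<le> l"
    and bip: "bipartite {..<n} E" and f: "kRiDF k {..<n} E f" "weight {..<n} f \<le> l"
    unfolding kRiDF_problem_def by blast
  note bits = encode_instance_bits[OF x]
  obtain f' where f': "kRiDF (min n k) {..<n} E f'" "weight {..<n} f' \<le> min n l"
    using kRiDF_cap[OF x(2), of k l] f by blast
  obtain y where y: "length y = n + n * n" "certificate_ok (bit_at x) (bit_at y) n (min n k) (min n l)"
    using certificate_ok_ex[OF bits(2) bip _ f'] by auto
  let ?p = "length (nat_bits k)" and ?q = "length (nat_bits l)"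
  have len: "length x = l_start n ?p + ?q" using bits(1) by (simp add: encoding_ok_def)
  then have "n < Suc (length x)" "?p < Suc (length x)" "?q < Suc (length x)"
    by (auto simp: l_start_def k_start_def)
  then have "verifies (string_pair x y)"
    unfolding verifies_def fst_length fst_bit snd_bit
    using bits(1) y(2) unfolding bits(3,4)[symmetric] by blast
  moreover have "n \<le> length x" using len by (simp add: l_start_def k_start_def)
  then have "length y \<le> poly [:0, 1, 1:] (length x)"
    using y(1) mult_mono[of n "length x" n "length x"] by simp
  ultimately show "\<exists>y. length y \<le> poly [:0, 1, 1:] (length x) \<and> verifies (string_pair x y)" by blast
next
  assume "\<exists>y. length y \<le> poly [:0, 1, 1:] (length x) \<and> verifies (string_pair x y)"
  then obtain y n p q where ok: "encoding_ok (length x) (bit_at x) n p q"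
    "certificate_ok (bit_at x) (bit_at y) n (capped_value n p (bit_at x) (k_start n) 2)
      (capped_value n q (bit_at x) (l_start n p) 1)"
    unfolding verifies_def fst_length fst_bit snd_bit by blast
  obtain E k l where x: "x = encode_instance n E k l" "simple_graph {..<n} E" "1 \<le> k" "1 \<le> l"
    and pq: "p = length (nat_bits k)" "q = length (nat_bits l)"
    using encode_instance_if_encoding_ok[OF ok(1)] by blast
  note bits = encode_instance_bits[OF x, folded pq]
  have "certificate_ok (bit_at x) (bit_at y) n (min n k) (min n l)" using ok(2) unfolding bits(3,4) .
  note kRiDF_if_certificate_ok[OF x(2) bits(2) this]
  then show "x \<in> kRiDF_problem bipartite"
    unfolding kRiDF_problem_def mem_Collect_eq kRiDF_cap[OF x(2)] using x by blast
qed

section \<open>The verifier runs in polynomial time\<close>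

lemma fn_fst_length: "fn n (\<lambda>x es. fst_length x)"
  unfolding fst_length_def by (intro fn_intros fn_All fn_tl[OF fn_hd])

lemma fn_fst_bit: "fn n A \<Longrightarrow> fn n (\<lambda>x es. of_bool (fst_bit x (A x es)))"
  unfolding fst_bit_def by (intro fn_intros fn_fst_length)

lemma fn_snd_bit: "fn n A \<Longrightarrow> fn n (\<lambda>x es. of_bool (snd_bit x (A x es)))"
  unfolding snd_bit_def by (intro fn_intros fn_fst_length)

lemma fn_adj_bit:
  "fn n N \<Longrightarrow> fn n I \<Longrightarrow> fn n J \<Longrightarrow> fn n (\<lambda>x es. of_bool (adj_bit (fst_bit x) (N x es) (I x es) (J x es)))"
  unfolding adj_bit_def by (intro fn_intros fn_fst_bit)

lemma fn_k_start: "fn n N \<Longrightarrow> fn n (\<lambda>x es. k_start (N x es))"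
  unfolding k_start_def by (intro fn_intros)

lemma fn_l_start: "fn n N \<Longrightarrow> fn n P \<Longrightarrow> fn n (\<lambda>x es. l_start (N x es) (P x es))"
  unfolding l_start_def by (intro fn_intros fn_k_start)

lemma fn_paired:
  assumes "fn n A" "fn n B"
  shows "fn n (\<lambda>x es. of_bool (paired (fst_bit x) (A x es) (B x es)))"
  unfolding paired_def by (intro fn_intros fn_All fn_fst_bit assms assms[THEN fn_tl])

lemma fn_colour:
  assumes "fn n A" "fn n B" "fn n C"
  shows "fn n (\<lambda>x es. colour (snd_bit x) (A x es) (B x es) (C x es))"
  unfolding colour_def by (intro fn_intros fn_snd_bit assms assms[THEN fn_tl])

lemma fn_encoding_ok:
  assumes "fn n N" "fn n P" "fn n Q"
  shows "fn n (\<lambda>x es. of_bool (encoding_ok (fst_length x) (fst_bit x) (N x es) (P x es) (Q x es)))"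
  unfolding encoding_ok_def
  by (intro fn_intros fn_All fn_fst_length fn_fst_bit fn_paired fn_adj_bit fn_k_start fn_l_start fn_tl[OF fn_hd]
      assms assms[THEN fn_tl] assms[THEN fn_tl, THEN fn_tl])

lemma fn_certificate_ok:
  assumes "fn n N" "fn n K" "fn n L"
  shows "fn n (\<lambda>x es. of_bool (certificate_ok (fst_bit x) (snd_bit x) (N x es) (K x es) (L x es)))"
  unfolding certificate_ok_def
  by (intro fn_intros fn_Ex fn_All fn_snd_bit fn_adj_bit fn_colour fn_tl[OF fn_hd] fn_tl[OF fn_tl[OF fn_hd]]
      assms assms[THEN fn_tl] assms[THEN fn_tl, THEN fn_tl] assms[THEN fn_tl, THEN fn_tl, THEN fn_tl])

lemma fn_verifies: "fn 0 (\<lambda>x es. of_bool (verifies x))"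
  unfolding verifies_def
  by (intro fn_conj fn_Ex fn_Suc fn_const fn_hd fn_encoding_ok fn_certificate_ok
      fn_capped_value fn_fst_length fn_fst_bit fn_k_start fn_l_start fn_tl[OF fn_hd] fn_tl[OF fn_tl[OF fn_hd]])

theorem kRiDF_bipartite_in_NP: "kRiDF_problem bipartite \<in> class_NP"
proof -
  have "polytime (\<lambda>x. [verifies x])"
    using polytime_outp[OF outp_bit[OF fn_verifies]] by simp
  then have "{z. verifies z} \<in> class_P" by (simp add: class_P_def)
  then show ?thesis unfolding class_NP_def mem_Collect_eq
    by (intro bexI[of _ "{z. verifies z}"] exI[of _ "[:0, 1, 1:]"] allI)
      (simp_all only: mem_Collect_eq verifies_iff)
qed

theorem theorem10:
  shows "NP_complete (kRiDF_problem bipartite)"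
  unfolding NP_complete_def using kRiDF_bipartite_in_NP NP_hard_kRiDF_bipartite by blast

end
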